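(* Let $M\in\mathcal{HD}_{2,\mathbb{R}}$ and $T_t=e^{tA_M}$. Let $c^M$ be a function in $L^2_{\mathrm{loc}}[0,\infty)$ such that $\mathcal{L}[c^M](z)=M(z)/z$, and let $c^M_t=c^M-S_tc^M$ for $t>0$. Then $\{c^M_t\}_{t>0}$ is a real additive cocycle for the pair $(\{S_t\},\{T_t\})$. Every real additive cocycle for $(\{S_t\},\{T_t\})$ is a scalar multiple of $\{c^M_t\}_{t>0}$.
   Context: Notation: $\mathbb{H}_r=\{z\in\mathbb{C}:\mathrm{Re}\,z>0\}$ with Hardy space $H^2(\mathbb{H}_r)$; $\mathcal{L}[f](z)=\int_0^\infty f(x)e^{-zx}dx$ (for $\mathrm{Re}\,z$ large enough); $(f,g)=\int_0^\infty f(x)g(x)dx$ (bilinear); $L^2_{\mathrm{loc}}[0,\infty)$ is the set of measurable functions square integrable on compact subsets of $[0,\infty)$; $L^2(0,\infty)_{\mathbb{R}}$ is the real Hilbert space of real functions in $L^2(0,\infty)$; $\{S_t\}$ is the shift semigroup $(S_tf)(x)=1_{[t,\infty)}(x)f(x-t)$, also applied to functions in $L^2_{\mathrm{loc}}[0,\infty)$. $\mathcal{HD}$ is the set of holomorphic functions $M$ on $\mathbb{H}_r$ with $M(z)/(1+z)\in H^2(\mathbb{H}_r)$ and $M\notin H^2(\mathbb{H}_r)$. For $M\in\mathcal{HD}$ let $q\in L^2(0,\infty)$ satisfy $\mathcal{L}[q](z)=M(z)/(1+z)$; $A_M$ is the operator $A_Mf=-f'$ whose domain is the set of locally absolutely continuous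 $f\in L^2(0,\infty)$ with $f'\in L^2(0,\infty)$ and $(f-f',q)=0$. $\mathcal{HD}_2$ is the set of $M\in\mathcal{HD}$ such that $A_M$ generates a $C_0$-semigroup and $e^{tA_M}-S_t$ is Hilbert–Schmidt for all $t\ge0$. $\mathcal{HD}_{2,\mathbb{R}}$ is the set of $M\in\mathcal{HD}_2$ with $\overline{M(z)}=M(\overline z)$. For such $M$, $T_t=e^{tA_M}$ preserves $L^2(0,\infty)_{\mathbb{R}}$ and $T_t^*S_t=1$. $G^M_{0,t}=\{f\in L^2(0,\infty)_{\mathbb{R}}:T_t^*f=0\}$. A real additive cocycle for $(\{S_t\},\{T_t\})$ is a measurable family $\{c_t\}_{t>0}$ in $L^2(0,\infty)_{\mathbb{R}}$ with $c_t\in G^M_{0,t}$ for all $t>0$ and $c_{s+t}=c_s+S_sc_t$ for all $s,t>0$. It is known that a function $c^M$ as in the claim exists. *)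

theory Defs
  imports "HOL-Analysis.Analysis"
begin

text \<open>Elements of \<open>L\<^sup>2(0,\<infinity>)\<close> are represented by functions on the real line, of which only
  the values on the half-line matter; equality of elements is equality almost everywhere on
  the half-line. Operators act on representatives.\<close>

abbreviation halfline :: "real measure" where
  "halfline \<equiv> lebesgue_on {0<..}"

abbreviation ae_eq :: "(real \<Rightarrow> complex) \<Rightarrow> (real \<Rightarrow> complex) \<Rightarrow> bool" (infix "\<doteq>" 50) where
  "f \<doteq> g \<equiv> (AE x in halfline. f x = g x)"

definition L2 :: "(real \<Rightarrow> complex) set" where
  "L2 = {f. f \<in> borel_measurable halfline \<and> integrable halfline (\<lambda>x. (norm (f x))\<^sup>2)}"

definition L2_real :: "(real \<Rightarrow> complex) set" where
  "L2_real = {f \<in> L2. AE x in halfline. f x \<in> \<real>}"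

definition L2_loc :: "(real \<Rightarrow> complex) set" where
  "L2_loc = {f. f \<in> borel_measurable (lebesgue_on {0..}) \<and>
     (\<forall>K. compact K \<and> K \<subseteq> {0..} \<longrightarrow> integrable (lebesgue_on K) (\<lambda>x. (norm (f x))\<^sup>2))}"

definition L2_inner :: "(real \<Rightarrow> complex) \<Rightarrow> (real \<Rightarrow> complex) \<Rightarrow> complex" where
  "L2_inner f g = (\<integral>x. f x * cnj (g x) \<partial>halfline)"

definition L2_bilin :: "(real \<Rightarrow> complex) \<Rightarrow> (real \<Rightarrow> complex) \<Rightarrow> complex" where
  "L2_bilin f g = (\<integral>x. f x * g x \<partial>halfline)"

definition L2_norm :: "(real \<Rightarrow> complex) \<Rightarrow> real" where
  "L2_norm f = sqrt (\<integral>x. (norm (f x))\<^sup>2 \<partial>halfline)"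

subsection \<open>Operators on \<open>L\<^sup>2(0,\<infinity>)\<close>\<close>

type_synonym L2_op = "(real \<Rightarrow> complex) \<Rightarrow> (real \<Rightarrow> complex)"

text \<open>Linearity and boundedness force \<open>A f \<doteq> A g\<close> whenever \<open>f \<doteq> g\<close>, so such an \<open>A\<close> does
  define an operator on equivalence classes.\<close>

definition L2_bounded_op :: "L2_op \<Rightarrow> bool" where
  "L2_bounded_op A \<longleftrightarrow>
     (\<forall>f\<in>L2. A f \<in> L2) \<and>
     (\<forall>f\<in>L2. \<forall>g\<in>L2. \<forall>a b. A (\<lambda>x. a * f x + b * g x) \<doteq> (\<lambda>x. a * A f x + b * A g x)) \<and>
     (\<exists>C. \<forall>f\<in>L2. L2_norm (A f) \<le> C * L2_norm f)"

text \<open>\<open>L2_adjoint A f g\<close> states that the adjoint of \<open>A\<close> maps \<open>f\<close> to \<open>g\<close>.\<close>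

definition L2_adjoint :: "L2_op \<Rightarrow> (real \<Rightarrow> complex) \<Rightarrow> (real \<Rightarrow> complex) \<Rightarrow> bool" where
  "L2_adjoint A f g \<longleftrightarrow> f \<in> L2 \<and> g \<in> L2 \<and> (\<forall>h\<in>L2. L2_inner (A h) f = L2_inner h g)"

definition L2_orthonormal_basis :: "(nat \<Rightarrow> real \<Rightarrow> complex) \<Rightarrow> bool" where
  "L2_orthonormal_basis e \<longleftrightarrow>
     (\<forall>n. e n \<in> L2) \<and>
     (\<forall>m n. L2_inner (e m) (e n) = (if m = n then 1 else 0)) \<and>
     (\<forall>f\<in>L2. (\<forall>n. L2_inner f (e n) = 0) \<longrightarrow> f \<doteq> (\<lambda>_. 0))"

definition L2_Hilbert_Schmidt :: "L2_op \<Rightarrow> bool" where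
  "L2_Hilbert_Schmidt A \<longleftrightarrow> L2_bounded_op A \<and>
     (\<exists>e. L2_orthonormal_basis e \<and> summable (\<lambda>n. (L2_norm (A (e n)))\<^sup>2))"

definition C0_semigroup :: "(real \<Rightarrow> L2_op) \<Rightarrow> bool" where
  "C0_semigroup T \<longleftrightarrow>
     (\<forall>t\<ge>0. L2_bounded_op (T t)) \<and>
     (\<forall>f\<in>L2. T 0 f \<doteq> f) \<and>
     (\<forall>s\<ge>0. \<forall>t\<ge>0. \<forall>f\<in>L2. T (s + t) f \<doteq> T s (T t f)) \<and>
     (\<forall>f\<in>L2. ((\<lambda>t. L2_norm (\<lambda>x. T t f x - f x)) \<longlongrightarrow> 0) (at_right 0))"

text \<open>Unbounded operators are given by their graphs, which are closed under almost everywhere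
  equality in both components.\<close>

type_synonym L2_graph = "((real \<Rightarrow> complex) \<times> (real \<Rightarrow> complex)) set"

definition generator :: "(real \<Rightarrow> L2_op) \<Rightarrow> L2_graph" where
  "generator T = {(f, g). f \<in> L2 \<and> g \<in> L2 \<and>
     ((\<lambda>t. L2_norm (\<lambda>x. (T t f x - f x) / of_real t - g x)) \<longlongrightarrow> 0) (at_right 0)}"

definition generates :: "L2_graph \<Rightarrow> (real \<Rightarrow> L2_op) \<Rightarrow> bool" where
  "generates A T \<longleftrightarrow> C0_semigroup T \<and> generator T = A"

definition right_shift :: "real \<Rightarrow> L2_op" where
  "right_shift t f = (\<lambda>x. if t \<le> x then f (x - t) else 0)"

subsection \<open>Locally absolutely continuous functions\<close>

definition absolutely_continuous_on :: "real set \<Rightarrow> (real \<Rightarrow> complex) \<Rightarrow> bool" where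
  "absolutely_continuous_on S f \<longleftrightarrow>
     (\<forall>\<epsilon>>0. \<exists>\<delta>>0. \<forall>\<D> X. \<D> division_of X \<and> X \<subseteq> S \<and> (\<Sum>I\<in>\<D>. Sup I - Inf I) < \<delta> \<longrightarrow>
        (\<Sum>I\<in>\<D>. norm (f (Sup I) - f (Inf I))) < \<epsilon>)"

definition locally_absolutely_continuous :: "(real \<Rightarrow> complex) \<Rightarrow> bool" where
  "locally_absolutely_continuous f \<longleftrightarrow> (\<forall>b\<ge>0. absolutely_continuous_on {0..b} f)"

text \<open>\<open>f\<close> agrees almost everywhere with a locally absolutely continuous function whose
  almost everywhere derivative is \<open>d\<close>.\<close>

definition ac_with_derivative :: "(real \<Rightarrow> complex) \<Rightarrow> (real \<Rightarrow> complex) \<Rightarrow> bool" where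
  "ac_with_derivative f d \<longleftrightarrow>
     (\<exists>f\<^sub>0. f\<^sub>0 \<doteq> f \<and> locally_absolutely_continuous f\<^sub>0 \<and>
        (AE x in halfline. (f\<^sub>0 has_vector_derivative d x) (at x)))"

subsection \<open>Hardy space and Laplace transform\<close>

definition right_half_plane :: "complex set" where
  "right_half_plane = {z. Re z > 0}"

definition Hardy2 :: "(complex \<Rightarrow> complex) set" where
  "Hardy2 = {F. F holomorphic_on right_half_plane \<and>
     (\<exists>C::real. \<forall>x>0. (\<integral>\<^sup>+y. ennreal ((norm (F (Complex x y)))\<^sup>2) \<partial>lborel) \<le> ennreal C)}"

definition has_laplace :: "(real \<Rightarrow> complex) \<Rightarrow> complex \<Rightarrow> complex \<Rightarrow> bool" where
  "has_laplace f z w \<longleftrightarrow>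
     integrable halfline (\<lambda>x. f x * exp (- (z * of_real x))) \<and>
     (\<integral>x. f x * exp (- (z * of_real x)) \<partial>halfline) = w"

subsection \<open>The operators \<open>A\<^sub>M\<close> and the classes of \<open>M\<close>\<close>

definition HD :: "(complex \<Rightarrow> complex) set" where
  "HD = {M. M holomorphic_on right_half_plane \<and> (\<lambda>z. M z / (1 + z)) \<in> Hardy2 \<and> M \<notin> Hardy2}"

text \<open>For \<open>M \<in> HD\<close> the function \<open>q\<close> below exists and is unique up to null sets, by the
  Paley-Wiener theorem.\<close>

definition A_op :: "(complex \<Rightarrow> complex) \<Rightarrow> L2_graph" where
  "A_op M = {(f, \<lambda>x. - f' x) | f f'. f \<in> L2 \<and> f' \<in> L2 \<and> ac_with_derivative f f' \<and>
     (\<exists>q\<in>L2. (\<forall>z\<in>right_half_plane. has_laplace q z (M z / (1 + z))) \<and>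
        L2_bilin (\<lambda>x. f x - f' x) q = 0)}"

definition HD2 :: "(complex \<Rightarrow> complex) set" where
  "HD2 = {M \<in> HD. \<exists>T. generates (A_op M) T \<and>
     (\<forall>t\<ge>0. L2_Hilbert_Schmidt (\<lambda>f x. T t f x - right_shift t f x))}"

definition HD2_real :: "(complex \<Rightarrow> complex) set" where
  "HD2_real = {M \<in> HD2. \<forall>z\<in>right_half_plane. cnj (M z) = M (cnj z)}"

subsection \<open>Additive cocycles\<close>

definition G0 :: "(real \<Rightarrow> L2_op) \<Rightarrow> real \<Rightarrow> (real \<Rightarrow> complex) set" where
  "G0 T t = {f \<in> L2_real. L2_adjoint (T t) f (\<lambda>_. 0)}"

text \<open>Measurability of the family is stated weakly; as \<open>L\<^sup>2(0,\<infinity>)\<close> is separable, this is the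
  same as strong measurability.\<close>

definition real_additive_cocycle ::
    "(real \<Rightarrow> L2_op) \<Rightarrow> (real \<Rightarrow> L2_op) \<Rightarrow> (real \<Rightarrow> real \<Rightarrow> complex) \<Rightarrow> bool" where
  "real_additive_cocycle S T c \<longleftrightarrow>
     (\<forall>t>0. c t \<in> L2_real) \<and>
     (\<forall>g\<in>L2_real. (\<lambda>t. L2_inner (c t) g) \<in> borel_measurable (lebesgue_on {0<..})) \<and>
     (\<forall>t>0. c t \<in> G0 T t) \<and>
     (\<forall>s>0. \<forall>t>0. c (s + t) \<doteq> (\<lambda>x. c s x + S s (c t) x))"

end

theory Submission
  imports Defs
begin

text \<open>
The function with Laplace transform \<open>M z / z\<close> can be written down: if \<open>q\<close> has the transform
\<open>M z / (1 + z)\<close>, then \<open>c x = q x + \<integral>\<^sub>0\<^sup>x q\<close>, because \<open>(1 + 1 / z) / (1 + z) = 1 / z\<close> and Laplace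
transforms are unique. The difference \<open>c - S\<^sub>t c\<close> is then \<open>q - S\<^sub>t q + \<integral>\<^sub>0\<^sup>t S\<^sub>r q dr\<close>, which is square
integrable, and \<open>c\<close> is real since its conjugate has the same transform on the real axis.

The generator acts as \<open>- f'\<close> in the interior, so the semigroup transports functions to the right:
\<open>T\<^sub>t f\<close> equals the shift of \<open>f\<close> on \<open>[t, \<infinity>)\<close>, that is, \<open>(T\<^sub>t f, S\<^sub>t g) = (f, g)\<close> (lemma \<open>transport\<close>). For
\<open>f\<close> in the domain this holds because the integral of \<open>T\<^sub>s f\<close> over the moving interval \<open>[s, b + s]\<close> has
derivative \<open>0\<close>; the domain is dense. The boundary condition \<open>(f - f', q) = 0\<close>, applied to
\<open>\<integral>\<^sub>0\<^sup>t T\<^sub>s h ds\<close>, whose derivative is \<open>h - T\<^sub>t h\<close>, becomes \<open>(T\<^sub>t h, c - S\<^sub>t c) = 0\<close> after the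
pairings have been rewritten by the transport identity (lemma \<open>bil_cocycle_zero\<close>). This is the condition
\<open>T\<^sub>t\<^sup>* (c - S\<^sub>t c) = 0\<close>; the cocycle identity is telescoping.

Conversely, let \<open>d\<close> be a cocycle. On \<open>[0, N + 1]\<close> it is \<open>\<kappa> - S\<^sub>t \<kappa>\<close> with \<open>\<kappa> = d\<^bsub>N + 1\<^esub>\<close>. Differentiating
\<open>(T\<^sub>t f, d\<^sub>t) = 0\<close> at \<open>t = 0\<close> for \<open>f\<close> in the domain with support in \<open>[0, N]\<close> gives
\<open>(f', \<kappa>) = 0\<close> (lemma \<open>cocycle_orthogonal_graph\<close>). The domain is cut out by one linear condition, which
for such \<open>f\<close> reads \<open>(f', c) = 0\<close>. So the functional given by \<open>\<kappa>\<close> vanishes on the kernel of the one given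
by \<open>c\<close>, and hence \<open>\<kappa>\<close> is a multiple of \<open>c\<close> (lemma \<open>real_additive_cocycle_unique\<close>). Piecewise linear
\<open>f\<close> suffice as test functions.

Three tools are developed for this: the Banach space of classes of square integrable
functions, the elementary theory of strongly continuous semigroups up to the density of the domain
of the generator, and the fundamental theorem of calculus for absolutely continuous functions.
\<close>

section \<open>The Hilbert space of square integrable functions on the half-line\<close>

lemma L2D: 
  assumes "f \<in> L2" shows "f \<in> borel_measurable halfline" "integrable halfline (\<lambda>x. (norm (f x))\<^sup>2)"
  using assms by (auto simp: L2_def)

lemma L2I: "f \<in> borel_measurable halfline \<Longrightarrow> integrable halfline (\<lambda>x. (norm (f x))\<^sup>2) \<Longrightarrow> f \<in> L2"
  by (auto simp: L2_def)

lemma L2_bound: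
  assumes "g \<in> borel_measurable halfline" "integrable halfline h" "AE x in halfline. (norm (g x))\<^sup>2 \<le> h x"
  shows "g \<in> L2"
proof (rule L2I)
  show "integrable halfline (\<lambda>x. (norm (g x))\<^sup>2)"
    using assms by (intro Bochner_Integration.integrable_bound[OF assms(2)]) (auto elim: eventually_mono)
qed fact

lemma L2_mult_integrable:
  assumes "f \<in> L2" "g \<in> L2"
  shows "integrable halfline (\<lambda>x. f x * g x)"
proof (rule Bochner_Integration.integrable_bound)
  show "integrable halfline (\<lambda>x. (norm (f x))\<^sup>2 + (norm (g x))\<^sup>2)"
    using assms by (auto simp: L2_def)
  show "(\<lambda>x. f x * g x) \<in> borel_measurable halfline"
    using assms by (auto simp: L2_def)
  have "norm (f x) * norm (g x) \<le> (norm (f x))\<^sup>2 + (norm (g x))\<^sup>2" for x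
    using sum_squares_bound[of "norm (f x)" "norm (g x)"]
      mult_nonneg_nonneg[OF norm_ge_zero[of "f x"] norm_ge_zero[of "g x"]] by linarith
  then show "AE x in halfline. norm (f x * g x) \<le> norm ((norm (f x))\<^sup>2 + (norm (g x))\<^sup>2)"
    by (auto simp: norm_mult)
qed

lemma L2_cnj: "f \<in> L2 \<Longrightarrow> (\<lambda>x. cnj (f x)) \<in> L2"
  by (auto simp: L2_def intro: borel_measurable_continuous_on[where f=cnj] continuous_on_cnj continuous_on_id)

lemma L2_inner_integrable:
  assumes "f \<in> L2" "g \<in> L2"
  shows "integrable halfline (\<lambda>x. f x * cnj (g x))"
  using L2_mult_integrable[OF assms(1) L2_cnj[OF assms(2)]] .

lemma L2_add: 
  assumes "f \<in> L2" "g \<in> L2" shows "(\<lambda>x. f x + g x) \<in> L2"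
proof (rule L2_bound)
  show "integrable halfline (\<lambda>x. 2 * (norm (f x))\<^sup>2 + 2 * (norm (g x))\<^sup>2)"
    using assms by (auto simp: L2_def)
  show "(\<lambda>x. f x + g x) \<in> borel_measurable halfline"
    using assms by (auto simp: L2_def)
  have "(norm (f x + g x))\<^sup>2 \<le> (norm (f x) + norm (g x))\<^sup>2" for x
    by (intro power_mono norm_triangle_ineq) auto
  also have "(norm (f x) + norm (g x))\<^sup>2 \<le> 2 * (norm (f x))\<^sup>2 + 2 * (norm (g x))\<^sup>2" for x
    using sum_squares_bound[of "norm (f x)" "norm (g x)"] by (simp add: power2_sum)
  finally show "AE x in halfline. (norm (f x + g x))\<^sup>2 \<le> 2 * (norm (f x))\<^sup>2 + 2 * (norm (g x))\<^sup>2"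
    by auto
qed

lemma L2_cmult: "f \<in> L2 \<Longrightarrow> (\<lambda>x. a * f x) \<in> L2"
  by (auto simp: L2_def norm_mult power_mult_distrib)

lemma L2_zero: "(\<lambda>_. 0) \<in> L2"
  by (auto simp: L2_def)

lemma L2_uminus: "f \<in> L2 \<Longrightarrow> (\<lambda>x. - f x) \<in> L2"
  using L2_cmult[of f "-1"] by simp

lemma L2_diff: "f \<in> L2 \<Longrightarrow> g \<in> L2 \<Longrightarrow> (\<lambda>x. f x - g x) \<in> L2"
  using L2_add[OF _ L2_uminus, of f g] by simp

lemma L2_divide: "f \<in> L2 \<Longrightarrow> (\<lambda>x. f x / a) \<in> L2"
  using L2_cmult[of f "1/a"] by simp

text \<open>The semigroup arguments integrate \<open>L\<^sup>2\<close>-valued orbits, so the classes of functions modulo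
null sets are made into a type on which the library's integral and limits are available. Only the
real scalars are needed for this, with the real part of the inner product; complex scalars stay
with the representing functions.\<close>

quotient_type l2 = "real \<Rightarrow> complex" / partial: "\<lambda>f g. f \<in> L2 \<and> g \<in> L2 \<and> f \<doteq> g"
  morphisms rep_l2 cls
proof (rule part_equivpI)
  show "\<exists>x. x \<in> L2 \<and> x \<in> L2 \<and> (x \<doteq> x)" by (auto intro!: exI[of _ "\<lambda>_. 0"] L2_zero)
  show "symp (\<lambda>f g. f \<in> L2 \<and> g \<in> L2 \<and> f \<doteq> g)"
    by (auto intro!: sympI elim: eventually_mono)
  show "transp (\<lambda>f g. f \<in> L2 \<and> g \<in> L2 \<and> f \<doteq> g)"
    by (intro transpI) (auto elim: eventually_elim2)
qed

lemma cls_eq_iff: "f \<in> L2 \<Longrightarrow> g \<in> L2 \<Longrightarrow> cls f = cls g \<longleftrightarrow> f \<doteq> g"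
  using Quotient_rel[OF Quotient_l2, of f g] by auto

lemma rep_l2_L2: "rep_l2 x \<in> L2"
  using Quotient_rep_reflp[OF Quotient_l2, of x] by auto

lemma cls_rep_l2 [simp]: "cls (rep_l2 x) = x"
  using Quotient_abs_rep[OF Quotient_l2] by auto

lemma rep_l2_cls: "f \<in> L2 \<Longrightarrow> rep_l2 (cls f) \<doteq> f"
  using cls_eq_iff[OF rep_l2_L2, of f "cls f"] by simp

lemma l2_cases: obtains f where "f \<in> L2" "x = cls f"
  using rep_l2_L2[of x] cls_rep_l2[of x] by metis

lemma L2_inner_self: "f \<in> L2 \<Longrightarrow> Re (L2_inner f f) = (\<integral>x. (norm (f x))\<^sup>2 \<partial>halfline)"
  unfolding L2_inner_def complex_norm_square[symmetric] of_real_power[symmetric]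
  by (simp del: of_real_power)

lemma L2_inner_cong:
  assumes "f \<in> L2" "f' \<in> L2" "f \<doteq> f'" "g \<in> L2" "g' \<in> L2" "g \<doteq> g'"
  shows "L2_inner f g = L2_inner f' g'"
  unfolding L2_inner_def
  by (rule integral_cong_AE) (use assms in \<open>auto intro!: borel_measurable_integrable L2_inner_integrable elim: eventually_elim2\<close>)

lemma L2_bilin_cong:
  assumes "f \<in> L2" "f' \<in> L2" "f \<doteq> f'" "g \<in> L2" "g' \<in> L2" "g \<doteq> g'"
  shows "L2_bilin f g = L2_bilin f' g'"
  unfolding L2_bilin_def
  by (rule integral_cong_AE) (use assms in \<open>auto intro!: borel_measurable_integrable L2_mult_integrable elim: eventually_elim2\<close>)

instantiation l2 :: real_inner
begin

lift_definition zero_l2 :: l2 is "\<lambda>_. 0" by (auto simp: L2_zero)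

lift_definition plus_l2 :: "l2 \<Rightarrow> l2 \<Rightarrow> l2" is "\<lambda>f g x. f x + g x"
  by (auto simp: L2_add elim: eventually_elim2)

lift_definition minus_l2 :: "l2 \<Rightarrow> l2 \<Rightarrow> l2" is "\<lambda>f g x. f x - g x"
  by (auto simp: L2_diff elim: eventually_elim2)

lift_definition uminus_l2 :: "l2 \<Rightarrow> l2" is "\<lambda>f x. - f x"
  by (auto simp: L2_uminus elim: eventually_mono)

lift_definition scaleR_l2 :: "real \<Rightarrow> l2 \<Rightarrow> l2" is "\<lambda>a f x. of_real a * f x"
  by (auto simp: L2_cmult elim: eventually_mono)

lift_definition inner_l2 :: "l2 \<Rightarrow> l2 \<Rightarrow> real" is "\<lambda>f g. Re (L2_inner f g)"
  by (metis L2_inner_cong)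

definition norm_l2 :: "l2 \<Rightarrow> real" where "norm_l2 x = sqrt (inner x x)"
definition dist_l2 :: "l2 \<Rightarrow> l2 \<Rightarrow> real" where "dist_l2 x y = norm (x - y)"
definition sgn_l2 :: "l2 \<Rightarrow> l2" where "sgn_l2 x = inverse (norm x) *\<^sub>R x"
definition uniformity_l2 :: "(l2 \<times> l2) filter"
  where "uniformity_l2 = (INF e\<in>{0<..}. principal {(x, y). dist x y < e})"
definition open_l2 :: "l2 set \<Rightarrow> bool"
  where "open_l2 S = (\<forall>x\<in>S. \<forall>\<^sub>F (x', y) in uniformity. x' = x \<longrightarrow> y \<in> S)"

instance
proof
  fix x y z :: l2 and a b :: real
  show "x + y + z = x + (y + z)"
    by transfer (simp add: add.assoc L2_add)
  show "x + y = y + x"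
    by transfer (simp add: add.commute L2_add)
  show "0 + x = x"
    by transfer (simp add: L2_add L2_zero)
  show "- x + x = 0"
    by transfer (simp add: L2_add L2_zero L2_uminus)
  show "x - y = x + - y"
    by transfer (simp add: L2_add L2_diff L2_uminus)
  show "a *\<^sub>R (x + y) = a *\<^sub>R x + a *\<^sub>R y"
    by transfer (simp add: L2_add L2_cmult distrib_left)
  show "(a + b) *\<^sub>R x = a *\<^sub>R x + b *\<^sub>R x"
    by transfer (simp add: L2_add L2_cmult distrib_right)
  show "a *\<^sub>R b *\<^sub>R x = (a * b) *\<^sub>R x"
    by transfer (simp add: L2_cmult mult.assoc)
  show "1 *\<^sub>R x = x"
    by transfer simp
  show "dist x y = norm (x - y)" by (rule dist_l2_def)
  show "sgn x = inverse (norm x) *\<^sub>R x" by (rule sgn_l2_def)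
  show "uniformity = (INF e\<in>{0<..}. principal {(x, y). dist (x::l2) y < e})" by (rule uniformity_l2_def)
  show "open S \<longleftrightarrow> (\<forall>x\<in>S. \<forall>\<^sub>F (x', y) in uniformity. x' = x \<longrightarrow> y \<in> S)" for S :: "l2 set" by (rule open_l2_def)
  show "norm x = sqrt (inner x x)" by (rule norm_l2_def)
  show "inner x y = inner y x"
  proof transfer
    fix f g assume "f \<in> L2 \<and> f \<in> L2 \<and> f \<doteq> f" "g \<in> L2 \<and> g \<in> L2 \<and> g \<doteq> g"
    then have *: "integrable halfline (\<lambda>x. f x * cnj (g x))" "integrable halfline (\<lambda>x. g x * cnj (f x))"
      by (auto intro: L2_inner_integrable)
    have "L2_inner f g = cnj (L2_inner g f)"
      unfolding L2_inner_def Bochner_Integration.integral_cnj[symmetric] by (simp add: mult.commute)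
    then show "Re (L2_inner f g) = Re (L2_inner g f)" by simp
  qed
  show "inner (x + y) z = inner x z + inner y z"
    by transfer (auto simp: L2_inner_def distrib_right Bochner_Integration.integral_add L2_inner_integrable)
  show "inner (a *\<^sub>R x) y = a * inner x y"
    by transfer (simp add: L2_inner_def mult.assoc L2_inner_integrable)
  show "0 \<le> inner x x"
    by transfer (auto simp: L2_inner_self)
  show "inner x x = 0 \<longleftrightarrow> x = 0"
  proof transfer
    fix f :: "real \<Rightarrow> complex" assume f: "f \<in> L2 \<and> f \<in> L2 \<and> f \<doteq> f"
    then have "(\<integral>x. (norm (f x))\<^sup>2 \<partial>halfline) = 0 \<longleftrightarrow> (AE x in halfline. (norm (f x))\<^sup>2 = 0)"
      by (intro integral_nonneg_eq_0_iff_AE) (auto simp: L2_def)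
    then show "(Re (L2_inner f f) = 0) = (f \<in> L2 \<and> (\<lambda>_. 0) \<in> L2 \<and> f \<doteq> (\<lambda>_. 0))"
      using f by (simp add: L2_inner_self L2_zero)
  qed
qed

end

lemma cls_add: "f \<in> L2 \<Longrightarrow> g \<in> L2 \<Longrightarrow> cls f + cls g = cls (\<lambda>x. f x + g x)"
  by (simp add: plus_l2.abs_eq)
lemma cls_diff: "f \<in> L2 \<Longrightarrow> g \<in> L2 \<Longrightarrow> cls f - cls g = cls (\<lambda>x. f x - g x)"
  by (simp add: minus_l2.abs_eq)
lemma cls_scaleR: "f \<in> L2 \<Longrightarrow> a *\<^sub>R cls f = cls (\<lambda>x. of_real a * f x)"
  by (simp add: scaleR_l2.abs_eq)
lemma cls_zero: "cls (\<lambda>_. 0) = 0"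
  by (simp add: zero_l2.abs_eq)
lemma norm_cls: "f \<in> L2 \<Longrightarrow> norm (cls f) = L2_norm f"
  by (simp add: norm_l2_def inner_l2.abs_eq L2_inner_self L2_norm_def)

lemma L2_norm_sq: "L2_norm f ^ 2 = (\<integral>x. (norm (f x))\<^sup>2 \<partial>halfline)"
  by (simp add: L2_norm_def)

text \<open>Completeness in the manner of Riesz and Fischer. The weights \<open>2\<^sup>n\<close> turn the fast decay of the
norms of the increments into \<open>\<Sum>n. 2\<^sup>n |f (n + 1) - f n|\<^sup>2 < \<infinity>\<close> almost everywhere; by the
arithmetic-geometric mean inequality the increments are then absolutely summable, so the sequence
converges pointwise, and Fatou's lemma upgrades this to convergence in norm. The Cauchy property
is assumed separately so that Fatou's lemma gives the rate directly.\<close>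

lemma L2_Cauchy_limit:
  assumes f: "\<And>n. f n \<in> L2" 
   and fast: "\<And>n. L2_norm (\<lambda>x. f (Suc n) x - f n x) \<le> (1/2)^n"
   and C: "\<And>e. e > 0 \<Longrightarrow> \<exists>N. \<forall>m\<ge>N. \<forall>n\<ge>N. L2_norm (\<lambda>x. f m x - f n x) \<le> e"
  shows "\<exists>g\<in>L2. (\<lambda>n. L2_norm (\<lambda>x. f n x - g x)) \<longlonglongrightarrow> 0"
proof -
  have [measurable]: "f n \<in> borel_measurable halfline" for n using f by (auto simp: L2_def)
  define D where "D n x = f (Suc n) x - f n x" for n x
  have D: "D n \<in> L2" for n unfolding D_def by (intro L2_diff f)
  have [measurable]: "D n \<in> borel_measurable halfline" for n using D by (auto simp: L2_def)
  have nn_sq: "(\<integral>\<^sup>+x. ennreal ((norm (h x))\<^sup>2) \<partial>halfline) = ennreal ((L2_norm h)\<^sup>2)" if "h \<in> L2" for h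
    unfolding L2_norm_sq using that by (intro nn_integral_eq_integral) (auto simp: L2_def)
  have "(\<integral>\<^sup>+x. (\<Sum>n. ennreal (2^n * (norm (D n x))\<^sup>2)) \<partial>halfline) = (\<Sum>n. \<integral>\<^sup>+x. ennreal (2^n * (norm (D n x))\<^sup>2) \<partial>halfline)"
    by (rule nn_integral_suminf) measurable
  also have "\<dots> = (\<Sum>n. ennreal (2^n * (L2_norm (D n))\<^sup>2))"
    using nn_sq[OF D] by (simp add: ennreal_mult nn_integral_cmult)
  also have "\<dots> \<le> (\<Sum>n. ennreal ((1/2)^n))"
  proof (rule suminf_le)
    fix n
    have "(L2_norm (D n))\<^sup>2 \<le> ((1/2)^n)\<^sup>2"
      using fast[of n] unfolding D_def by (intro power_mono) (auto simp: L2_norm_def)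
    then have "2^n * (L2_norm (D n))\<^sup>2 \<le> 2^n * ((1/2)^n)\<^sup>2" by simp
    also have "\<dots> = (1/2)^n" by (simp add: power2_eq_square power_one_over)
    finally show "ennreal (2^n * (L2_norm (D n))\<^sup>2) \<le> ennreal ((1/2)^n)" by (rule ennreal_leI)
  qed auto
  also have "\<dots> = ennreal (\<Sum>n. (1/2)^n)"
    by (rule suminf_ennreal2) (auto simp: summable_geometric)
  finally have "(\<integral>\<^sup>+x. (\<Sum>n. ennreal (2^n * (norm (D n x))\<^sup>2)) \<partial>halfline) \<noteq> \<infinity>"
    by (auto simp: top_unique)
  then have "AE x in halfline. (\<Sum>n. ennreal (2^n * (norm (D n x))\<^sup>2)) \<noteq> \<infinity>"
    by (intro nn_integral_PInf_AE) measurable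
  then have conv: "AE x in halfline. convergent (\<lambda>n. f n x)"
  proof eventually_elim
    case (elim x)
    then have S: "summable (\<lambda>n. 2^n * (norm (D n x))\<^sup>2)"
      by (intro summable_suminf_not_top) auto
    have "summable (\<lambda>n. norm (D n x))"
    proof (rule summable_comparison_test')
      show "summable (\<lambda>n. 2^n * (norm (D n x))\<^sup>2 + (1/2)^n)"
        by (intro summable_add S) (auto simp: summable_geometric)
      fix n :: nat
      \<comment> \<open>The product \<open>a b\<close> is the increment, and \<open>a b \<le> a\<^sup>2 + b\<^sup>2\<close> is the comparison.\<close>
      define a b where "a = sqrt (2^n) * norm (D n x)" and "b = 1 / sqrt (2^n)"
      have "a * b = norm (D n x)" "a^2 = 2^n * (norm (D n x))\<^sup>2" "b^2 = (1/2)^n"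
        by (auto simp: a_def b_def power_mult_distrib power_one_over power_divide)
      moreover have "2 * (a*b) \<le> a^2+b^2" using sum_squares_bound[of a b] by (simp only: mult.assoc)
      ultimately show "norm (norm (D n x)) \<le> 2^n * (norm (D n x))\<^sup>2 + (1/2)^n"
        using norm_ge_zero[of "D n x"] by (simp only: real_norm_def abs_norm_cancel)
    qed
    then have "summable (\<lambda>n. D n x)" by (rule summable_norm_cancel)
    then have "convergent (\<lambda>n. \<Sum>i<n. D i x)" by (simp add: summable_iff_convergent)
    moreover have "(\<Sum>i<n. D i x) = f n x - f 0 x" for n
      unfolding D_def by (rule sum_lessThan_telescope)
    ultimately have "convergent (\<lambda>n. (f n x - f 0 x) + f 0 x)" by (intro convergent_add convergent_const) simp
    then show ?case by simp
  qed
  define g where "g x = lim (\<lambda>n. f n x)" for x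
  have [measurable]: "g \<in> borel_measurable halfline" unfolding g_def by measurable
  have lim: "AE x in halfline. (\<lambda>n. f n x) \<longlonglongrightarrow> g x"
    using conv by eventually_elim (simp add: g_def convergent_LIMSEQ_iff)
  have fatou: "(\<integral>\<^sup>+x. ennreal ((norm (f n x - g x))\<^sup>2) \<partial>halfline) \<le> ennreal (e^2)"
    if e: "\<forall>m\<ge>N. L2_norm (\<lambda>x. f n x - f m x) \<le> e" "e > 0" for n N e
  proof -
    have "(\<integral>\<^sup>+x. ennreal ((norm (f n x - g x))\<^sup>2) \<partial>halfline)
        = (\<integral>\<^sup>+x. liminf (\<lambda>m. ennreal ((norm (f n x - f m x))\<^sup>2)) \<partial>halfline)"
    proof (rule nn_integral_cong_AE, use lim in eventually_elim)
      case (elim x)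
      have "(\<lambda>m. ennreal ((norm (f n x - f m x))\<^sup>2)) \<longlonglongrightarrow> ennreal ((norm (f n x - g x))\<^sup>2)"
        by (intro tendsto_ennrealI tendsto_intros elim)
      from lim_imp_Liminf[OF _ this] show ?case by simp
    qed
    also have "\<dots> \<le> liminf (\<lambda>m. (\<integral>\<^sup>+x. ennreal ((norm (f n x - f m x))\<^sup>2) \<partial>halfline))"
      by (rule nn_integral_liminf) measurable
    also have "\<dots> = liminf (\<lambda>m. ennreal ((L2_norm (\<lambda>x. f n x - f m x))\<^sup>2))"
      by (subst nn_sq) (auto intro!: L2_diff f)
    also have "\<dots> \<le> liminf (\<lambda>m. ennreal (e^2))"
      by (intro Liminf_mono eventually_sequentiallyI[of N] ennreal_leI power_mono) (use e in \<open>auto simp: L2_norm_def\<close>)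
    also have "\<dots> = ennreal (e^2)" by (simp add: Liminf_const)
    finally show ?thesis .
  qed
  obtain N1 where "\<forall>m\<ge>N1. \<forall>n\<ge>N1. L2_norm (\<lambda>x. f m x - f n x) \<le> 1" using C[of 1] by auto
  then have "(\<integral>\<^sup>+x. ennreal ((norm (f N1 x - g x))\<^sup>2) \<partial>halfline) \<le> ennreal (1^2)" 
    by (intro fatou[of N1]) auto
  then have "(\<lambda>x. f N1 x - g x) \<in> L2"
    by (intro L2I integrableI_bounded) (auto simp: top_unique less_top[symmetric])
  from L2_diff[OF f this, of N1] have g: "g \<in> L2" by simp
  show ?thesis
  proof (intro bexI[OF _ g] metric_LIMSEQ_I)
    fix e :: real assume e: "e > 0"
    then obtain N where N: "\<forall>m\<ge>N. \<forall>n\<ge>N. L2_norm (\<lambda>x. f m x - f n x) \<le> e/2" using C[of "e/2"] by auto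
    have bound: "L2_norm (\<lambda>x. f n x - g x) \<le> e/2" if "n \<ge> N" for n
    proof -
      have "ennreal ((L2_norm (\<lambda>x. f n x - g x))\<^sup>2) \<le> ennreal ((e/2)^2)"
        unfolding nn_sq[OF L2_diff[OF f g], symmetric] using fatou[of N n "e/2"] N that e by auto
      then have "(L2_norm (\<lambda>x. f n x - g x))\<^sup>2 \<le> (e/2)^2" by (subst (asm) ennreal_le_iff) auto
      then show ?thesis by (rule power2_le_imp_le) (use e in simp)
    qed
    have "dist (L2_norm (\<lambda>x. f n x - g x)) 0 < e" if "n \<ge> N" for n
    proof -
      have "L2_norm (\<lambda>x. f n x - g x) \<le> e/2" by (rule bound) fact
      moreover have "L2_norm (\<lambda>x. f n x - g x) \<ge> 0" by (simp add: L2_norm_def)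
      ultimately show ?thesis using e unfolding dist_real_def by linarith
    qed
    then show "\<exists>N. \<forall>n\<ge>N. dist (L2_norm (\<lambda>x. f n x - g x)) 0 < e" by blast
  qed
qed

instance l2 :: banach
proof
  fix X :: "nat \<Rightarrow> l2" assume X: "Cauchy X"
  have "\<exists>N. \<forall>k. \<forall>m\<ge>N k. \<forall>n\<ge>N k. dist (X m) (X n) < (1/2)^k"
    using X unfolding Cauchy_def by (intro choice) auto
  then obtain N where N: "\<And>k m n. m \<ge> N k \<Longrightarrow> n \<ge> N k \<Longrightarrow> dist (X m) (X n) < (1/2)^k" by blast
  \<comment> \<open>By summation \<open>r k\<close> and \<open>r (k + 1)\<close> are both at least \<open>N k\<close>.\<close>
  define r where "r k = (\<Sum>j\<le>k. N j) + k" for k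
  have rN: "r k \<ge> N k" "r (Suc k) \<ge> N k" "r k \<ge> k" for k
    using member_le_sum[of k "{..k}" N] by (auto simp: r_def)
  define f where "f k = rep_l2 (X (r k))" for k
  have f: "f k \<in> L2" "cls (f k) = X (r k)" for k by (auto simp: f_def rep_l2_L2)
  have fd: "L2_norm (\<lambda>x. f m x - f n x) = dist (X (r m)) (X (r n))" for m n
    using f by (simp add: dist_norm norm_cls[symmetric] L2_diff cls_diff[symmetric])
  obtain g where g: "g \<in> L2" "(\<lambda>n. L2_norm (\<lambda>x. f n x - g x)) \<longlonglongrightarrow> 0"
  proof (rule bexE[OF L2_Cauchy_limit[of f]])
    show "L2_norm (\<lambda>x. f (Suc n) x - f n x) \<le> (1/2)^n" for n
      unfolding fd using N[of n "r (Suc n)" "r n"] rN[of n] by (simp add: less_imp_le)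
    show "\<exists>N. \<forall>m\<ge>N. \<forall>n\<ge>N. L2_norm (\<lambda>x. f m x - f n x) \<le> e" if e: "e > 0" for e
    proof -
      obtain K where "\<forall>m\<ge>K. \<forall>n\<ge>K. dist (X m) (X n) < e" using X e unfolding Cauchy_def by blast
      then show ?thesis unfolding fd using rN(3) by (intro exI[of _ K]) (meson less_imp_le order_trans)
    qed
  qed (use f in auto)
  then have lim: "(\<lambda>k. X (r k)) \<longlonglongrightarrow> cls g"
    using f by (subst tendsto_dist_iff) (simp add: dist_norm norm_cls[symmetric] L2_diff cls_diff[symmetric])
  have "X \<longlonglongrightarrow> cls g"
  proof (rule metric_LIMSEQ_I)
    fix e :: real assume e: "e > 0"
    then have e2: "e/2 > 0" by simp
    obtain K where K: "\<And>m n. m\<ge>K \<Longrightarrow> n\<ge>K \<Longrightarrow> dist (X m) (X n) < e/2" 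
      using X e2 unfolding Cauchy_def by blast
    obtain L where L: "\<And>k. k \<ge> L \<Longrightarrow> dist (X (r k)) (cls g) < e/2" using metric_LIMSEQ_D[OF lim e2] by blast
    have "dist (X n) (cls g) < e" if "n \<ge> K" for n
    proof -
      have "r (max K L) \<ge> K" using rN(3)[of "max K L"] by simp
      then have "dist (X n) (X (r (max K L))) < e/2" by (intro K that)
      moreover have "dist (X (r (max K L))) (cls g) < e/2" by (intro L) simp
      ultimately show ?thesis using dist_triangle[of "X n" "cls g" "X (r (max K L))"] by linarith
    qed
    then show "\<exists>no. \<forall>n\<ge>no. dist (X n) (cls g) < e" by blast
  qed
  then show "convergent X" by (rule convergentI)
qed

text \<open>The bilinear pairing \<open>(f, g) = \<integral>f g\<close>. As a bounded bilinear map with complex values on the real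
space it commutes with limits and integrals in either argument, and it detects complex
orthogonality without conjugations.\<close>

lift_definition bil :: "l2 \<Rightarrow> l2 \<Rightarrow> complex" is L2_bilin
  by (blast intro: L2_bilin_cong)

lemma bil_cls: "f \<in> L2 \<Longrightarrow> g \<in> L2 \<Longrightarrow> bil (cls f) (cls g) = L2_bilin f g"
  by (simp add: bil.abs_eq)

lemma L2_Re_inner_le:
  assumes "f \<in> L2" "g \<in> L2" shows "Re (L2_inner f g) \<le> L2_norm f * L2_norm g"
  using norm_cauchy_schwarz[of "cls f" "cls g"] assms by (simp add: norm_cls inner_l2.abs_eq)

lemma L2_norm_mult_integral_le:
  assumes f: "f \<in> L2" and g: "g \<in> L2" shows "(\<integral>x. norm (f x * g x) \<partial>halfline) \<le> L2_norm f * L2_norm g"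
proof -
  let ?f = "\<lambda>x. of_real (norm (f x)) :: complex" and ?g = "\<lambda>x. of_real (norm (g x)) :: complex"
  have norm_L2: "(\<lambda>x. of_real (norm (h x)) :: complex) \<in> L2" if "h \<in> L2" for h
  proof (rule L2I)
    have [measurable]: "h \<in> borel_measurable halfline" using L2D[OF that] by simp
    show "(\<lambda>x. of_real (norm (h x)) :: complex) \<in> borel_measurable halfline" by measurable
    show "integrable halfline (\<lambda>x. (norm (of_real (norm (h x)) :: complex))\<^sup>2)"
      using L2D[OF that] by simp
  qed
  have fg: "?f \<in> L2" "?g \<in> L2" using norm_L2 f g by blast+
  have "L2_inner ?f ?g = of_real (\<integral>x. norm (f x * g x) \<partial>halfline)"
  proof -
    have "L2_inner ?f ?g = (\<integral>x. of_real (norm (f x * g x)) \<partial>halfline)"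
      unfolding L2_inner_def by (simp add: norm_mult)
    then show ?thesis by (simp only: integral_complex_of_real)
  qed
  then show ?thesis using L2_Re_inner_le[OF fg] by (simp add: L2_norm_def)
qed

interpretation bil: bounded_bilinear bil
proof
  fix a b c :: l2 and r :: real
  show "bil (a + b) c = bil a c + bil b c"
    by transfer (auto simp: L2_bilin_def distrib_right L2_mult_integrable)
  show "bil a (b + c) = bil a b + bil a c"
    by transfer (auto simp: L2_bilin_def distrib_left L2_mult_integrable)
  obtain f g where *: "f \<in> L2" "a = cls f" "g \<in> L2" "b = cls g" by (metis l2_cases)
  have "(\<integral>x. of_real r * f x * g x \<partial>halfline) = of_real r * (\<integral>x. f x * g x \<partial>halfline)"
    "(\<integral>x. f x * (of_real r * g x) \<partial>halfline) = of_real r * (\<integral>x. f x * g x \<partial>halfline)"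
    by (simp_all add: mult.assoc mult.left_commute)
  then show "bil (r *\<^sub>R a) b = r *\<^sub>R bil a b" "bil a (r *\<^sub>R b) = r *\<^sub>R bil a b"
    by (simp_all only: * cls_scaleR bil_cls L2_cmult L2_bilin_def scaleR_conv_of_real)
  show "\<exists>K. \<forall>a b. norm (bil a b) \<le> norm a * norm b * K"
  proof (intro exI[of _ 1] allI)
    fix a b
    obtain f g where *: "f \<in> L2" "a = cls f" "g \<in> L2" "b = cls g" by (metis l2_cases)
    then have "norm (bil a b) \<le> (\<integral>x. norm (f x * g x) \<partial>halfline)"
      unfolding * bil_cls[OF *(1,3)] L2_bilin_def by (intro integral_norm_bound)
    also have "\<dots> \<le> norm a * norm b" using L2_norm_mult_integral_le[OF *(1,3)] * by (simp add: norm_cls)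
    finally show "norm (bil a b) \<le> norm a * norm b * 1" by simp
  qed
qed

section \<open>Strongly continuous semigroups on Banach spaces\<close>

text \<open>For orbits of semigroups only right difference quotients are directly controlled, so the mean value
theorem is replaced by this one-sided version: the points up to which \<open>f\<close> grows at rate at most
\<open>e\<close> form an interval that is closed by continuity and can be extended to the right.\<close>

lemma right_derivative_zero_const:
  fixes f :: "real \<Rightarrow> 'a::real_normed_vector"
  assumes ab: "a \<le> b" and cont: "continuous_on {a..b} f"
    and der: "\<And>s. a \<le> s \<Longrightarrow> s < b \<Longrightarrow> ((\<lambda>h. (f (s + h) - f s) /\<^sub>R h) \<longlongrightarrow> 0) (at_right 0)"
  shows "f b = f a"
proof -
  have "norm (f b - f a) \<le> e * (b - a)" if e: "e > 0" for e
  proof -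
    define S where "S = {s\<in>{a..b}. \<forall>r\<in>{a..s}. norm (f r - f a) \<le> e * (r - a)}"
    have aS: "a \<in> S" using ab by (simp add: S_def)
    have bdd: "bdd_above S" by (rule bdd_aboveI[of _ b]) (simp add: S_def)
    define m where "m = Sup S"
    have m: "a \<le> m" "m \<le> b"
    proof -
      show "a \<le> m" unfolding m_def by (rule cSup_upper[OF aS bdd])
      show "m \<le> b" unfolding m_def by (rule cSup_least) (use aS in blast, simp add: S_def)
    qed
    have below: "norm (f r - f a) \<le> e * (r - a)" if r: "a \<le> r" "r < m" for r
    proof -
      obtain s where "s \<in> S" "r < s" using less_cSupD[of S r] r aS unfolding m_def by blast
      then show ?thesis using r by (auto simp: S_def)
    qed
    have atm: "norm (f m - f a) \<le> e * (m - a)"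
    proof (cases "m = a")
      case False
      then have am: "a < m" using m by simp
      have "((\<lambda>r. f r) \<longlongrightarrow> f m) (at m within {a..b})"
        using cont m by (auto simp: continuous_on_def)
      then have "(f \<longlongrightarrow> f m) (at m within {a..m})"
        by (rule tendsto_within_subset) (use m in auto)
      then have lim: "(f \<longlongrightarrow> f m) (at_left m)" using am by (simp add: at_within_Icc_at_left)
      show ?thesis
      proof (rule tendsto_le[OF _ _ tendsto_norm[OF tendsto_diff[OF lim tendsto_const]]])
        show "((\<lambda>r. e * (r - a)) \<longlongrightarrow> e * (m - a)) (at_left m)" by (intro tendsto_intros)
        show "\<forall>\<^sub>F x in at_left m. norm (f x - f a) \<le> e * (x - a)"
          using am below by (intro eventually_at_leftI[of a]) auto
      qed simp
    qed simp
    have "m = b"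
    proof (rule ccontr)
      assume "m \<noteq> b" then have mb: "m < b" using m by simp
      have "\<forall>\<^sub>F h in at_right 0. norm ((f (m + h) - f m) /\<^sub>R h) < e"
        using tendstoD[OF der[OF m(1) mb] e] by (simp add: dist_norm)
      then obtain d where d: "d > 0" "\<And>h. 0 < h \<Longrightarrow> h < d \<Longrightarrow> norm ((f (m + h) - f m) /\<^sub>R h) < e"
        unfolding eventually_at_right_field by auto
      define s where "s = min b (m + d/2)"
      have s: "m < s" "s \<le> b" "s < m + d" using d mb by (auto simp: s_def)
      have "norm (f r - f a) \<le> e * (r - a)" if r: "r \<in> {a..s}" for r
      proof (cases "r \<le> m")
        case True then show ?thesis using below[of r] atm r by (cases "r = m") auto
      next
        case False
        then have "norm ((f r - f m) /\<^sub>R (r-m)) < e" using r s d(2)[of "r - m"] by simp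
        then have "(r - m) * norm ((f r - f m) /\<^sub>R (r - m)) \<le> (r - m) * e"
          using False by (intro mult_left_mono) auto
        moreover have "(r - m) * norm ((f r - f m) /\<^sub>R (r - m)) = norm (f r - f m)"
          using False by (simp only: norm_scaleR) simp
        ultimately have "norm (f r - f m) \<le> e * (r - m)" by (simp only: mult.commute[of e])
        moreover have "norm (f r - f a) \<le> norm (f r - f m) + norm (f m - f a)"
          using norm_triangle_ineq[of "f r - f m" "f m - f a"] by simp
        ultimately show ?thesis using atm by (simp add: algebra_simps)
      qed
      then have "s \<in> S" using s m by (auto simp: S_def)
      then have "s \<le> m" unfolding m_def by (rule cSup_upper[OF _ bdd])
      then show False using s by simp
    qed
    then show ?thesis using atm by simp
  qed
  then have "norm (f b - f a) \<le> 0"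
  proof (cases "a = b")
    case False
    then have "b - a > 0" using ab by simp
    show ?thesis
    proof (rule field_le_epsilon)
      fix e :: real assume "e > 0"
      then show "norm (f b - f a) \<le> 0 + e"
        using \<open>\<And>e. e > 0 \<Longrightarrow> norm (f b - f a) \<le> e * (b - a)\<close>[of "e / (b - a)"] \<open>b - a > 0\<close> by simp
    qed
  qed simp
  then show ?thesis by simp
qed

lemma has_vector_derivative_at_rightD:
  fixes f :: "real \<Rightarrow> 'a::real_normed_vector"
  assumes "(f has_vector_derivative D) (at_right t)"
  shows "((\<lambda>h. (f (t + h) - f t) /\<^sub>R h) \<longlongrightarrow> D) (at_right 0)"
proof -
  have "((\<lambda>y. (1 / norm (y - t)) *\<^sub>R (f y - (f t + (y - t) *\<^sub>R D))) \<longlongrightarrow> 0) (at_right t)"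
    using assms by (auto simp: has_vector_derivative_def has_derivative_within)
  then have "((\<lambda>h. (1 / norm h) *\<^sub>R (f (t + h) - (f t + h *\<^sub>R D))) \<longlongrightarrow> 0) (at_right 0)"
    unfolding filterlim_at_right_to_0[of _ _ t] by (simp add: add.commute)
  then have "((\<lambda>h. (1 / norm h) *\<^sub>R (f (t + h) - (f t + h *\<^sub>R D)) + D) \<longlongrightarrow> 0 + D) (at_right 0)"
    by (intro tendsto_intros)
  moreover have "\<forall>\<^sub>F h in at_right 0. (1 / norm h) *\<^sub>R (f (t + h) - (f t + h *\<^sub>R D)) + D = (f (t + h) - f t) /\<^sub>R h"
    by (intro eventually_at_rightI[of 0 1]) (auto simp: algebra_simps inverse_eq_divide)
  ultimately show ?thesis using tendsto_cong by force
qed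

locale strongly_continuous_semigroup =
  fixes U :: "real \<Rightarrow> 'a::banach \<Rightarrow> 'a"
  assumes bl: "t \<ge> 0 \<Longrightarrow> bounded_linear (U t)"
    and zero: "U 0 x = x"
    and add: "s \<ge> 0 \<Longrightarrow> t \<ge> 0 \<Longrightarrow> U (s + t) x = U s (U t x)"
    and lim0: "((\<lambda>t. U t x) \<longlongrightarrow> x) (at_right 0)"
begin

text \<open>The uniform boundedness principle for the semigroup, by Baire: the closed sets of vectors whose
orbit is bounded by \<open>n + 1\<close> on \<open>[0, 1 / (n + 1)]\<close> exhaust the space because orbits are continuous at
\<open>0\<close>, so one of them contains a ball.\<close>

lemma local_bound: "\<exists>\<delta>>0. \<exists>K\<ge>1. \<forall>t\<in>{0..\<delta>}. \<forall>x. norm (U t x) \<le> K * norm x"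
proof -
  define F where "F n = (\<Inter>t\<in>{0..1 / real (Suc n)}. {x. norm (U t x) \<le> real (Suc n)})" for n
  have cl: "closed (F n)" for n
    unfolding F_def
    by (intro closed_INT ballI closed_Collect_le continuous_intros)
       (auto intro: linear_continuous_on bl)
  have un: "(\<Union>n. F n) = UNIV"
  proof -
    have "\<exists>n. x \<in> F n" for x
    proof -
      have "\<forall>\<^sub>F t in at_right 0. dist (U t x) x < 1" using tendstoD[OF lim0] by simp
      then obtain b where b: "b > 0" "\<And>t. 0 < t \<Longrightarrow> t < b \<Longrightarrow> dist (U t x) x < 1"
        unfolding eventually_at_right_field by auto
      obtain n :: nat where n: "real n > norm x + 1 + 1/b" using reals_Archimedean2 by blast
      have "1 / real (Suc n) < b"
      proof -
        have "1/b < real (Suc n)" using n norm_ge_zero[of x] by (simp del: norm_ge_zero)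
        then show ?thesis using b by (simp add: field_simps)
      qed
      moreover have "1/b > 0" using b by simp
      ultimately have "norm (U t x) \<le> real (Suc n)" if "t \<in> {0..1 / real (Suc n)}" for t
      proof (cases "t = 0")
        case False
        then have "dist (U t x) x < 1" using that \<open>1 / real (Suc n) < b\<close> by (intro b) auto
        then have "norm (U t x) < norm x + 1" using norm_triangle_ineq2[of "U t x" x] by (simp add: dist_norm)
        then show ?thesis using n \<open>1/b > 0\<close> of_nat_Suc[of n, where 'a=real] by linarith
      next
        case True
        then show ?thesis using n \<open>1/b > 0\<close> of_nat_Suc[of n, where 'a=real] zero[of x] by (simp only:)
      qed
      then have "x \<in> F n" unfolding F_def by blast
      then show ?thesis by blast
    qed
    then show ?thesis by auto
  qed
  have "\<exists>n. interior (F n) \<noteq> {}"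
  proof (rule ccontr)
    assume "\<not> ?thesis"
    then have "Met_TC.mtopology interior_of (\<Union>(range F)) = {}"
    proof (intro Met_TC.metric_Baire_category_alt)
      show "Met_TC.mcomplete TYPE('a)" by (simp only: mcomplete_iff_complete complete_UNIV)
      fix T assume "T \<in> range F"
      then show "closedin Met_TC.mtopology T \<and> Met_TC.mtopology interior_of T = {}"
        using cl \<open>\<not> (\<exists>n. interior (F n) \<noteq> {})\<close> by auto
    qed simp
    then show False using un by simp
  qed
  then obtain n x0 where "x0 \<in> interior (F n)" by blast
  then obtain r where r: "r > 0" "ball x0 r \<subseteq> F n" by (meson mem_interior)
  define N where "N = real (Suc n)"
  have N: "N \<ge> 1" by (simp add: N_def)
  have "norm (U t x) \<le> max 1 (4 * N / r) * norm x" if t: "t \<in> {0..1 / N}" for t x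
  proof (cases "x = 0")
    case True then show ?thesis using bl[of t] t by (simp add: linear_simps)
  next
    case False
    interpret bounded_linear "U t" using bl t by simp
    define y where "y = (r / (2 * norm x)) *\<^sub>R x"
    have "norm y < r" using r False by (simp add: y_def)
    then have "x0 + y \<in> F n" "x0 \<in> F n" using r by (auto simp: dist_norm intro!: subsetD[OF r(2)])
    then have "norm (U t (x0 + y)) \<le> N" "norm (U t x0) \<le> N" using t by (auto simp: F_def N_def)
    then have "norm (U t y) \<le> 2 * N" using norm_triangle_ineq4[of "U t (x0 + y)" "U t x0"] by (simp add: add)
    then have "norm (U t x) \<le> 4 * N / r * norm x" using r False by (simp add: y_def scaleR field_simps)
    also have "\<dots> \<le> max 1 (4 * N / r) * norm x" by (intro mult_right_mono) auto
    finally show ?thesis .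
  qed
  then show ?thesis using N by (intro exI[of _ "1/N"] conjI exI[of _ "max 1 (4 * N / r)"]) auto
qed

lemma bound_on: "\<exists>K. \<forall>t\<in>{0..b}. \<forall>x. norm (U t x) \<le> K * norm x"
proof -
  obtain d K where d: "d > 0" "K \<ge> 1" and K: "\<And>t x. 0 \<le> t \<Longrightarrow> t \<le> d \<Longrightarrow> norm (U t x) \<le> K * norm x"
    using local_bound by (auto simp: Ball_def)
  have *: "\<forall>t x. 0 \<le> t \<and> t \<le> real (Suc n) * d \<longrightarrow> norm (U t x) \<le> K ^ Suc n * norm x" for n
  proof (induction n)
    case (Suc n)
    show ?case
    proof (intro allI impI)
      fix t x assume t: "0 \<le> t \<and> t \<le> real (Suc (Suc n)) * d"
      show "norm (U t x) \<le> K ^ Suc (Suc n) * norm x"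
      proof (cases "t \<le> d")
        case True
        have "norm (U t x) \<le> K ^ 1 * norm x" using K t True by simp
        also have "\<dots> \<le> K ^ Suc (Suc n) * norm x"
          by (intro mult_right_mono power_increasing) (use d in auto)
        finally show ?thesis .
      next
        case False
        then have "U t x = U d (U (t - d) x)" using add[of d "t - d"] d by simp
        also have "norm \<dots> \<le> K * norm (U (t - d) x)" using d by (intro K) auto
        also have "\<dots> \<le> K * (K ^ Suc n * norm x)"
          using Suc False t d by (intro mult_left_mono) (auto simp: algebra_simps)
        finally show ?thesis by (simp add: mult.assoc)
      qed
    qed
  qed (use K in auto)
  obtain n :: nat where "real n > b / d" using reals_Archimedean2 by blast
  then have "b \<le> real (Suc n) * d" using d by (simp add: field_simps) 
  then show ?thesis using *[of n] by (intro exI[of _ "K ^ Suc n"]) auto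
qed

lemma continuous: "continuous_on {0..b} (\<lambda>t. U t x)"
proof -
  obtain K0 where K0: "\<forall>t\<in>{0..b}. \<forall>x. norm (U t x) \<le> K0 * norm x" using bound_on by blast
  define K where "K = max 1 K0"
  have K: "norm (U t x) \<le> K * norm x" if "t \<in> {0..b}" for t x
  proof -
    have "norm (U t x) \<le> K0 * norm x" using K0 that by blast
    also have "\<dots> \<le> K * norm x" by (intro mult_right_mono) (auto simp: K_def)
    finally show ?thesis .
  qed
  have K1: "K \<ge> 1" by (simp add: K_def)
  have key: "dist (U s x) (U t x) \<le> K * dist (U (t - s) x) x" if "0 \<le> s" "s \<le> t" "t \<le> b" for s t
  proof -
    have "U t x - U s x = U s (U (t - s) x - x)"
      using add[of s "t - s" x] that bl[of s] by (simp add: linear_simps)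
    then show ?thesis using K[of s "U (t - s) x - x"] that by (simp add: dist_norm norm_minus_commute[of _ "U t x"] norm_minus_commute[of x])
  qed
  have "\<exists>d>0. \<forall>s\<in>{0..b}. dist s t < d \<longrightarrow> dist (U s x) (U t x) < e" if e: "e > 0" and "t \<in> {0..b}" for e t
  proof -
    have "\<forall>\<^sub>F t in at_right 0. dist (U t x) x < e / K" using tendstoD[OF lim0, of "e/K"] e K1 by simp
    then obtain d where d: "d > 0" "\<And>t. 0 < t \<Longrightarrow> t < d \<Longrightarrow> dist (U t x) x < e/K"
      unfolding eventually_at_right_field by auto
    have d': "K * dist (U h x) x < e" if "0 \<le> h" "h < d" for h
      using d(2)[of h] that zero e K1 by (cases "h = 0") (auto simp: field_simps)
    have "dist (U s x) (U t x) < e" if "s \<in> {0..b}" "t \<in> {0..b}" "dist s t < d" for s t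
    proof (cases "s \<le> t")
      case True
      then have "dist (U s x) (U t x) \<le> K * dist (U (t - s) x) x" using that by (intro key) auto
      also have "\<dots> < e" using that True by (intro d') (auto simp: dist_real_def)
      finally show ?thesis .
    next
      case False
      then have "dist (U t x) (U s x) \<le> K * dist (U (s - t) x) x" using that by (intro key) auto
      also have "\<dots> < e" using that False by (intro d') (auto simp: dist_real_def)
      finally show ?thesis by (simp add: dist_commute)
    qed
    then show ?thesis using d(1) that(2) by blast
  qed
  then show ?thesis unfolding continuous_on_iff by blast
qed

definition orbit_integral where "orbit_integral t x = integral {0..t} (\<lambda>s. U s x)"

lemma U_integrable: "0 \<le> a \<Longrightarrow> (\<lambda>s. U s x) integrable_on {a..b}"
  by (intro integrable_continuous_real continuous_on_subset[OF continuous[of b]]) auto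

lemma orbit_integral_derivative:
  assumes "t \<ge> 0" shows "((\<lambda>h. (orbit_integral (t + h) x - orbit_integral t x) /\<^sub>R h) \<longlongrightarrow> U t x) (at_right 0)"
proof -
  have "((\<lambda>u. integral {0..u} (\<lambda>s. U s x)) has_vector_derivative U t x) (at t within {0..t+1})"
    using assms by (intro integral_has_vector_derivative continuous) auto
  then have "((\<lambda>u. orbit_integral u x) has_vector_derivative U t x) (at t within {t..t+1})"
    unfolding orbit_integral_def by (rule has_vector_derivative_within_subset) (use assms in auto)
  then show ?thesis by (intro has_vector_derivative_at_rightD) (simp add: at_within_Icc_at_right)
qed

lemma U_I:
  assumes "t \<ge> 0" "e \<ge> 0" shows "U e (orbit_integral t x) = orbit_integral (t + e) x - orbit_integral e x"
proof -
  have "U e (orbit_integral t x) = integral {0..t} (\<lambda>s. U e (U s x))"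
    unfolding orbit_integral_def using integral_linear[OF U_integrable bl, of 0 e t x] assms by (simp add: o_def)
  also have "\<dots> = integral {0..t} (\<lambda>s. U (s + e) x)"
    by (intro integral_cong) (use assms in \<open>auto simp: add[symmetric] add.commute\<close>)
  also have "\<dots> = integral {e..t+e} (\<lambda>s. U s x)"
    using integral_shift_Icc_real[of 0 t "\<lambda>s. U s x" e] by (simp add: o_def add.commute)
  also have "\<dots> = orbit_integral (t + e) x - orbit_integral e x"
    using Henstock_Kurzweil_Integration.integral_combine[of 0 e "t+e" "\<lambda>s. U s x"] assms U_integrable[of 0]
    by (simp add: orbit_integral_def algebra_simps)
  finally show ?thesis .
qed

lemma orbit_integral_zero: "orbit_integral 0 x = 0"
  by (simp add: orbit_integral_def)

text \<open>By the semigroup law the numerator is the integral of the orbit over \<open>[t, t + e]\<close> minus that over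
\<open>[0, e]\<close>, so orbit integrals lie in the domain of the generator for every initial vector. With the
averages tending to \<open>x\<close> this also makes the domain dense.\<close>

lemma orbit_integral_generator:
  assumes "t \<ge> 0"
  shows "((\<lambda>e. (U e (orbit_integral t x) - orbit_integral t x) /\<^sub>R e) \<longlongrightarrow> U t x - x) (at_right 0)"
proof -
  have "((\<lambda>e. (orbit_integral (t + e) x - orbit_integral t x) /\<^sub>R e - (orbit_integral (0 + e) x - orbit_integral 0 x) /\<^sub>R e) \<longlongrightarrow> U t x - U 0 x) (at_right 0)"
    by (intro tendsto_diff orbit_integral_derivative assms) simp
  moreover have "\<forall>\<^sub>F e in at_right 0. (orbit_integral (t + e) x - orbit_integral t x) /\<^sub>R e - (orbit_integral (0 + e) x - orbit_integral 0 x) /\<^sub>R e = (U e (orbit_integral t x) - orbit_integral t x) /\<^sub>R e"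
    using assms by (intro eventually_at_rightI[of 0 1]) (simp_all add: U_I orbit_integral_zero scaleR_diff_right[symmetric])
  ultimately show ?thesis using tendsto_cong by (force simp: zero)
qed

lemma orbit_integral_average: "((\<lambda>e. orbit_integral e x /\<^sub>R e) \<longlongrightarrow> x) (at_right 0)"
  using orbit_integral_derivative[of 0 x] by (simp add: orbit_integral_def zero)

text \<open>Both quotients equal \<open>U s\<close> applied to the difference quotient at time \<open>0\<close>. Read for the second one,
the generator is invariant under the semigroup.\<close>

lemma orbit_derivative:
  assumes "((\<lambda>e. (U e f - f) /\<^sub>R e) \<longlongrightarrow> g) (at_right 0)" "s \<ge> 0"
  shows "((\<lambda>e. (U (s + e) f - U s f) /\<^sub>R e) \<longlongrightarrow> U s g) (at_right 0)"
    and "((\<lambda>e. (U e (U s f) - U s f) /\<^sub>R e) \<longlongrightarrow> U s g) (at_right 0)"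
proof -
  interpret bounded_linear "U s" using bl assms(2) .
  have *: "((\<lambda>e. U s ((U e f - f) /\<^sub>R e)) \<longlongrightarrow> U s g) (at_right 0)"
    by (rule tendsto[OF assms(1)])
  have "\<forall>\<^sub>F e in at_right 0. U s ((U e f - f) /\<^sub>R e) = (U (s + e) f - U s f) /\<^sub>R e"
    using assms(2) by (intro eventually_at_rightI[of 0 1]) (auto simp: strongly_continuous_semigroup.add[OF strongly_continuous_semigroup_axioms] scaleR diff)
  from tendsto_cong[THEN iffD1, OF this *] show 1: "((\<lambda>e. (U (s + e) f - U s f) /\<^sub>R e) \<longlongrightarrow> U s g) (at_right 0)" .
  have "\<forall>\<^sub>F e in at_right 0. (U (s + e) f - U s f) /\<^sub>R e = (U e (U s f) - U s f) /\<^sub>R e"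
    using assms(2) by (intro eventually_at_rightI[of 0 1]) (auto simp: strongly_continuous_semigroup.add[OF strongly_continuous_semigroup_axioms, symmetric] add.commute)
  from tendsto_cong[THEN iffD1, OF this 1] show "((\<lambda>e. (U e (U s f) - U s f) /\<^sub>R e) \<longlongrightarrow> U s g) (at_right 0)" .
qed

end

section \<open>The fundamental theorem of calculus for absolutely continuous functions\<close>

lemma division_sum_measure:
  fixes \<D> :: "'a::euclidean_space set set"
  assumes "\<D> division_of S"
  shows "(\<Sum>K\<in>\<D>. measure lborel K) = measure lebesgue S"
proof -
  have D: "finite \<D>" "\<Union>\<D> = S" "\<And>K. K \<in> \<D> \<Longrightarrow> \<exists>a b. K = cbox a b" using assms by auto
  have "measure lebesgue (\<Union>\<D>) = (\<Sum>K\<in>\<D>. measure lebesgue K)"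
  proof (rule measure_negligible_finite_Union)
    show "pairwise (\<lambda>S T. negligible (S \<inter> T)) \<D>"
    proof (rule pairwiseI)
      fix K L assume KL: "K \<in> \<D>" "L \<in> \<D>" "K \<noteq> L"
      then obtain a b c d where ab: "K = cbox a b" "L = cbox c d" using D by meson
      have "interior (K \<inter> L) = {}" using division_ofD(5)[OF assms KL] by simp
      moreover have "convex (K \<inter> L)" unfolding ab by (intro convex_Int convex_box)
      ultimately show "negligible (K \<inter> L)" using negligible_convex_interior by blast
    qed
    show "K \<in> lmeasurable" if "K \<in> \<D>" for K using D(3)[OF that] by auto
  qed fact
  then show ?thesis using D by (auto simp: measure_completion intro!: sum.cong dest: D(3))
qed

lemma absolutely_continuous_on_subset:
  "absolutely_continuous_on S f \<Longrightarrow> T \<subseteq> S \<Longrightarrow> absolutely_continuous_on T f"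
  unfolding absolutely_continuous_on_def by (meson order_trans)

text \<open>The gauge is chosen separately on the exceptional null set. At points of differentiability it
comes from the derivative, as in the classical fundamental theorem. On the null set the
integrand is set to \<open>0\<close>, and the gauge keeps the intervals inside an open set of small measure,
where absolute continuity bounds the total increment of \<open>f\<close>.\<close>

lemma absolutely_continuous_FTC:
  fixes f :: "real \<Rightarrow> complex"
  assumes ab: "a \<le> b" and ac: "absolutely_continuous_on {a..b} f" and N: "negligible N"
    and der: "\<And>x. x \<in> {a..b} - N \<Longrightarrow> (f has_vector_derivative f' x) (at x within {a..b})"
  shows "(f' has_integral (f b - f a)) {a..b}"
proof (cases "a = b")
  case False
  then have lt: "a < b" using ab by simp
  define g where "g x = (if x \<in> N then 0 else f' x)" for x
  have "(g has_integral (f b - f a)) {a..b}"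
    unfolding has_integral_factor_content_real
  proof (intro allI impI)
    fix e :: real assume e: "e > 0"
    define e2 where "e2 = e * (b - a) / 2"
    have e2: "e2 > 0" using e lt by (simp add: e2_def)
    obtain \<delta> where "\<delta> > 0" and \<delta>: "\<And>\<D> X. \<D> division_of X \<Longrightarrow> X \<subseteq> {a..b} \<Longrightarrow> (\<Sum>I\<in>\<D>. Sup I - Inf I) < \<delta> \<Longrightarrow>
        (\<Sum>I\<in>\<D>. norm (f (Sup I) - f (Inf I))) < e2"
    proof -
      from ac[unfolded absolutely_continuous_on_def, THEN spec, THEN mp, OF e2] obtain \<delta> where "\<delta> > 0"
        and "\<forall>\<D> X. \<D> division_of X \<and> X \<subseteq> {a..b} \<and> (\<Sum>I\<in>\<D>. Sup I - Inf I) < \<delta> \<longrightarrow>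
          (\<Sum>I\<in>\<D>. norm (f (Sup I) - f (Inf I))) < e2" by (elim exE conjE)
      then show thesis by (intro that[of \<delta>]) (auto simp only:)
    qed
    obtain T where T: "open T" "N \<subseteq> T" "T - N \<in> lmeasurable" "emeasure lebesgue (T - N) < ennreal \<delta>"
      using sets_lebesgue_outer_open[OF negligible_imp_sets[OF N] \<open>\<delta> > 0\<close>] .
    have "T = (T - N) \<union> N" using T(2) by blast
    then have "T \<in> lmeasurable" "measure lebesgue T = measure lebesgue (T - N)"
      using T(3) N fmeasurable.Un[OF T(3) negligible_imp_measurable[OF N]]
      by (auto intro!: measure_negligible_symdiff negligible_subset[OF N])
    then have mT: "T \<in> lmeasurable" "measure lebesgue T < \<delta>"
      using T(3,4) by (auto simp: emeasure_eq_measure2 ennreal_less_iff)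
    have "\<forall>x. \<exists>d>0. x \<in> {a..b} - N \<longrightarrow>
         (\<forall>y\<in>{a..b}. norm (y-x) < d \<longrightarrow> norm (f y - f x - (y-x) *\<^sub>R f' x) \<le> e/2 * norm (y-x))"
      using der[unfolded has_vector_derivative_def has_derivative_within_alt] e by (meson half_gt_zero zero_less_one)
    then obtain d where d: "\<And>x. 0 < d x"
                 "\<And>x y. \<lbrakk>x \<in> {a..b}; x \<notin> N; y \<in> {a..b}; norm (y-x) < d x\<rbrakk>
                        \<Longrightarrow> norm (f y - f x - (y-x) *\<^sub>R f' x) \<le> e/2 * norm (y-x)"
      by (metis Diff_iff)
    define \<gamma> where "\<gamma> x = (if x \<in> N then T else ball x (d x))" for x
    show "\<exists>d. gauge d \<and> (\<forall>p. p tagged_division_of {a..b} \<and> d fine p \<longrightarrow>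
      norm ((\<Sum>(x, k)\<in>p. measure lborel k *\<^sub>R g x) - (f b - f a)) \<le> e * measure lborel {a..b})"
    proof (intro exI[of _ \<gamma>] conjI allI impI)
      show "gauge \<gamma>" using T d(1) by (auto simp: gauge_def \<gamma>_def)
      fix p assume p: "p tagged_division_of {a..b} \<and> \<gamma> fine p"
      then have ptag: "p tagged_division_of {a..b}" and fine: "\<gamma> fine p" by auto
      note pfin = tagged_division_ofD(1)[OF ptag]
      define h where "h z = (case z of (x, K) \<Rightarrow> measure lborel K *\<^sub>R g x - (f (Sup K) - f (Inf K)))" for z :: "real \<times> real set"
      define p1 p2 where "p1 = {z\<in>p. fst z \<notin> N}" and "p2 = {z\<in>p. fst z \<in> N}"
      have pp: "p = p1 \<union> p2" "p1 \<inter> p2 = {}" "finite p1" "finite p2" using pfin by (auto simp: p1_def p2_def)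
      have fba: "f b - f a = (\<Sum>(x,K)\<in>p. f (Sup K) - f (Inf K))"
        using additive_tagged_division_1[OF ab ptag, of f] by simp
      have ba: "b - a = (\<Sum>(x,K)\<in>p. Sup K - Inf K)"
        using additive_tagged_division_1[OF ab ptag, of "\<lambda>x. x"] by simp
      have ivl: "\<exists>u v. K = {u..v} \<and> u \<le> v \<and> x \<in> K \<and> K \<subseteq> {a..b}" if "(x, K) \<in> p" for x K
        using tagged_division_ofD(2,3,4)[OF ptag that] by (metis atLeastatMost_empty_iff box_real(2) empty_iff)
      have 1: "norm (sum h p1) \<le> e / 2 * (b - a)"
      proof -
        have "norm (sum h p1) \<le> (\<Sum>z\<in>p1. e/2 * (case z of (x, K) \<Rightarrow> Sup K - Inf K))"
        proof (rule sum_norm_le, clarify)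
          fix x K assume xK: "(x, K) \<in> p1"
          then have xp: "(x, K) \<in> p" "x \<notin> N" by (auto simp: p1_def)
          obtain u v where k: "K = {u..v}" "u \<le> v" "x \<in> K" "K \<subseteq> {a..b}" using ivl[OF xp(1)] by auto
          have uv: "u \<in> K" "v \<in> K" using k by auto
          have ball: "y \<in> ball x (d x)" if "y \<in> K" for y
            using fineD[OF fine xp(1)] xp(2) that by (auto simp: \<gamma>_def)
          have "norm ((v - u) *\<^sub>R f' x - (f v - f u)) = norm (f u - f x - (u - x) *\<^sub>R f' x - (f v - f x - (v - x) *\<^sub>R f' x))"
            by (auto simp: algebra_simps)
          also have "\<dots> \<le> norm (f u - f x - (u - x) *\<^sub>R f' x) + norm (f v - f x - (v - x) *\<^sub>R f' x)"
            by (rule norm_triangle_ineq4)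
          also have "\<dots> \<le> e/2 * norm (u - x) + e/2 * norm (v - x)"
            by (intro add_mono d(2)) (use uv k xp ball[of u] ball[of v] in \<open>auto simp: dist_real_def\<close>)
          also have "\<dots> = e/2 * (Sup K - Inf K)" using k by (auto simp: field_simps)
          finally show "norm (h (x, K)) \<le> e/2 * (Sup K - Inf K)" using k xp by (simp add: h_def g_def)
        qed
        also have "\<dots> = e/2 * (\<Sum>(x, K)\<in>p1. Sup K - Inf K)" by (simp add: sum_distrib_left)
        also have "\<dots> \<le> e/2 * (b - a)"
          unfolding ba using e pfin by (intro mult_left_mono sum_mono2) (auto simp: p1_def dest!: ivl)
        finally show ?thesis .
      qed
      have 2: "norm (sum h p2) \<le> e2"
      proof -
        have "p2 tagged_partial_division_of {a..b}"
          using ptag tagged_partial_division_subset[of p "{a..b}" p2] pp by (auto simp: tagged_division_of_def)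
        from tagged_partial_division_of_Union_self[OF this]
        have tag2: "p2 tagged_division_of \<Union>(snd ` p2)" .
        from division_of_tagged_division[OF this] have div2: "snd ` p2 division_of \<Union>(snd ` p2)" .
        have K: "\<exists>u v. K = {u..v} \<and> u \<le> v \<and> K \<subseteq> {a..b} \<and> K \<subseteq> T" if "K \<in> snd ` p2" for K
        proof -
          from that obtain x where x: "(x, K) \<in> p2" by auto
          then have xp: "(x, K) \<in> p" "x \<in> N" by (auto simp: p2_def)
          then have "K \<subseteq> T" using fineD[OF fine xp(1)] by (auto simp: \<gamma>_def)
          then show ?thesis using ivl[OF xp(1)] by blast
        qed
        have sub: "\<Union>(snd ` p2) \<subseteq> {a..b}" "\<Union>(snd ` p2) \<subseteq> T" by (rule Union_least, use K in meson)+
        have "(\<Sum>I\<in>snd ` p2. Sup I - Inf I) = (\<Sum>I\<in>snd ` p2. measure lborel I)"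
        proof (rule sum.cong[OF refl])
          fix K assume "K \<in> snd ` p2"
          from K[OF this] obtain u v where "K = {u..v}" "u \<le> v" by blast
          then show "Sup K - Inf K = measure lborel K" by simp
        qed
        also have "\<dots> = measure lebesgue (\<Union>(snd ` p2))" by (rule division_sum_measure[OF div2])
        also have "\<dots> \<le> measure lebesgue T"
        proof (rule measure_mono_fmeasurable[OF sub(2) _ mT(1)])
          show "\<Union>(snd ` p2) \<in> sets lebesgue"
          proof (rule sets.finite_Union)
            show "snd ` p2 \<subseteq> sets lebesgue"
            proof
              fix K assume "K \<in> snd ` p2"
              from K[OF this] obtain u v where "K = {u..v}" by blast
              then show "K \<in> sets lebesgue" by simp
            qed
          qed (use pp in simp)
        qed
        also have "\<dots> < \<delta>" by fact
        finally have small: "(\<Sum>I\<in>snd ` p2. norm (f (Sup I) - f (Inf I))) < e2"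
          by (intro \<delta>[OF div2] sub)
        \<comment> \<open>The empty interval needs the value \<open>0\<close> because \<open>Sup\<close> and \<open>Inf\<close> of the empty set are unspecified.\<close>
        define D where "D K = (if K = {} then 0 else norm (f (Sup K) - f (Inf K)))" for K
        have "norm (sum h p2) \<le> (\<Sum>(x, K)\<in>p2. D K)"
        proof (rule sum_norm_le, clarify)
          fix x K assume "(x, K) \<in> p2"
          then have "(x, K) \<in> p" "x \<in> N" by (auto simp: p2_def)
          then show "norm (h (x, K)) \<le> D K" using ivl[of x K] norm_minus_commute[of "f (Sup K)" "f (Inf K)"] by (auto simp: h_def g_def D_def)
        qed
        also have "\<dots> = sum D (snd ` p2)"
        proof (rule sum.over_tagged_division_lemma[OF tag2])
          fix u v :: real assume "box u v = {}"
          then show "D (cbox u v) = 0" by (cases "u = v") (auto simp: D_def)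
        qed
        also have "\<dots> \<le> (\<Sum>I\<in>snd ` p2. norm (f (Sup I) - f (Inf I)))"
          by (intro sum_mono) (auto simp: D_def)
        finally show ?thesis using small by simp
      qed
      have "(\<Sum>(x, k)\<in>p. measure lborel k *\<^sub>R g x) - (f b - f a) = sum h p"
        unfolding fba sum_subtractf[symmetric] h_def by (rule sum.cong) auto
      also have "\<dots> = sum h p1 + sum h p2" using pp by (simp add: sum.union_disjoint)
      finally have "norm ((\<Sum>(x, k)\<in>p. measure lborel k *\<^sub>R g x) - (f b - f a)) \<le> norm (sum h p1) + norm (sum h p2)"
        by (simp add: norm_triangle_ineq)
      also have "\<dots> \<le> e / 2 * (b - a) + e2" using 1 2 by simp
      also have "\<dots> = e * measure lborel {a..b}" using ab by (simp add: e2_def field_simps)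
      finally show "norm ((\<Sum>(x, k)\<in>p. measure lborel k *\<^sub>R g x) - (f b - f a)) \<le> e * measure lborel {a..b}" .
    qed
  qed
  then show ?thesis by (rule has_integral_spike[OF N, rotated]) (simp add: g_def)
qed auto

lemma Lipschitz_imp_absolutely_continuous_on:
  fixes f :: "real \<Rightarrow> complex"
  assumes L: "\<And>x y. x \<in> S \<Longrightarrow> y \<in> S \<Longrightarrow> norm (f x - f y) \<le> L * \<bar>x - y\<bar>"
  shows "absolutely_continuous_on S f"
  unfolding absolutely_continuous_on_def
proof (intro allI impI)
  fix e :: real assume e: "e > 0"
  define L' where "L' = max 1 L"
  have L': "L' \<ge> 1" "L' \<ge> L" by (auto simp: L'_def)
  show "\<exists>\<delta>>0. \<forall>\<D> X. \<D> division_of X \<and> X \<subseteq> S \<and> (\<Sum>I\<in>\<D>. Sup I - Inf I) < \<delta> \<longrightarrow>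
        (\<Sum>I\<in>\<D>. norm (f (Sup I) - f (Inf I))) < e"
  proof (intro exI[of _ "e / L'"] conjI allI impI)
    show "e / L' > 0" using e L' by simp
    fix \<D> X assume *: "\<D> division_of X \<and> X \<subseteq> S \<and> (\<Sum>I\<in>\<D>. Sup I - Inf I) < e / L'"
    have "(\<Sum>I\<in>\<D>. norm (f (Sup I) - f (Inf I))) \<le> (\<Sum>I\<in>\<D>. L' * (Sup I - Inf I))"
    proof (rule sum_mono)
      fix I assume I: "I \<in> \<D>"
      then have "I \<noteq> {}" "I \<subseteq> S" "\<exists>a b. I = cbox a b" using * by (auto simp: division_of_def)
      then obtain u v where "I = {u..v}" "u \<le> v" by (metis atLeastatMost_empty_iff box_real(2))
      then have "norm (f (Sup I) - f (Inf I)) \<le> L * \<bar>Sup I - Inf I\<bar>" "Sup I - Inf I \<ge> 0"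
        using \<open>I \<subseteq> S\<close> L[of v u] by (auto simp: subset_eq)
      then show "norm (f (Sup I) - f (Inf I)) \<le> L' * (Sup I - Inf I)"
        using mult_right_mono[OF L'(2), of "Sup I - Inf I"] by linarith
    qed
    also have "\<dots> < e" unfolding sum_distrib_left[symmetric] using * L' by (simp add: pos_less_divide_eq mult.commute)
    finally show "(\<Sum>I\<in>\<D>. norm (f (Sup I) - f (Inf I))) < e" .
  qed
qed

section \<open>Borel representatives and shifts\<close>

lemma AE_halfline_iff: "(AE x in halfline. P x) \<longleftrightarrow> (AE x in lborel. 0 < x \<longrightarrow> P x)"
  by (simp add: AE_restrict_space_iff AE_completion_iff)

lemma halfline_measurable_iff:
  fixes f :: "real \<Rightarrow> 'b::euclidean_space"
  shows "f \<in> borel_measurable halfline \<longleftrightarrow> (\<lambda>x. indicat_real {0<..} x *\<^sub>R f x) \<in> borel_measurable lebesgue"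
  by (rule borel_measurable_restrict_space_iff) simp

lemma borel_imp_halfline_measurable:
  fixes f :: "real \<Rightarrow> 'b::euclidean_space"
  assumes "f \<in> borel_measurable borel" shows "f \<in> borel_measurable halfline"
  using assms by (simp add: measurable_completion measurable_restrict_space1)

lemma halfline_integral_lborel:
  fixes h :: "real \<Rightarrow> 'b::euclidean_space"
  assumes [measurable]: "h \<in> borel_measurable borel" and 0: "\<And>x. x \<le> 0 \<Longrightarrow> h x = 0"
  shows "integrable halfline h \<longleftrightarrow> integrable lborel h" "integral\<^sup>L halfline h = integral\<^sup>L lborel h"
proof -
  have eq: "(\<lambda>x. indicat_real {0<..} x *\<^sub>R h x) = h" using 0 by (auto simp: indicator_def fun_eq_iff)
  show "integrable halfline h \<longleftrightarrow> integrable lborel h"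
    by (subst integrable_restrict_space) (auto simp: eq integrable_completion)
  show "integral\<^sup>L halfline h = integral\<^sup>L lborel h"
    by (subst integral_restrict_space) (auto simp: eq integral_completion)
qed

lemma borel_measurable_cnj [measurable (raw)]:
  "f \<in> borel_measurable M \<Longrightarrow> (\<lambda>x. cnj (f x)) \<in> borel_measurable M"
  by (rule borel_measurable_continuous_on[where f=cnj]) (auto intro: continuous_on_cnj continuous_on_id)

text \<open>Fubini's theorem needs Borel functions: \<open>q (x - r)\<close> need not be jointly measurable for a merely
Lebesgue measurable \<open>q\<close>. Extension by \<open>0\<close> to the negative axis turns the right shift into a plain
translation and integrals over the half-line into integrals over the line.\<close>

definition supp_borel :: "(real \<Rightarrow> complex) set" where
  "supp_borel = {f. f \<in> borel_measurable borel \<and> (\<forall>x\<le>0. f x = 0)}"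

lemma supp_borelD: "f \<in> supp_borel \<Longrightarrow> f \<in> borel_measurable borel" "f \<in> supp_borel \<Longrightarrow> x \<le> 0 \<Longrightarrow> f x = 0"
  by (auto simp: supp_borel_def)

lemma supp_borel_representative:
  assumes "f \<in> borel_measurable halfline"
  obtains g where "g \<in> supp_borel" "f \<doteq> g"
proof -
  let ?F = "\<lambda>x. indicat_real {0<..} x *\<^sub>R f x"
  have F [measurable]: "?F \<in> borel_measurable lebesgue" using assms by (simp add: halfline_measurable_iff)
  have "(\<lambda>x. Re (?F x)) \<in> borel_measurable (completion lborel)" "(\<lambda>x. Im (?F x)) \<in> borel_measurable (completion lborel)"
    by measurable
  from this[THEN completion_ex_borel_measurable_real] obtain u v :: "real \<Rightarrow> real" where
    [measurable]: "u \<in> borel_measurable lborel" "v \<in> borel_measurable lborel"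
    and uv: "AE x in lborel. Re (?F x) = u x" "AE x in lborel. Im (?F x) = v x" by auto
  define g where "g x = indicat_real {0<..} x *\<^sub>R Complex (u x) (v x)" for x
  show thesis
  proof
    have "g \<in> borel_measurable borel" unfolding g_def Complex_eq by measurable
    then show "g \<in> supp_borel" by (auto simp: supp_borel_def g_def)
    show "f \<doteq> g" unfolding AE_halfline_iff using uv
      by eventually_elim (auto simp: g_def complex_eq_iff indicator_def)
  qed
qed

lemma L2_supp_borel:
  assumes "f \<in> L2"
  obtains g where "g \<in> supp_borel" "g \<in> L2" "f \<doteq> g"
proof -
  obtain g where g: "g \<in> supp_borel" "f \<doteq> g" using supp_borel_representative[OF L2D(1)[OF assms]] .
  have [measurable]: "g \<in> borel_measurable halfline" using supp_borelD(1)[OF g(1)] by (rule borel_imp_halfline_measurable)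
  have "g \<in> L2" using g(2) by (intro L2_bound[OF _ L2D(2)[OF assms]]) (auto elim: eventually_mono)
  with g that show thesis by blast
qed

lemma AE_lborel_translate:
  assumes "AE x in lborel. P x" shows "AE x in lborel. P (x + t :: real)"
proof -
  have "distr lborel borel ((+) t) = (lborel :: real measure)" by (rule lborel_distr_plus)
  with assms have "AE x in distr lborel borel ((+) t). P x" by (simp only:)
  then have "AE x in lborel. P (t + x)" by (rule AE_distrD[rotated]) measurable
  then show ?thesis by (simp add: add.commute)
qed

lemma right_shift_cong:
  assumes "f \<doteq> g" "t \<ge> 0" shows "right_shift t f \<doteq> right_shift t g"
proof -
  have "AE x in lborel. 0 < x + - t \<longrightarrow> f (x + - t) = g (x + - t)"
    by (rule AE_lborel_translate) (use assms in \<open>simp add: AE_halfline_iff\<close>)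
  moreover have "AE x in lborel. x \<noteq> t" by (rule AE_lborel_singleton)
  ultimately show ?thesis unfolding AE_halfline_iff
    by eventually_elim (auto simp: right_shift_def)
qed

lemma right_shift_supp_borel:
  assumes "f \<in> supp_borel" "t \<ge> 0"
  shows "right_shift t f = (\<lambda>x. f (x - t))" "right_shift t f \<in> supp_borel"
proof -
  show *: "right_shift t f = (\<lambda>x. f (x - t))" using supp_borelD(2)[OF assms(1)] by (auto simp: right_shift_def fun_eq_iff)
  show "right_shift t f \<in> supp_borel" unfolding * using assms by (auto simp: supp_borel_def)
qed

lemma right_shift_measurable:
  assumes "f \<in> borel_measurable halfline" "t \<ge> 0"
  shows "right_shift t f \<in> borel_measurable halfline"
proof -
  let ?F = "\<lambda>x. indicat_real {0<..} x *\<^sub>R f x"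
  define H where "H x = ?F (- t + 1 *\<^sub>R x)" for x
  have H: "H \<in> borel_measurable lebesgue" unfolding H_def
    by (rule borel_measurable_affine) (use assms in \<open>simp_all add: halfline_measurable_iff\<close>)
  have I: "indicat_real {t} \<in> borel_measurable lebesgue" "indicat_real {0::real<..} \<in> borel_measurable lebesgue"
    by (intro borel_measurable_indicator sets_completionI_sets; simp)+
  have "(\<lambda>x. indicat_real {0<..} x *\<^sub>R (H x + indicat_real {t} x *\<^sub>R f 0)) \<in> borel_measurable lebesgue"
    by (rule borel_measurable_scaleR[OF I(2) borel_measurable_add[OF H borel_measurable_scaleR[OF I(1) borel_measurable_const]]])
  also have "(\<lambda>x. indicat_real {0<..} x *\<^sub>R (H x + indicat_real {t} x *\<^sub>R f 0))
     = (\<lambda>x. indicat_real {0<..} x *\<^sub>R right_shift t f x)"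
    using assms(2) by (auto simp: right_shift_def indicator_def fun_eq_iff H_def)
  finally show ?thesis by (simp add: halfline_measurable_iff)
qed

text \<open>Translation invariance of Lebesgue measure, read off a Borel representative.\<close>

lemma right_shift_integral:
  assumes "f \<in> borel_measurable halfline" "t \<ge> 0"
  shows "integrable halfline (right_shift t f) \<longleftrightarrow> integrable halfline f"
    "integral\<^sup>L halfline (right_shift t f) = integral\<^sup>L halfline f"
proof -
  obtain g where g: "g \<in> supp_borel" "f \<doteq> g" using supp_borel_representative[OF assms(1)] .
  note [measurable] = supp_borelD(1)[OF g(1)] supp_borelD(1)[OF right_shift_supp_borel(2)[OF g(1) assms(2)]]
    assms(1) right_shift_measurable[OF assms] borel_imp_halfline_measurable[OF supp_borelD(1)[OF g(1)]]
    borel_imp_halfline_measurable[OF supp_borelD(1)[OF right_shift_supp_borel(2)[OF g(1) assms(2)]]]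
  have s: "right_shift t f \<doteq> right_shift t g" by (rule right_shift_cong) fact+
  have gg: "right_shift t g x = g (- t + 1 * x)" for x using right_shift_supp_borel[OF g(1) assms(2)] by simp
  have "integrable halfline (right_shift t f) \<longleftrightarrow> integrable halfline (right_shift t g)"
    by (rule integrable_cong_AE) (use s in auto)
  also have "\<dots> \<longleftrightarrow> integrable lborel (\<lambda>x. g (- t + 1 * x))"
    unfolding gg[symmetric] by (rule halfline_integral_lborel)
     (use supp_borelD(2)[OF right_shift_supp_borel(2)[OF g(1) assms(2)]] in auto)
  also have "\<dots> \<longleftrightarrow> integrable lborel g" by (rule lborel_integrable_real_affine_iff) simp
  also have "\<dots> \<longleftrightarrow> integrable halfline g" using supp_borelD(2)[OF g(1)] by (intro halfline_integral_lborel[symmetric]) auto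
  also have "\<dots> \<longleftrightarrow> integrable halfline f" by (rule integrable_cong_AE) (use g in \<open>auto elim: eventually_mono\<close>)
  finally show "integrable halfline (right_shift t f) \<longleftrightarrow> integrable halfline f" .
  have "integral\<^sup>L halfline (right_shift t f) = integral\<^sup>L halfline (right_shift t g)"
    by (rule integral_cong_AE) (use s in auto)
  also have "\<dots> = integral\<^sup>L lborel (\<lambda>x. g (- t + 1 * x))"
    unfolding gg[symmetric] by (rule halfline_integral_lborel)
     (use supp_borelD(2)[OF right_shift_supp_borel(2)[OF g(1) assms(2)]] in auto)
  also have "\<dots> = integral\<^sup>L lborel g" using lborel_integral_real_affine[of 1 g "-t"] by simp
  also have "\<dots> = integral\<^sup>L halfline g" using supp_borelD(2)[OF g(1)] by (intro halfline_integral_lborel[symmetric]) auto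
  also have "\<dots> = integral\<^sup>L halfline f" by (rule integral_cong_AE) (use g in \<open>auto elim: eventually_mono\<close>)
  finally show "integral\<^sup>L halfline (right_shift t f) = integral\<^sup>L halfline f" .
qed

lemma right_shift_norm_sq:
  "(\<lambda>x. complex_of_real ((norm (right_shift t f x))\<^sup>2)) = right_shift t (\<lambda>x. of_real ((norm (f x))\<^sup>2))"
  by (auto simp: right_shift_def)

lemma right_shift_L2:
  assumes "f \<in> L2" "t \<ge> 0" shows "right_shift t f \<in> L2"
proof (rule L2I)
  show "right_shift t f \<in> borel_measurable halfline" using assms L2D by (intro right_shift_measurable) auto
  have [measurable]: "f \<in> borel_measurable halfline" using assms L2D by auto
  have "integrable halfline (\<lambda>x. complex_of_real ((norm (f x))\<^sup>2))" 
    using L2D(2)[OF assms(1)] by (rule integrable_of_real)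
  then have "integrable halfline (\<lambda>x. complex_of_real ((norm (right_shift t f x))\<^sup>2))"
    unfolding right_shift_norm_sq by (subst right_shift_integral) (use assms in \<open>auto intro: borel_measurable_integrable\<close>)
  from integrable_norm[OF this] show "integrable halfline (\<lambda>x. (norm (right_shift t f x))\<^sup>2)" by (simp add: norm_power)
qed


lemma right_shift_mult: "f x * right_shift t g x = right_shift t (\<lambda>y. f (y + t) * g y) x"
  by (auto simp: right_shift_def)

text \<open>Shifting \<open>|f (x + t)|\<^sup>2\<close> to the right by \<open>t\<close> restores \<open>|f|\<^sup>2\<close> on \<open>[t, \<infinity>)\<close>, which is integrable.\<close>

lemma left_shift_L2:
  assumes f: "f \<in> L2" and t: "t \<ge> 0" shows "(\<lambda>x. f (x + t)) \<in> L2"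
proof -
  have [measurable]: "f \<in> borel_measurable halfline" using L2D f by auto
  define H where "H x = indicat_real {0<..} (t + 1 *\<^sub>R x) *\<^sub>R f (t + 1 *\<^sub>R x)" for x
  have H: "H \<in> borel_measurable lebesgue" unfolding H_def
    by (rule borel_measurable_affine) (use L2D(1)[OF f] in \<open>simp_all add: halfline_measurable_iff\<close>)
  have I: "indicat_real {0::real<..} \<in> borel_measurable lebesgue"
    by (intro borel_measurable_indicator sets_completionI_sets) simp
  have "(\<lambda>x. indicat_real {0<..} x *\<^sub>R f (x + t)) = (\<lambda>x. indicat_real {0<..} x *\<^sub>R H x)"
    using t by (auto simp: H_def indicator_def fun_eq_iff add.commute)
  then have meas [measurable]: "(\<lambda>x. f (x + t)) \<in> borel_measurable halfline"
    unfolding halfline_measurable_iff using borel_measurable_scaleR[OF I H] by simp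
  have R [measurable]: "right_shift t (\<lambda>x. complex_of_real ((norm (f (x + t)))\<^sup>2)) \<in> borel_measurable halfline"
    by (rule right_shift_measurable[OF _ t]) measurable
  have "integrable halfline (right_shift t (\<lambda>x. complex_of_real ((norm (f (x + t)))\<^sup>2)))"
    by (rule Bochner_Integration.integrable_bound[OF L2D(2)[OF f] R]) (auto simp: right_shift_def norm_power)
  then have "integrable halfline (\<lambda>x. complex_of_real ((norm (f (x + t)))\<^sup>2))"
    by (subst (asm) right_shift_integral(1)) (use t in auto)
  from integrable_norm[OF this] show ?thesis by (intro L2I meas) (simp add: norm_power)
qed

lemma L2_bilin_right_shift:
  assumes f: "f \<in> L2" and g: "g \<in> L2" and t: "t \<ge> 0"
  shows "L2_bilin f (right_shift t g) = L2_bilin (\<lambda>x. f (x + t)) g"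
  unfolding L2_bilin_def right_shift_mult
  by (rule right_shift_integral(2)) (use L2_mult_integrable[OF left_shift_L2[OF f t] g] t in auto)

lemma right_shift_norm:
  assumes f: "f \<in> L2" and t: "t \<ge> 0" shows "L2_norm (right_shift t f) = L2_norm f"
proof -
  have "complex_of_real (\<integral>x. (norm (right_shift t f x))\<^sup>2 \<partial>halfline) = (\<integral>x. complex_of_real ((norm (right_shift t f x))\<^sup>2) \<partial>halfline)"
    by (rule integral_complex_of_real[symmetric])
  also have "\<dots> = (\<integral>x. complex_of_real ((norm (f x))\<^sup>2) \<partial>halfline)"
    unfolding right_shift_norm_sq
    by (rule right_shift_integral(2)[OF borel_measurable_integrable[OF integrable_of_real[OF L2D(2)[OF f]]] t])
  also have "\<dots> = complex_of_real (\<integral>x. (norm (f x))\<^sup>2 \<partial>halfline)"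
    by (rule integral_complex_of_real)
  finally show ?thesis by (simp only: of_real_eq_iff L2_norm_def)
qed

lemma right_shift_right_shift:
  "s \<ge> 0 \<Longrightarrow> t \<ge> 0 \<Longrightarrow> right_shift s (right_shift t f) = right_shift (s + t) f"
  by (auto simp: right_shift_def fun_eq_iff diff_diff_eq)

section \<open>Uniqueness of Laplace transforms\<close>

text \<open>By Lebesgue's differentiation theorem almost every value is the limit of averages over
\<open>[x, x + h]\<close>, and these all vanish.\<close>

lemma zero_integrals_imp_AE_zero:
  fixes f :: "real \<Rightarrow> complex"
  assumes b: "b \<ge> 0" and f: "\<And>a. 0 \<le> a \<Longrightarrow> a \<le> b \<Longrightarrow> (f has_integral 0) {0..a}"
  shows "AE x in halfline. x < b \<longrightarrow> f x = 0"
proof -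
  define F where "F x = (if x \<in> {0..b} then f x else 0)" for x
  have "F integrable_on UNIV"
    using f[of b] b unfolding F_def integrable_restrict_UNIV by auto
  then have "F integrable_on cbox x y" for x y by (rule integrable_on_subcbox) simp
  from integrable_ccontinuous_explicit[OF this] obtain N where N: "negligible N" and
    lim: "\<And>x e. \<lbrakk>x \<notin> N; 0 < e\<rbrakk> \<Longrightarrow> \<exists>d>0. \<forall>h. 0 < h \<and> h < d \<longrightarrow>
                         norm(integral (cbox x (x + h *\<^sub>R One)) F /\<^sub>R h ^ DIM(real) - F x) < e" by blast
  have fx: "f x = 0" if x: "x \<notin> N" "0 < x" "x < b" for x
  proof -
    have "norm (f x) \<le> 0 + e" if e: "e > 0" for e
    proof -
      obtain d where d: "d > 0" "\<And>h. 0 < h \<Longrightarrow> h < d \<Longrightarrow> norm(integral (cbox x (x + h *\<^sub>R One)) F /\<^sub>R h ^ DIM(real) - F x) < e"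
        using lim[OF x(1) e] by blast
      define h where "h = min (d/2) (b - x)"
      have h: "h > 0" "h < d" "x + h \<le> b" using d(1) x by (auto simp: h_def)
      have "integral {0..x} f + integral {x..x+h} f = integral {0..x+h} f"
        using f[of "x + h"] h x by (intro Henstock_Kurzweil_Integration.integral_combine) (auto simp: integrable_on_def)
      then have "integral {x..x+h} f = 0"
        using f[of "x+h", THEN integral_unique] f[of x, THEN integral_unique] h x by simp
      moreover have "integral {x..x+h} F = integral {x..x+h} f"
        by (rule integral_cong) (use h x in \<open>auto simp: F_def\<close>)
      ultimately show ?thesis using d(2)[of h] h x by (simp add: F_def)
    qed
    then have "norm (f x) \<le> 0" by (rule field_le_epsilon)
    then show ?thesis by simp
  qed
  have "AE x in lborel. x \<notin> N"
  proof -
    have "N \<in> null_sets lebesgue" using N by (simp only: negligible_iff_null_sets)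
    from AE_not_in[OF this] show ?thesis by (simp only: AE_completion_iff)
  qed
  then show ?thesis unfolding AE_halfline_iff by eventually_elim (use fx in blast)
qed

lemma halfline_indicator_has_integral:
  fixes f :: "real \<Rightarrow> complex"
  assumes a: "0 \<le> a" and int: "integrable halfline (\<lambda>x. indicator {a..b} x * f x)"
  shows "(f has_integral (\<integral>x. indicator {a..b} x * f x \<partial>halfline)) {a..b}"
proof -
  have "((\<lambda>x. indicator {a..b} x * f x) has_integral (\<integral>x. indicator {a..b} x * f x \<partial>halfline)) {0<..}"
    using has_integral_integral_lebesgue_on[OF int] by simp
  then have "((\<lambda>x. indicator {a..b} x * f x) has_integral (\<integral>x. indicator {a..b} x * f x \<partial>halfline)) {0..}"
    by (rule has_integral_spike_set_eq[THEN iffD1, rotated 2]) (rule negligible_subset[of "{0}"]; auto)+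
  then have "((\<lambda>x. if x \<in> {0..} then indicator {a..b} x * f x else 0) has_integral (\<integral>x. indicator {a..b} x * f x \<partial>halfline)) UNIV"
    by (simp only: has_integral_restrict_UNIV)
  also have "(\<lambda>x. if x \<in> {0..} then indicator {a..b} x * f x else 0) = (\<lambda>x. if x \<in> {a..b} then f x else 0)"
    using a by (auto simp: indicator_def)
  finally show ?thesis by (simp only: has_integral_restrict_UNIV)
qed

text \<open>Lerch's argument. After absorbing \<open>e\<^sup>-\<^sup>\<sigma>\<^sup>x\<close> into \<open>f\<close> the hypothesis says that the integrals against
all powers of \<open>e\<^sup>-\<^sup>x\<close> vanish, hence against all polynomials in \<open>e\<^sup>-\<^sup>x\<close>. By the Weierstrass theorem the
indicator of \<open>[0, a)\<close> is a bounded pointwise limit of such polynomials.\<close>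

lemma laplace_unique_zero:
  fixes f :: "real \<Rightarrow> complex"
  assumes "\<And>n::nat. has_laplace f (of_real (\<sigma> + real n)) 0"
  shows "f \<doteq> (\<lambda>_. 0)"
proof -
  define g where "g x = f x * exp (- (of_real \<sigma> * of_real x))" for x
  have lap: "integrable halfline (\<lambda>x. g x * of_real (exp (-x)^n))" "(\<integral>x. g x * of_real (exp (-x)^n) \<partial>halfline) = 0" for n
  proof -
    have "(\<lambda>x. f x * exp (- (complex_of_real (\<sigma> + real n) * of_real x))) = (\<lambda>x. g x * of_real (exp (-x)^n))"
    proof
      fix x :: real
      have "(of_real (exp (-x)^n) :: complex) = exp (of_nat n * (- of_real x))"
        by (simp only: exp_of_nat_mult of_real_power exp_of_real[symmetric] of_real_minus)
      then have "exp (- (of_real \<sigma> * of_real x)) * (of_real (exp (-x)^n) :: complex)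
        = exp (- (of_real \<sigma> * of_real x) + of_nat n * (- of_real x))" by (simp only: exp_add)
      also have "- (of_real \<sigma> * of_real x) + of_nat n * (- of_real x) = - (complex_of_real (\<sigma> + real n) * of_real x)"
        by (simp add: algebra_simps)
      finally show "f x * exp (- (of_real (\<sigma> + real n) * of_real x)) = g x * of_real (exp (-x)^n)"
        by (simp only: g_def mult.assoc)
    qed
    then show "integrable halfline (\<lambda>x. g x * of_real (exp (-x)^n))" "(\<integral>x. g x * of_real (exp (-x)^n) \<partial>halfline) = 0"
      using assms[of n] by (simp_all add: has_laplace_def)
  qed
  have g [measurable]: "integrable halfline g" using lap(1)[of 0] by simp
  then have [measurable]: "g \<in> borel_measurable halfline" by auto
  have poly: "integrable halfline (\<lambda>x. g x * of_real (p (exp (-x))))" "(\<integral>x. g x * of_real (p (exp (-x))) \<partial>halfline) = 0"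
    if p: "real_polynomial_function p" for p :: "real \<Rightarrow> real"
  proof -
    obtain a n where "p = (\<lambda>x. \<Sum>i\<le>n. a i * x ^ i)" using p unfolding real_polynomial_function_iff_sum by auto
    then have *: "(\<lambda>x. g x * of_real (p (exp (-x)))) = (\<lambda>x. \<Sum>i\<le>n. of_real (a i) * (g x * of_real (exp (-x)^i)))"
      by (simp add: sum_distrib_left fun_eq_iff mult.left_commute)
    show "integrable halfline (\<lambda>x. g x * of_real (p (exp (-x))))" unfolding *
      by (intro Bochner_Integration.integrable_sum integrable_mult_right lap)
    have "(\<integral>x. (\<Sum>i\<le>n. of_real (a i) * (g x * of_real (exp (-x)^i))) \<partial>halfline)
      = (\<Sum>i\<le>n. of_real (a i) * (\<integral>x. g x * of_real (exp (-x)^i) \<partial>halfline))"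
      by (subst Bochner_Integration.integral_sum) (use lap in auto)
    then show "(\<integral>x. g x * of_real (p (exp (-x))) \<partial>halfline) = 0" unfolding * by (simp only: lap(2) mult_zero_right sum.neutral_const)
  qed
  have zero: "(\<integral>x. indicator {0..<a} x * g x \<partial>halfline) = 0" if a: "a > 0" for a
  proof -
    \<comment> \<open>A ramp in \<open>u = e\<^sup>-\<^sup>x\<close> that rises steeply to the right of \<open>e\<^sup>-\<^sup>a\<close>, that is, for \<open>x < a\<close>.\<close>
    define \<phi> where "\<phi> k u = min 1 (max 0 (real k * (u - exp (-a))))" for k :: nat and u :: real
    have "\<exists>p. real_polynomial_function p \<and> (\<forall>u\<in>{0..1}. \<bar>\<phi> k u - p u\<bar> < 1 / real (Suc k))" for k
      by (rule Stone_Weierstrass_real_polynomial_function[of "{0..1}" "\<phi> k" "1 / real (Suc k)"])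
         (auto simp: \<phi>_def intro!: continuous_intros)
    then obtain p where p: "\<And>k. real_polynomial_function (p k)"
      and pb: "\<And>k u. u \<in> {0..1} \<Longrightarrow> \<bar>\<phi> k u - p k u\<bar> < 1 / real (Suc k)" by metis
    have lim: "(\<lambda>k. g x * of_real (p k (exp (-x)))) \<longlonglongrightarrow> indicator {0..<a} x * g x" if x: "x > 0" for x
    proof -
      have u: "exp (-x) \<in> {0..1}" using x by simp
      have "(\<lambda>k. \<phi> k (exp (-x))) \<longlonglongrightarrow> indicator {0..<a} x"
      proof (cases "x < a")
        case True
        obtain K :: nat where K: "1 / (exp (-x) - exp (-a)) < real K" using reals_Archimedean2 by blast
        have "\<phi> k (exp (-x)) = 1" if "k \<ge> K" for k
        proof -
          have "1 / (exp (-x) - exp (-a)) < real k" using K that by linarith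
          then have "1 < real k * (exp (-x) - exp (-a))" using True by (simp add: divide_less_eq)
          then show ?thesis by (simp add: \<phi>_def)
        qed
        then show ?thesis using True x by (intro tendsto_eventually eventually_sequentiallyI[of K]) simp
      next
        case False
        then have "real k * (exp (-x) - exp (-a)) \<le> 0" for k by (intro mult_nonneg_nonpos) auto
        then have "\<phi> k (exp (-x)) = 0" for k by (simp add: \<phi>_def max_absorb1)
        then show ?thesis using False by simp
      qed
      moreover have "(\<lambda>k. \<phi> k (exp (-x)) - p k (exp (-x))) \<longlonglongrightarrow> 0"
      proof (rule Lim_null_comparison)
        show "\<forall>\<^sub>F k in sequentially. norm (\<phi> k (exp (-x)) - p k (exp (-x))) \<le> 1 / real (Suc k)"
          using pb[OF u] by (auto intro!: always_eventually less_imp_le)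
        show "(\<lambda>k. 1 / real (Suc k)) \<longlonglongrightarrow> 0" using LIMSEQ_inverse_real_of_nat by (simp add: inverse_eq_divide)
      qed
      ultimately have "(\<lambda>k. \<phi> k (exp (-x)) - (\<phi> k (exp (-x)) - p k (exp (-x)))) \<longlonglongrightarrow> indicator {0..<a} x - 0"
        by (rule tendsto_diff)
      then have "(\<lambda>k. g x * of_real (p k (exp (-x)))) \<longlonglongrightarrow> g x * of_real (indicator {0..<a} x)"
        by (intro tendsto_mult tendsto_of_real tendsto_const) simp
      also have "g x * of_real (indicator {0..<a} x) = indicator {0..<a} x * g x"
        by (simp split: split_indicator)
      finally show ?thesis .
    qed
    have "(\<lambda>k. \<integral>x. g x * of_real (p k (exp (-x))) \<partial>halfline) \<longlonglongrightarrow> (\<integral>x. indicator {0..<a} x * g x \<partial>halfline)"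
    proof (rule integral_dominated_convergence)
      show "integrable halfline (\<lambda>x. 2 * norm (g x))" using g by auto
      show "(\<lambda>x. g x * of_real (p k (exp (-x)))) \<in> borel_measurable halfline" for k
        using poly(1)[OF p] by (rule borel_measurable_integrable)
      show "(\<lambda>x. indicator {0..<a} x * g x) \<in> borel_measurable halfline"
        by (intro borel_measurable_times[OF borel_imp_halfline_measurable]) measurable
      show "AE x in halfline. (\<lambda>k. g x * of_real (p k (exp (-x)))) \<longlonglongrightarrow> indicator {0..<a} x * g x"
        unfolding AE_halfline_iff by (intro AE_I2 impI lim)
      show "AE x in halfline. norm (g x * of_real (p k (exp (-x)))) \<le> 2 * norm (g x)" for k
        unfolding AE_halfline_iff
      proof (intro AE_I2 impI)
        fix x :: real assume x: "0 < x"
        have "\<bar>\<phi> k (exp (-x)) - p k (exp (-x))\<bar> < 1 / real (Suc k)" using x by (intro pb) auto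
        moreover have "1 / real (Suc k) \<le> 1" by simp
        moreover have "\<bar>\<phi> k (exp (-x))\<bar> \<le> 1" by (simp add: \<phi>_def)
        ultimately have "\<bar>p k (exp (-x))\<bar> \<le> 2" by linarith
        then have "norm (g x) * \<bar>p k (exp (-x))\<bar> \<le> norm (g x) * 2" by (intro mult_left_mono) auto
        then show "norm (g x * of_real (p k (exp (-x)))) \<le> 2 * norm (g x)" by (simp add: norm_mult mult.commute)
      qed
    qed
    then show ?thesis unfolding poly(2)[OF p] LIMSEQ_const_iff by simp
  qed
  have "AE x in halfline. x < b \<longrightarrow> g x = 0" for b
  proof (cases "b \<ge> 0")
    case True
    have "(g has_integral 0) {0..a}" if "a \<ge> 0" for a
    proof (cases "a = 0")
    case False
    with that have a: "0 < a" by simp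
    have eq: "(\<lambda>x. indicator {0..a} x * g x) \<doteq> (\<lambda>x. indicator {0..<a} x * g x)"
      unfolding AE_halfline_iff using AE_lborel_singleton[of a] by eventually_elim (auto simp: indicator_def)
    have i: "integrable halfline (\<lambda>x. indicator {0..a} x * g x)"
      by (rule Bochner_Integration.integrable_bound[OF g]) (auto simp: indicator_def intro!: borel_measurable_times[OF borel_imp_halfline_measurable])
    have "(\<integral>x. indicator {0..a} x * g x \<partial>halfline) = (\<integral>x. indicator {0..<a} x * g x \<partial>halfline)"
      by (rule integral_cong_AE[OF _ _ eq]) (auto intro!: borel_measurable_times[OF borel_imp_halfline_measurable])
    with halfline_indicator_has_integral[OF order_refl i] show "(g has_integral 0) {0..a}" using zero[OF a(1)] by simp
    qed auto
    then show ?thesis by (intro zero_integrals_imp_AE_zero True)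
  qed (auto simp: AE_halfline_iff)
  then have "AE x in halfline. \<forall>n::nat. x < real n \<longrightarrow> g x = 0" by (simp only: AE_all_countable) blast
  then have "AE x in halfline. g x = 0" by eventually_elim (meson reals_Archimedean2)
  then show ?thesis by eventually_elim (simp add: g_def)
qed


section \<open>Primitives and their shifts\<close>

definition primitive :: "(real \<Rightarrow> complex) \<Rightarrow> real \<Rightarrow> complex" where
  "primitive q x = (\<integral>y. indicator {..x} y * q y \<partial>halfline)"

lemma L2_local_integrable:
  assumes q: "q \<in> L2"
  shows "integrable halfline (\<lambda>y. indicator {..x} y * q y)"
proof -
  have "(\<lambda>y. indicator {..x} y :: complex) \<in> L2"
  proof (rule L2_bound)
    show "integrable halfline (indicat_real {0..x})"
    proof (subst integrable_restrict_space)
      have "emeasure lborel ({0<..} \<inter> {0..x}) < \<infinity>"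
        by (intro emeasure_bounded_finite bounded_Int) auto
      then show "integrable lebesgue (\<lambda>y. indicat_real {0<..} y *\<^sub>R indicat_real {0..x} y)"
        by (auto simp: indicator_inter_arith[symmetric] integrable_completion intro!: integrable_real_indicator)
    qed simp
  qed (auto simp: AE_halfline_iff indicator_def intro!: borel_imp_halfline_measurable)
  from L2_mult_integrable[OF this q] show ?thesis .
qed

lemma primitive_supp_borel:
  assumes q: "q \<in> supp_borel"
  shows "primitive q x = (\<integral>y. indicator {..x} y * q y \<partial>lborel)" "primitive q \<in> supp_borel"
proof -
  have [measurable]: "q \<in> borel_measurable borel" using q by (rule supp_borelD)
  show *: "primitive q x = (\<integral>y. indicator {..x} y * q y \<partial>lborel)" for x
    unfolding primitive_def by (rule halfline_integral_lborel) (use supp_borelD(2)[OF q] in auto)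
  have "(\<lambda>x. \<integral>y. (if y \<le> x then q y else 0) \<partial>lborel) \<in> borel_measurable borel"
    by measurable
  also have "(\<lambda>x. \<integral>y. (if y \<le> x then q y else 0) \<partial>lborel) = primitive q"
    unfolding * fun_eq_iff by (intro allI Bochner_Integration.integral_cong) auto
  finally have "primitive q \<in> borel_measurable borel" .
  moreover have "primitive q x = 0" if "x \<le> 0" for x
    unfolding * using supp_borelD(2)[OF q] that by (intro integral_eq_zero_AE AE_I2) (auto simp: indicator_def)
  ultimately show "primitive q \<in> supp_borel" by (simp add: supp_borel_def)
qed

text \<open>Exchanging the integrations in \<open>\<integral>\<integral>\<^bsub>y \<le> x\<^esub> q y k x\<close>. It is used twice: with an exponential kernel for
the Laplace transform of the primitive, and with the indicator of \<open>[0, a]\<close> for its integrals.\<close>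

lemma primitive_Fubini:
  fixes k :: "real \<Rightarrow> real" and K :: "real \<Rightarrow> real"
  assumes q: "q \<in> supp_borel" and k: "k \<in> borel_measurable borel" "\<And>x. k x \<ge> 0"
    and K: "\<And>y. y > 0 \<Longrightarrow> has_bochner_integral lborel (\<lambda>x. indicator {y..} x * k x) (K y)"
    and int: "integrable lborel (\<lambda>y. q y * of_real (K y))"
  shows "integrable halfline (\<lambda>x. primitive q x * of_real (k x))"
    "(\<integral>x. primitive q x * of_real (k x) \<partial>halfline) = (\<integral>y. q y * of_real (K y) \<partial>lborel)"
proof -
  have [measurable]: "q \<in> borel_measurable borel" "k \<in> borel_measurable borel" using supp_borelD(1)[OF q] k by auto
  note P = primitive_supp_borel[OF q]
  define f where "f y x = (if y \<le> x then q y * of_real (k x) else 0)" for y x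
  have f [measurable]: "case_prod f \<in> borel_measurable (lborel \<Otimes>\<^sub>M lborel)"
    unfolding f_def by measurable
  have K0: "K y \<ge> 0" if "y > 0" for y
    using K[OF that] k(2) Bochner_Integration.integral_nonneg[of lborel "\<lambda>x. indicat_real {y..} x * k x"]
    by (simp add: has_bochner_integral_iff)
  have fy: "has_bochner_integral lborel (f y) (q y * of_real (K y))"
    "(\<integral>x. norm (f y x) \<partial>lborel) = norm (q y * of_real (K y))" for y
  proof -
    have "has_bochner_integral lborel (f y) (q y * of_real (K y)) \<and> (\<integral>x. norm (f y x) \<partial>lborel) = norm (q y * of_real (K y))"
    proof (cases "y > 0")
      case True
      have f1: "f y = (\<lambda>x. q y * of_real (indicator {y..} x * k x))"
        by (auto simp: f_def indicator_def)
      have f2: "(\<lambda>x. norm (f y x)) = (\<lambda>x. norm (q y) * (indicator {y..} x * k x))"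
        unfolding f1 using k(2) by (auto simp: norm_mult)
      have "has_bochner_integral lborel (f y) (q y * of_real (K y))"
        unfolding f1 by (intro has_bochner_integral_mult_right has_bochner_integral_of_real K True)
      moreover have "(\<integral>x. norm (f y x) \<partial>lborel) = norm (q y * of_real (K y))"
        unfolding f2 using K[OF True] K0[OF True] by (simp add: has_bochner_integral_iff norm_mult)
      ultimately show ?thesis by blast
    next
      case False
      then have "q y = 0" using supp_borelD(2)[OF q] by simp
      then have "f y = (\<lambda>x. 0)" by (auto simp: f_def)
      then show ?thesis using \<open>q y = 0\<close> by (simp add: has_bochner_integral_zero)
    qed
    then show "has_bochner_integral lborel (f y) (q y * of_real (K y))"
      "(\<integral>x. norm (f y x) \<partial>lborel) = norm (q y * of_real (K y))" by auto
  qed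
  have F: "integrable (lborel \<Otimes>\<^sub>M lborel) (case_prod f)"
  proof (rule lborel_pair.Fubini_integrable)
    show "integrable lborel (\<lambda>y. \<integral>x. norm (case (y, x) of (y, x) \<Rightarrow> f y x) \<partial>lborel)"
      using integrable_norm[OF int] by (simp add: fy(2))
    show "AE y in lborel. integrable lborel (\<lambda>x. case (y, x) of (y, x) \<Rightarrow> f y x)"
      using fy(1) by (auto simp: has_bochner_integral_iff)
  qed measurable
  have inner: "(\<integral>y. f y x \<partial>lborel) = primitive q x * of_real (k x)" for x
  proof -
    have "(\<integral>y. f y x \<partial>lborel) = (\<integral>y. indicator {..x} y * q y * of_real (k x) \<partial>lborel)"
      by (intro Bochner_Integration.integral_cong) (auto simp: f_def)
    then show ?thesis by (simp add: P(1))
  qed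
  have 0: "primitive q x * of_real (k x) = 0" if "x \<le> 0" for x
    using supp_borelD(2)[OF P(2) that] by simp
  have m: "(\<lambda>x. primitive q x * of_real (k x)) \<in> borel_measurable borel"
    using supp_borelD(1)[OF P(2)] by measurable
  have hl: "integrable halfline (\<lambda>x. primitive q x * of_real (k x)) \<longleftrightarrow> integrable lborel (\<lambda>x. primitive q x * of_real (k x))"
    "(\<integral>x. primitive q x * of_real (k x) \<partial>halfline) = (\<integral>x. primitive q x * of_real (k x) \<partial>lborel)"
    by (rule halfline_integral_lborel[OF m], erule 0)+
  show "integrable halfline (\<lambda>x. primitive q x * of_real (k x))"
    using lborel_pair.integrable_snd[OF F] unfolding inner hl .
  have "(\<integral>x. primitive q x * of_real (k x) \<partial>lborel) = (\<integral>y. (\<integral>x. f y x \<partial>lborel) \<partial>lborel)"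
    using lborel_pair.Fubini_integral[OF F] unfolding inner .
  also have "\<dots> = (\<integral>y. q y * of_real (K y) \<partial>lborel)" using fy(1) by (simp add: has_bochner_integral_iff)
  finally show "(\<integral>x. primitive q x * of_real (k x) \<partial>halfline) = (\<integral>y. q y * of_real (K y) \<partial>lborel)"
    unfolding hl .
qed

lemma L2_supp_borel_iff:
  assumes "f \<in> supp_borel"
  shows "f \<in> L2 \<longleftrightarrow> integrable lborel (\<lambda>x. (norm (f x))\<^sup>2)"
proof -
  have [measurable]: "f \<in> borel_measurable borel" using assms by (rule supp_borelD)
  have "integrable halfline (\<lambda>x. (norm (f x))\<^sup>2) \<longleftrightarrow> integrable lborel (\<lambda>x. (norm (f x))\<^sup>2)"
    by (rule halfline_integral_lborel) (use supp_borelD(2)[OF assms] in auto)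
  then show ?thesis by (auto simp: L2_def borel_imp_halfline_measurable)
qed

lemma primitive_minus_shift:
  assumes q: "q \<in> supp_borel" "q \<in> L2" and t: "t \<ge> 0"
  shows "primitive q x - right_shift t (primitive q) x = (\<integral>r. indicator {0..t} r * q (x - r) \<partial>lborel)"
proof -
  have [measurable]: "q \<in> borel_measurable borel" using q by (auto intro: supp_borelD)
  note P = primitive_supp_borel[OF q(1)]
  have i: "integrable lborel (\<lambda>y. indicator {..x} y * q y)" for x
    using L2_local_integrable[OF q(2), of x]
    by (subst (asm) halfline_integral_lborel(1)) (use supp_borelD(2)[OF q(1)] in auto)
  have "primitive q x - right_shift t (primitive q) x = (\<integral>y. indicator {..x} y * q y \<partial>lborel) - (\<integral>y. indicator {..x-t} y * q y \<partial>lborel)"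
    by (simp add: right_shift_supp_borel[OF P(2) t] P(1))
  also have "\<dots> = (\<integral>y. indicator {..x} y * q y - indicator {..x-t} y * q y \<partial>lborel)"
    by (rule Bochner_Integration.integral_diff[symmetric]) (rule i)+
  also have "\<dots> = (\<integral>y. indicator {x-t<..x} y * q y \<partial>lborel)"
    by (rule Bochner_Integration.integral_cong) (use t in \<open>auto simp: indicator_def\<close>)
  also have "\<dots> = (\<integral>r. indicator {x-t<..x} (x + (-1) * r) * q (x + (-1) * r) \<partial>lborel)"
    using lborel_integral_real_affine[of "-1" "\<lambda>y. indicator {x-t<..x} y * q y" x] by simp
  also have "\<dots> = (\<integral>r. indicator {0..t} r * q (x - r) \<partial>lborel)"
  proof (rule integral_cong_AE)
    show "AE r in lborel. indicator {x-t<..x} (x + (-1) * r) * q (x + (-1) * r) = indicator {0..t} r * q (x - r)"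
      using AE_lborel_singleton[of t] by eventually_elim (auto simp: indicator_def)
  qed measurable
  finally show ?thesis .
qed

text \<open>The primitive itself need not be square integrable, but this difference averages \<open>q\<close> over a window
of length \<open>t\<close>. The Cauchy-Schwarz inequality on the window and Tonelli's theorem bound its norm by
\<open>t\<close> times that of \<open>q\<close>.\<close>

lemma primitive_minus_shift_L2:
  assumes q: "q \<in> supp_borel" "q \<in> L2" and t: "t \<ge> 0"
  shows "(\<lambda>x. primitive q x - right_shift t (primitive q) x) \<in> L2"
proof -
  have [measurable]: "q \<in> borel_measurable borel" using q by (auto intro: supp_borelD)
  note P = primitive_supp_borel[OF q(1)]
  note S = right_shift_supp_borel[OF P(2) t]
  define p where "p x = primitive q x - right_shift t (primitive q) x" for x
  have p: "p \<in> supp_borel" unfolding p_def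
    using supp_borelD[OF P(2)] supp_borelD[OF S(2)] by (auto simp: supp_borel_def)
  have [measurable]: "p \<in> borel_measurable borel" using p by (rule supp_borelD)
  have q2: "integrable lborel (\<lambda>x. (norm (q x))\<^sup>2)" using q L2_supp_borel_iff by simp
  have qr: "integrable lborel (\<lambda>r. (norm (q (x - r)))\<^sup>2)" for x
    using lborel_integrable_real_affine[OF q2, of "-1" x] by simp
  have bound: "ennreal ((norm (p x))\<^sup>2) \<le> ennreal t * (\<integral>\<^sup>+r. indicator {0..t} r * ennreal ((norm (q (x - r)))\<^sup>2) \<partial>lborel)" for x
  proof -
    define h where "h r = indicator {0<..t} r * q (x - r)" for r
    define e where "e r = (indicator {0<..t} r :: complex)" for r :: real
    have [measurable]: "h \<in> borel_measurable borel" "e \<in> borel_measurable borel" unfolding h_def e_def by measurable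
    have h: "h \<in> supp_borel" and e: "e \<in> supp_borel" by (auto simp: supp_borel_def) (auto simp: h_def e_def)
    have hsq: "(norm (h r))\<^sup>2 = indicator {0<..t} r * (norm (q (x - r)))\<^sup>2"
      and esq: "(norm (e r))\<^sup>2 = indicator {0<..t} r" for r by (auto simp: h_def e_def indicator_def)
    have hi: "integrable lborel (\<lambda>r. (norm (h r))\<^sup>2)"
      unfolding hsq by (rule integrable_mult_indicator[OF _ qr, of _ x, unfolded real_scaleR_def]) simp
    have ei: "integrable lborel (\<lambda>r. (norm (e r))\<^sup>2)" unfolding esq using t by (intro integrable_real_indicator) auto
    have hL: "h \<in> L2" "e \<in> L2" using h e hi ei L2_supp_borel_iff by auto
    have eN: "(L2_norm e)\<^sup>2 = t" and hN: "(L2_norm h)\<^sup>2 = (\<integral>r. (norm (h r))\<^sup>2 \<partial>lborel)"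
    proof -
      have "(L2_norm e)\<^sup>2 = (\<integral>r. (norm (e r))\<^sup>2 \<partial>lborel)" unfolding L2_norm_sq
        by (rule halfline_integral_lborel(2)) (use supp_borelD(2)[OF e] in auto)
      also have "\<dots> = t" unfolding esq using t by simp
      finally show "(L2_norm e)\<^sup>2 = t" .
      show "(L2_norm h)\<^sup>2 = (\<integral>r. (norm (h r))\<^sup>2 \<partial>lborel)" unfolding L2_norm_sq
        by (rule halfline_integral_lborel(2)) (use supp_borelD(2)[OF h] in auto)
    qed
    have "p x = (\<integral>r. h r \<partial>lborel)" unfolding p_def primitive_minus_shift[OF q t]
    proof (rule integral_cong_AE)
      show "AE r in lborel. indicator {0..t} r * q (x - r) = h r"
        using AE_lborel_singleton[of 0] by eventually_elim (auto simp: h_def indicator_def)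
    qed measurable
    then have "norm (p x) \<le> (\<integral>r. norm (h r) \<partial>lborel)" by simp
    also have "\<dots> = (\<integral>r. norm (h r) \<partial>halfline)"
      by (rule halfline_integral_lborel(2)[symmetric]) (use supp_borelD(2)[OF h] in auto)
    also have "\<dots> = (\<integral>r. norm (e r * h r) \<partial>halfline)"
      by (intro Bochner_Integration.integral_cong) (auto simp: e_def h_def indicator_def)
    also have "\<dots> \<le> L2_norm e * L2_norm h" by (rule L2_norm_mult_integral_le) fact+
    finally have "(norm (p x))\<^sup>2 \<le> (L2_norm e * L2_norm h)\<^sup>2" by (intro power_mono) auto
    also have "\<dots> = t * (\<integral>r. (norm (h r))\<^sup>2 \<partial>lborel)" by (simp add: power_mult_distrib eN hN)
    finally have "ennreal ((norm (p x))\<^sup>2) \<le> ennreal (t * (\<integral>r. (norm (h r))\<^sup>2 \<partial>lborel))" by (rule ennreal_leI)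
    also have "\<dots> = ennreal t * (\<integral>\<^sup>+r. ennreal ((norm (h r))\<^sup>2) \<partial>lborel)"
      using t hi by (simp add: ennreal_mult nn_integral_eq_integral)
    also have "\<dots> \<le> ennreal t * (\<integral>\<^sup>+r. indicator {0..t} r * ennreal ((norm (q (x - r)))\<^sup>2) \<partial>lborel)"
      by (intro mult_left_mono nn_integral_mono) (auto simp: h_def indicator_def)
    finally show ?thesis .
  qed
  have "(\<integral>\<^sup>+x. ennreal ((norm (p x))\<^sup>2) \<partial>lborel)
     \<le> (\<integral>\<^sup>+x. ennreal t * (\<integral>\<^sup>+r. indicator {0..t} r * ennreal ((norm (q (x - r)))\<^sup>2) \<partial>lborel) \<partial>lborel)"
    by (intro nn_integral_mono bound)
  also have "\<dots> = ennreal t * (\<integral>\<^sup>+x. \<integral>\<^sup>+r. indicator {0..t} r * ennreal ((norm (q (x - r)))\<^sup>2) \<partial>lborel \<partial>lborel)"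
    by (rule nn_integral_cmult) measurable
  also have "(\<integral>\<^sup>+x. \<integral>\<^sup>+r. indicator {0..t} r * ennreal ((norm (q (x - r)))\<^sup>2) \<partial>lborel \<partial>lborel)
    = (\<integral>\<^sup>+r. \<integral>\<^sup>+x. indicator {0..t} r * ennreal ((norm (q (x - r)))\<^sup>2) \<partial>lborel \<partial>lborel)"
    by (rule lborel_pair.Fubini') measurable
  also have "\<dots> = (\<integral>\<^sup>+r. indicator {0..t} r * (\<integral>\<^sup>+x. ennreal ((norm (q x))\<^sup>2) \<partial>lborel) \<partial>lborel)"
  proof (rule nn_integral_cong)
    fix r :: real
    have "(\<integral>\<^sup>+x. ennreal ((norm (q x))\<^sup>2) \<partial>lborel) = (\<integral>\<^sup>+x. ennreal ((norm (q (- r + 1 * x)))\<^sup>2) \<partial>lborel)"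
      using nn_integral_real_affine[of "\<lambda>x. ennreal ((norm (q x))\<^sup>2)" 1 "- r"] by simp
    then have "(\<integral>\<^sup>+x. ennreal ((norm (q (x - r)))\<^sup>2) \<partial>lborel) = (\<integral>\<^sup>+x. ennreal ((norm (q x))\<^sup>2) \<partial>lborel)" by simp
    then show "(\<integral>\<^sup>+x. indicator {0..t} r * ennreal ((norm (q (x - r)))\<^sup>2) \<partial>lborel)
       = indicator {0..t} r * (\<integral>\<^sup>+x. ennreal ((norm (q x))\<^sup>2) \<partial>lborel)"
      by (simp add: nn_integral_cmult)
  qed
  also have "\<dots> = ennreal t * (\<integral>\<^sup>+x. ennreal ((norm (q x))\<^sup>2) \<partial>lborel)"
    using t by (simp add: nn_integral_multc)
  finally have "(\<integral>\<^sup>+x. ennreal ((norm (p x))\<^sup>2) \<partial>lborel) \<le> ennreal t * (ennreal t * (\<integral>\<^sup>+x. ennreal ((norm (q x))\<^sup>2) \<partial>lborel))" .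
  also have "\<dots> < \<infinity>"
    using q2 by (auto simp: integrable_iff_bounded ennreal_mult_less_top)
  finally have "integrable lborel (\<lambda>x. (norm (p x))\<^sup>2)" by (intro integrableI_bounded) auto
  then show ?thesis using p L2_supp_borel_iff[OF p] by (simp add: p_def[abs_def])
qed

text \<open>The difference is \<open>\<integral>\<^sub>0\<^sup>t right_shift r q dr\<close>, and the pairing with \<open>u\<close> may be taken under this
integral.\<close>

lemma bilin_primitive_minus_shift:
  assumes u: "u \<in> L2" and q: "q \<in> supp_borel" "q \<in> L2" and t: "t \<ge> 0"
    and cont: "continuous_on {0..t} (\<lambda>r. L2_bilin u (right_shift r q))"
  shows "L2_bilin u (\<lambda>x. primitive q x - right_shift t (primitive q) x)
    = integral {0..t} (\<lambda>r. L2_bilin u (right_shift r q))"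
proof -
  have [measurable]: "q \<in> borel_measurable borel" using q by (auto intro: supp_borelD)
  obtain v where v: "v \<in> supp_borel" "v \<in> L2" "u \<doteq> v" using L2_supp_borel[OF u] .
  have [measurable]: "v \<in> borel_measurable borel" using v(1) by (rule supp_borelD)
  have uv: "L2_bilin u g = (\<integral>x. v x * g x \<partial>lborel)" if g: "g \<in> supp_borel" "g \<in> L2" for g
  proof -
    have "L2_bilin u g = L2_bilin v g" by (rule L2_bilin_cong[OF u v(2,3) g(2) g(2)]) simp
    also have "\<dots> = (\<integral>x. v x * g x \<partial>lborel)" unfolding L2_bilin_def
      by (rule halfline_integral_lborel) (use supp_borelD[OF v(1)] supp_borelD[OF g(1)] in auto)
    finally show ?thesis .
  qed
  have vint: "integrable lborel (\<lambda>x. v x * g x)" if g: "g \<in> supp_borel" "g \<in> L2" for g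
    using L2_mult_integrable[OF v(2) g(2)]
    by (subst (asm) halfline_integral_lborel(1)) (use supp_borelD[OF v(1)] supp_borelD[OF g(1)] in auto)
  have S: "right_shift r q \<in> supp_borel" "right_shift r q \<in> L2" "right_shift r q = (\<lambda>x. q (x - r))" if "r \<ge> 0" for r
    using right_shift_supp_borel[OF q(1) that] right_shift_L2[OF q(2) that] by auto
  define f where "f r x = indicator {0..t} r * (v x * q (x - r))" for r x
  have f [measurable]: "case_prod f \<in> borel_measurable (lborel \<Otimes>\<^sub>M lborel)"
    unfolding f_def by measurable
  have fr: "f r = (\<lambda>x. indicator {0..t} r * (v x * right_shift r q x))" if "r \<ge> 0" for r
    unfolding f_def fun_eq_iff S(3)[OF that] by simp
  have f0: "f r = (\<lambda>x. 0)" if "\<not> r \<ge> 0" for r using that by (auto simp: f_def)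
  have F: "integrable (lborel \<Otimes>\<^sub>M lborel) (case_prod f)"
  proof (rule lborel_pair.Fubini_integrable)
    have B: "(\<integral>x. norm (f r x) \<partial>lborel) \<le> indicator {0..t} r * (L2_norm v * L2_norm q)" for r
    proof (cases "r \<ge> 0")
      case True
      have "(\<integral>x. norm (f r x) \<partial>lborel) = indicator {0..t} r * (\<integral>x. norm (v x * right_shift r q x) \<partial>lborel)"
        unfolding fr[OF True] by (simp add: norm_mult indicator_def)
      also have "(\<integral>x. norm (v x * right_shift r q x) \<partial>lborel) = (\<integral>x. norm (v x * right_shift r q x) \<partial>halfline)"
        by (rule halfline_integral_lborel(2)[symmetric])
          (use supp_borelD[OF v(1)] supp_borelD[OF S(1)[OF True]] in auto)
      also have "\<dots> \<le> L2_norm v * L2_norm (right_shift r q)"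
        by (rule L2_norm_mult_integral_le[OF v(2) S(2)[OF True]])
      also have "L2_norm (right_shift r q) = L2_norm q" by (rule right_shift_norm[OF q(2) True])
      finally show ?thesis by (simp add: mult_left_mono)
    qed (simp add: f0 L2_norm_def)
    show "integrable lborel (\<lambda>r. \<integral>x. norm (case (r, x) of (r, x) \<Rightarrow> f r x) \<partial>lborel)"
    proof (rule Bochner_Integration.integrable_bound)
      show "integrable lborel (\<lambda>r. indicator {0..t} r * (L2_norm v * L2_norm q))"
        using t by (intro integrable_mult_left integrable_real_indicator) auto
      show "AE r in lborel. norm (\<integral>x. norm (case (r, x) of (r, x) \<Rightarrow> f r x) \<partial>lborel) \<le> norm (indicator {0..t} r * (L2_norm v * L2_norm q))"
        using order_trans[OF B abs_ge_self] by (intro AE_I2) simp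
    qed measurable
    have "integrable lborel (f r)" for r
      by (cases "r \<ge> 0") (auto simp: fr f0 intro!: integrable_mult_right vint S)
    then show "AE r in lborel. integrable lborel (\<lambda>x. case (r, x) of (r, x) \<Rightarrow> f r x)" by simp
  qed measurable
  have "L2_bilin u (\<lambda>x. primitive q x - right_shift t (primitive q) x)
    = (\<integral>x. v x * (primitive q x - right_shift t (primitive q) x) \<partial>lborel)"
  proof (rule uv)
    note P = primitive_supp_borel[OF q(1)]
    note S = right_shift_supp_borel[OF P(2) t]
    show "(\<lambda>x. primitive q x - right_shift t (primitive q) x) \<in> supp_borel"
      using supp_borelD[OF P(2)] supp_borelD[OF S(2)] by (auto simp: supp_borel_def)
  qed (rule primitive_minus_shift_L2[OF q t])
  also have "\<dots> = (\<integral>x. (\<integral>r. f r x \<partial>lborel) \<partial>lborel)"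
    by (simp add: primitive_minus_shift[OF q t] f_def mult.left_commute)
  also have "\<dots> = (\<integral>r. (\<integral>x. f r x \<partial>lborel) \<partial>lborel)"
    by (rule lborel_pair.Fubini_integral[OF F])
  also have "\<dots> = (\<integral>r. indicator {0..t} r *\<^sub>R L2_bilin u (right_shift r q) \<partial>lborel)"
  proof (rule Bochner_Integration.integral_cong)
    fix r :: real
    show "(\<integral>x. f r x \<partial>lborel) = indicator {0..t} r *\<^sub>R L2_bilin u (right_shift r q)"
      by (cases "r \<ge> 0") (auto simp: fr f0 uv[OF S(1,2)] indicator_def)
  qed simp
  also have "\<dots> = integral {0..t} (\<lambda>r. L2_bilin u (right_shift r q))"
    using set_borel_integral_eq_integral(2)[OF borel_integrable_atLeastAtMost'[OF cont]]
    by (simp add: set_lebesgue_integral_def)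
  finally show ?thesis .
qed

text \<open>For Borel representatives the pairing is a parameter integral of a jointly measurable integrand.\<close>

lemma measurable_shift_pairing:
  assumes c: "c \<in> borel_measurable halfline" and g: "g \<in> borel_measurable halfline"
  shows "(\<lambda>t. L2_inner (\<lambda>x. c x - right_shift t c x) g) \<in> borel_measurable (lebesgue_on {0<..})"
proof -
  obtain c' where c': "c' \<in> supp_borel" "c \<doteq> c'" using supp_borel_representative[OF c] .
  obtain g' where g': "g' \<in> supp_borel" "g \<doteq> g'" using supp_borel_representative[OF g] .
  have [measurable]: "c' \<in> borel_measurable borel" "g' \<in> borel_measurable borel"
    using c'(1) g'(1) by (auto intro: supp_borelD)
  have "L2_inner (\<lambda>x. c x - right_shift t c x) g = (\<integral>x. (c' x - c' (x - t)) * cnj (g' x) \<partial>lborel)" if t: "t > 0" for t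
  proof -
    have "L2_inner (\<lambda>x. c x - right_shift t c x) g = (\<integral>x. (c' x - c' (x - t)) * cnj (g' x) \<partial>halfline)"
      unfolding L2_inner_def
    proof (rule integral_cong_AE)
      have [measurable]: "right_shift t c \<in> borel_measurable halfline" "c \<in> borel_measurable halfline" "g \<in> borel_measurable halfline"
        using right_shift_measurable[OF c] t c g by auto
      show "(\<lambda>x. (c x - right_shift t c x) * cnj (g x)) \<in> borel_measurable halfline" by measurable
      show "(\<lambda>x. (c' x - c' (x - t)) * cnj (g' x)) \<in> borel_measurable halfline"
        by (rule borel_imp_halfline_measurable) measurable
      have "right_shift t c \<doteq> right_shift t c'" using t c'(2) by (intro right_shift_cong) auto
      with c'(2) g'(2) show "AE x in halfline. (c x - right_shift t c x) * cnj (g x) = (c' x - c' (x - t)) * cnj (g' x)"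
        by eventually_elim (use t in \<open>simp add: right_shift_supp_borel[OF c'(1)]\<close>)
    qed
    also have "\<dots> = (\<integral>x. (c' x - c' (x - t)) * cnj (g' x) \<partial>lborel)"
      by (rule halfline_integral_lborel(2)) (use supp_borelD(2)[OF g'(1)] in auto)
    finally show ?thesis .
  qed
  moreover have "(\<lambda>t. \<integral>x. (c' x - c' (x - t)) * cnj (g' x) \<partial>lborel) \<in> borel_measurable halfline"
    by (rule borel_imp_halfline_measurable) measurable
  ultimately show ?thesis by (subst measurable_cong) (auto simp: space_restrict_space)
qed

section \<open>Laplace transforms of primitives and of conjugates\<close>

lemma exp_kernel_integral:
  assumes s: "s > (0::real)"
  shows "has_bochner_integral lborel (\<lambda>x. indicator {y..} x * exp (- s * x)) (exp (- s * y) / s)"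
proof -
  have hi: "((\<lambda>x. exp (- s * x)) has_integral exp (- s * y) / s) {y..}"
    by (rule has_integral_exp_minus_to_infinity[OF s])
  then have "(\<lambda>x. exp (- s * x)) absolutely_integrable_on {y..}"
    by (intro nonnegative_absolutely_integrable_1) (auto simp: integrable_on_def)
  then have "integrable lborel (\<lambda>x. indicat_real {y..} x *\<^sub>R exp (- s * x))"
    by (simp add: set_integrable_def integrable_completion)
  then have set: "set_integrable lborel {y..} (\<lambda>x. exp (- s * x))" by (simp add: set_integrable_def)
  show ?thesis
    using set set_borel_integral_eq_integral(2)[OF set] hi
    by (auto simp: has_bochner_integral_iff set_integrable_def set_lebesgue_integral_def dest: integral_unique)
qed

lemma has_laplace_diff:
  assumes "has_laplace f z a" "has_laplace g z b" shows "has_laplace (\<lambda>x. f x - g x) z (a - b)"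
  using assms by (auto simp: has_laplace_def left_diff_distrib)

lemma has_laplace_add:
  assumes "has_laplace f z a" "has_laplace g z b" shows "has_laplace (\<lambda>x. f x + g x) z (a + b)"
  using assms by (auto simp: has_laplace_def distrib_right)

lemma exp_complex_kernel: "exp (- (complex_of_real s * of_real x)) = of_real (exp (- s * x))"
  by (simp only: exp_of_real[symmetric] of_real_mult of_real_minus mult_minus_left)

text \<open>Integrability of \<open>f e\<^sup>-\<^sup>s\<^sup>x\<close> contains the measurability of \<open>f\<close>.\<close>

lemma has_laplace_measurable:
  assumes "has_laplace f (of_real s) a" shows "f \<in> borel_measurable halfline"
proof -
  have "(\<lambda>x. f x * exp (- (of_real s * of_real x))) \<in> borel_measurable halfline"
    using assms by (auto simp: has_laplace_def)
  moreover have "(\<lambda>x. exp (complex_of_real s * of_real x)) \<in> borel_measurable halfline"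
    by (rule borel_imp_halfline_measurable) measurable
  ultimately have "(\<lambda>x. f x * exp (- (of_real s * of_real x)) * exp (of_real s * of_real x)) \<in> borel_measurable halfline"
    by (rule borel_measurable_times)
  then show ?thesis by (simp add: mult.assoc flip: exp_add)
qed

lemma has_laplace_cong_AE:
  assumes "f \<doteq> g" "g \<in> borel_measurable halfline" "has_laplace f (z) a" shows "has_laplace g z a"
proof -
  have "(\<lambda>x. exp (- (z * complex_of_real x))) \<in> borel_measurable halfline"
    by (rule borel_imp_halfline_measurable) measurable
  then have g: "(\<lambda>x. g x * exp (- (z * of_real x))) \<in> borel_measurable halfline"
    using assms(2) by (intro borel_measurable_times)
  have f: "(\<lambda>x. f x * exp (- (z * of_real x))) \<in> borel_measurable halfline"
    using assms(3) by (auto simp: has_laplace_def)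
  have eq: "AE x in halfline. f x * exp (- (z * of_real x)) = g x * exp (- (z * of_real x))"
    using assms(1) by eventually_elim simp
  show ?thesis using assms(3) integrable_cong_AE[OF f g eq] integral_cong_AE[OF f g eq] by (simp add: has_laplace_def)
qed

lemma laplace_unique:
  assumes "\<And>s. s > \<sigma> \<Longrightarrow> has_laplace f (of_real s) (F s)" "\<And>s. s > \<sigma> \<Longrightarrow> has_laplace g (of_real s) (F s)"
  shows "f \<doteq> g"
proof -
  have "(\<lambda>x. f x - g x) \<doteq> (\<lambda>_. 0)"
  proof (rule laplace_unique_zero[where \<sigma>="\<sigma> + 1"])
    fix n :: nat
    show "has_laplace (\<lambda>x. f x - g x) (of_real (\<sigma> + 1 + real n)) 0"
      using has_laplace_diff[OF assms(1) assms(2), of "\<sigma> + 1 + real n"] by simp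
  qed
  then show ?thesis by eventually_elim simp
qed

lemma has_laplace_primitive:
  assumes q: "q \<in> supp_borel" and s: "s > 0" and lap: "has_laplace q (of_real s) w"
  shows "has_laplace (primitive q) (of_real s) (w / of_real s)"
proof -
  have [measurable]: "q \<in> borel_measurable borel" using q by (rule supp_borelD)
  have int: "integrable lborel (\<lambda>y. q y * of_real (exp (- s * y)))" "(\<integral>y. q y * of_real (exp (- s * y)) \<partial>lborel) = w"
    using lap halfline_integral_lborel[of "\<lambda>y. q y * of_real (exp (- s * y))"] supp_borelD(2)[OF q]
    by (auto simp: has_laplace_def exp_complex_kernel)
  have int': "integrable lborel (\<lambda>y. q y * of_real (exp (- s * y) / s))"
    using Bochner_Integration.integrable_divide[OF int(1), of "of_real s"] by simp
  have w': "(\<integral>y. q y * of_real (exp (- s * y) / s) \<partial>lborel) = w / of_real s"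
    using int(2) by simp
  from primitive_Fubini[OF q _ _ exp_kernel_integral[OF s] int'] w'
  show ?thesis unfolding has_laplace_def exp_complex_kernel by simp
qed

lemma has_laplace_cnj:
  assumes "has_laplace f (of_real s) a" shows "has_laplace (\<lambda>x. cnj (f x)) (of_real s) (cnj a)"
proof -
  have "(\<lambda>x. cnj (f x) * exp (- (complex_of_real s * of_real x))) = (\<lambda>x. cnj (f x * exp (- (complex_of_real s * of_real x))))"
    by (simp only: exp_complex_kernel complex_cnj_mult complex_cnj_complex_of_real)
  then show ?thesis using assms by (simp only: has_laplace_def integrable_cnj Bochner_Integration.integral_cnj)
qed

lemma AE_real_integral:
  fixes f :: "real \<Rightarrow> complex"
  assumes "integrable halfline f" "AE x in halfline. f x \<in> \<real>"
  shows "(\<integral>x. f x \<partial>halfline) \<in> \<real>"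
proof -
  have "(\<integral>x. f x \<partial>halfline) = (\<integral>x. of_real (Re (f x)) \<partial>halfline)"
    by (rule integral_cong_AE) (use assms in \<open>auto elim!: eventually_mono Reals_cases\<close>)
  also have "\<dots> = of_real (\<integral>x. Re (f x) \<partial>halfline)" by (rule integral_complex_of_real)
  finally show ?thesis by simp
qed

lemma L2_inner_real:
  assumes "f \<in> L2" "g \<in> L2_real" shows "L2_inner f g = L2_bilin f g"
  unfolding L2_inner_def L2_bilin_def
proof (rule integral_cong_AE)
  have g: "g \<in> L2" "AE x in halfline. g x \<in> \<real>" using assms by (auto simp: L2_real_def)
  show "(\<lambda>x. f x * cnj (g x)) \<in> borel_measurable halfline" "(\<lambda>x. f x * g x) \<in> borel_measurable halfline"
    using L2_inner_integrable[OF assms(1) g(1)] L2_mult_integrable[OF assms(1) g(1)] by auto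
  show "AE x in halfline. f x * cnj (g x) = f x * g x"
    using g(2) by eventually_elim (simp add: Reals_cnj_iff)
qed

section \<open>Indicators of initial intervals as test functions\<close>

definition ind :: "real \<Rightarrow> real \<Rightarrow> complex" where
  "ind b x = indicator {0..b} x"

lemma ind_measurable [measurable]: "ind b \<in> borel_measurable borel"
  unfolding ind_def[abs_def] by measurable

lemma ind_L2: "ind b \<in> L2"
proof (rule L2_bound)
  have "emeasure lborel ({0<..} \<inter> {0..b}) < \<infinity>"
    by (intro emeasure_bounded_finite bounded_Int) auto
  then show "integrable halfline (indicat_real {0..b})"
    by (subst integrable_restrict_space) (auto simp: indicator_inter_arith[symmetric] integrable_completion intro!: integrable_real_indicator)
  show "ind b \<in> borel_measurable halfline" by (rule borel_imp_halfline_measurable) measurable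
qed (auto simp: ind_def indicator_def)

lemma bilin_ind_has_integral:
  assumes "f \<in> L2" shows "(f has_integral L2_bilin f (ind b)) {0..b}"
  using halfline_indicator_has_integral[of 0 b f] L2_mult_integrable[OF assms ind_L2[of b]]
  by (simp add: ind_def L2_bilin_def mult.commute)

text \<open>Because of this modulus of continuity the indicators can serve as test vectors that move with time.\<close>

lemma dist_ind:
  assumes "0 \<le> a" "a \<le> b" shows "dist (cls (ind b)) (cls (ind a)) = sqrt (b - a)"
proof -
  have "dist (cls (ind b)) (cls (ind a)) = L2_norm (\<lambda>x. ind b x - ind a x)"
    by (simp add: dist_norm cls_diff ind_L2 norm_cls L2_diff)
  moreover have "(\<integral>x. (norm (ind b x - ind a x))\<^sup>2 \<partial>halfline) = (\<integral>x. (norm (ind b x - ind a x))\<^sup>2 \<partial>lborel)"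
    by (rule halfline_integral_lborel(2)) (use assms in \<open>auto simp: ind_def indicator_def\<close>)
  moreover have "(\<lambda>x. (norm (ind b x - ind a x))\<^sup>2) = indicat_real {a<..b}"
    using assms by (auto simp: ind_def indicator_def fun_eq_iff)
  ultimately show ?thesis using assms by (simp add: L2_norm_def)
qed

lemma continuous_ind: "continuous_on {0..} (\<lambda>b. cls (ind b))"
proof -
  have *: "dist (cls (ind b)) (cls (ind a)) = sqrt \<bar>b - a\<bar>" if "0 \<le> a" "0 \<le> b" for a b
    using dist_ind[of a b] dist_ind[of b a] that by (cases "a \<le> b") (auto simp: dist_commute)
  show ?thesis unfolding continuous_on_iff
  proof (intro ballI allI impI)
    fix a e :: real assume a: "a \<in> {0..}" and e: "e > 0"
    have "dist (cls (ind b)) (cls (ind a)) < e" if "b \<in> {0..}" "dist b a < e\<^sup>2" for b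
    proof -
      have "sqrt \<bar>b - a\<bar> < sqrt (e\<^sup>2)" using that(2) by (simp only: real_sqrt_less_iff dist_real_def)
      also have "sqrt (e\<^sup>2) = e" using e by (intro real_sqrt_unique) auto
      finally have "sqrt \<bar>b - a\<bar> < e" .
      moreover have "dist (cls (ind b)) (cls (ind a)) = sqrt \<bar>b - a\<bar>" by (rule *) (use a that(1) in auto)
      ultimately show ?thesis by (simp only:)
    qed
    then show "\<exists>d>0. \<forall>b\<in>{0..}. dist b a < d \<longrightarrow> dist (cls (ind b)) (cls (ind a)) < e"
      using e by (intro exI[of _ "e\<^sup>2"]) simp
  qed
qed

lemma locally_absolutely_continuous_FTC:
  assumes ac: "locally_absolutely_continuous f" and d: "AE x in halfline. (f has_vector_derivative f' x) (at x)"
    and xy: "0 \<le> x" "x \<le> y"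
  shows "(f' has_integral (f y - f x)) {x..y}"
proof -
  obtain N where N: "N \<in> null_sets lborel" "{x. \<not> (0 < x \<longrightarrow> (f has_vector_derivative f' x) (at x))} \<subseteq> N"
    using d unfolding AE_halfline_iff by (auto elim!: AE_E simp: null_sets_def)
  have "N \<in> null_sets lebesgue" using N(1) by (rule null_sets_completionI)
  then have neg: "negligible (insert 0 N)" by (simp add: negligible_iff_null_sets[symmetric])
  show ?thesis
  proof (rule absolutely_continuous_FTC[OF xy(2) _ neg])
    have "absolutely_continuous_on {0..y} f" using ac xy by (auto simp: locally_absolutely_continuous_def)
    then show "absolutely_continuous_on {x..y} f" by (rule absolutely_continuous_on_subset) (use xy in auto)
    show "(f has_vector_derivative f' u) (at u within {x..y})" if "u \<in> {x..y} - insert 0 N" for u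
    proof -
      have "u \<noteq> 0" "u \<in> {x..y}" "u \<notin> N" using that by blast+
      then have "0 < u" using xy by simp
      with N(2) \<open>u \<notin> N\<close> have "(f has_vector_derivative f' u) (at u)" by blast
      then show ?thesis by (rule has_vector_derivative_at_within)
    qed
  qed
qed

lemma zero_bilin_ind_imp:
  assumes "f \<in> L2" "g \<in> L2" "\<And>b. b \<ge> 0 \<Longrightarrow> L2_bilin f (ind b) = L2_bilin g (ind b)"
  shows "f \<doteq> g"
proof -
  have "AE x in halfline. x < real n \<longrightarrow> f x - g x = 0" for n :: nat
  proof (rule zero_integrals_imp_AE_zero)
    show "((\<lambda>x. f x - g x) has_integral 0) {0..a}" if "0 \<le> a" for a
      using has_integral_diff[OF bilin_ind_has_integral[OF assms(1)] bilin_ind_has_integral[OF assms(2)], of a] assms(3)[OF that] by simp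
  qed simp
  then have "AE x in halfline. \<forall>n::nat. x < real n \<longrightarrow> f x - g x = 0" by (simp only: AE_all_countable) blast
  then show ?thesis by eventually_elim (metis reals_Archimedean2 eq_iff_diff_eq_0)
qed


section \<open>The semigroup generated by the operator of a symbol\<close>

text \<open>A Borel representative \<open>q\<close> is fixed so that Fubini's theorem applies to its primitive.\<close>

locale A_op_semigroup =
  fixes M :: "complex \<Rightarrow> complex" and T :: "real \<Rightarrow> L2_op" and q :: "real \<Rightarrow> complex"
  assumes gen: "generates (A_op M) T"
    and q: "q \<in> supp_borel" "q \<in> L2"
    and q_laplace: "\<And>z. z \<in> right_half_plane \<Longrightarrow> has_laplace q z (M z / (1 + z))"
begin

lemma T_bounded: "t \<ge> 0 \<Longrightarrow> L2_bounded_op (T t)"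
  and T_zero: "f \<in> L2 \<Longrightarrow> T 0 f \<doteq> f"
  and T_add: "s \<ge> 0 \<Longrightarrow> t \<ge> 0 \<Longrightarrow> f \<in> L2 \<Longrightarrow> T (s + t) f \<doteq> T s (T t f)"
  and T_lim: "f \<in> L2 \<Longrightarrow> ((\<lambda>t. L2_norm (\<lambda>x. T t f x - f x)) \<longlongrightarrow> 0) (at_right 0)"
  and T_gen: "generator T = A_op M"
  using gen unfolding generates_def C0_semigroup_def by blast+

lemma T_L2: "t \<ge> 0 \<Longrightarrow> f \<in> L2 \<Longrightarrow> T t f \<in> L2"
  using T_bounded[of t] unfolding L2_bounded_op_def by blast

lemma T_linear:
  assumes "t \<ge> 0" "f \<in> L2" "g \<in> L2"
  shows "T t (\<lambda>x. a * f x + b * g x) \<doteq> (\<lambda>x. a * T t f x + b * T t g x)"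
  using T_bounded[OF assms(1)] assms unfolding L2_bounded_op_def by blast

lemma T_bound:
  assumes "t \<ge> 0"
  obtains C where "\<And>f. f \<in> L2 \<Longrightarrow> L2_norm (T t f) \<le> C * L2_norm f"
  using T_bounded[OF assms] unfolding L2_bounded_op_def by blast

lemma T_cong:
  assumes t: "t \<ge> 0" and fg: "f \<in> L2" "g \<in> L2" "f \<doteq> g"
  shows "T t f \<doteq> T t g"
proof -
  obtain C where C: "\<And>f. f \<in> L2 \<Longrightarrow> L2_norm (T t f) \<le> C * L2_norm f" using T_bound[OF t] by blast
  define h where "h = (\<lambda>x. 1 * f x + (-1) * g x)"
  have h: "h \<in> L2" unfolding h_def by (intro L2_add L2_cmult fg)
  have "cls h = 0" unfolding cls_zero[symmetric] using fg(3)
    by (subst cls_eq_iff[OF h L2_zero]) (auto simp: h_def elim: eventually_mono)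
  then have "L2_norm h = 0" using norm_cls[OF h] by simp
  then have "norm (cls (T t h)) \<le> 0" using C[OF h] norm_cls[OF T_L2[OF t h]] by simp
  then have "cls (T t h) = cls (\<lambda>_. 0)" by (simp add: cls_zero)
  then have "T t h \<doteq> (\<lambda>_. 0)" by (subst (asm) cls_eq_iff[OF T_L2[OF t h] L2_zero])
  moreover have "T t h \<doteq> (\<lambda>x. 1 * T t f x + (-1) * T t g x)" unfolding h_def by (rule T_linear[OF t fg(1,2)])
  ultimately show ?thesis by eventually_elim simp
qed

definition U :: "real \<Rightarrow> l2 \<Rightarrow> l2" where
  "U t x = cls (T t (rep_l2 x))"

lemma U_cls: "t \<ge> 0 \<Longrightarrow> f \<in> L2 \<Longrightarrow> U t (cls f) = cls (T t f)"
  unfolding U_def by (subst cls_eq_iff) (auto intro!: T_L2 rep_l2_L2 T_cong rep_l2_cls)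

lemma U_quotient_cls:
  assumes "e > 0" "f \<in> L2" "g \<in> L2"
  shows "norm ((U e (cls f) - cls f) /\<^sub>R e - cls g) = L2_norm (\<lambda>x. (T e f x - f x) / of_real e - g x)"
proof -
  have m: "T e f \<in> L2" "(\<lambda>x. T e f x - f x) \<in> L2" "(\<lambda>x. of_real (inverse e) * (T e f x - f x)) \<in> L2"
    using assms by (auto intro!: T_L2 L2_diff L2_cmult)
  have "(U e (cls f) - cls f) /\<^sub>R e - cls g = cls (\<lambda>x. of_real (inverse e) * (T e f x - f x) - g x)"
    using assms m by (simp only: U_cls less_imp_le cls_diff cls_scaleR)
  then show ?thesis using m assms by (simp add: norm_cls L2_diff divide_inverse mult.commute)
qed

lemma generator_iff:
  assumes "f \<in> L2" "g \<in> L2"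
  shows "(f, g) \<in> A_op M \<longleftrightarrow> ((\<lambda>e. (U e (cls f) - cls f) /\<^sub>R e) \<longlongrightarrow> cls g) (at_right 0)"
proof -
  have "((\<lambda>e. (U e (cls f) - cls f) /\<^sub>R e) \<longlongrightarrow> cls g) (at_right 0) \<longleftrightarrow>
    ((\<lambda>e. norm ((U e (cls f) - cls f) /\<^sub>R e - cls g)) \<longlongrightarrow> 0) (at_right 0)"
    by (subst tendsto_dist_iff) (simp add: dist_norm)
  also have "\<dots> \<longleftrightarrow> ((\<lambda>e. L2_norm (\<lambda>x. (T e f x - f x) / of_real e - g x)) \<longlongrightarrow> 0) (at_right 0)"
    by (rule tendsto_cong, rule eventually_at_rightI[of 0 1]) (use assms in \<open>auto simp: U_quotient_cls\<close>)
  also have "\<dots> \<longleftrightarrow> (f, g) \<in> generator T" using assms by (simp add: generator_def)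
  finally show ?thesis unfolding T_gen by simp
qed

sublocale U: strongly_continuous_semigroup U
proof (rule strongly_continuous_semigroup.intro)
  fix t :: real assume t: "t \<ge> 0"
  obtain C where C: "\<And>f. f \<in> L2 \<Longrightarrow> L2_norm (T t f) \<le> C * L2_norm f" using T_bound[OF t] by blast
  show "bounded_linear (U t)"
  proof (rule bounded_linear_intro[where K=C])
    show "U t (x + y) = U t x + U t y" for x y
    proof -
      obtain f g where *: "f \<in> L2" "x = cls f" "g \<in> L2" "y = cls g" by (metis l2_cases)
      have "T t (\<lambda>x. f x + g x) \<doteq> (\<lambda>x. T t f x + T t g x)" using T_linear[OF t *(1,3), of 1 1] by simp
      then have "cls (T t (\<lambda>x. f x + g x)) = cls (\<lambda>x. T t f x + T t g x)"
        by (subst cls_eq_iff) (auto intro!: T_L2[OF t] L2_add *)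
      then show ?thesis using * t by (simp add: cls_add U_cls L2_add T_L2)
    qed
    show "U t (r *\<^sub>R x) = r *\<^sub>R U t x" for r x
    proof -
      obtain f where *: "f \<in> L2" "x = cls f" by (metis l2_cases)
      have "T t (\<lambda>x. of_real r * f x) \<doteq> (\<lambda>x. of_real r * T t f x)" using T_linear[OF t *(1,1), of "of_real r" 0] by simp
      then have "cls (T t (\<lambda>x. of_real r * f x)) = cls (\<lambda>x. of_real r * T t f x)"
        by (subst cls_eq_iff) (auto intro!: T_L2[OF t] L2_cmult *)
      then show ?thesis using * t by (simp add: cls_scaleR U_cls L2_cmult T_L2)
    qed
    show "norm (U t x) \<le> norm x * C" for x
    proof -
      obtain f where *: "f \<in> L2" "x = cls f" by (metis l2_cases)
      then show ?thesis using C[OF *(1)] t by (simp add: U_cls norm_cls T_L2 mult.commute)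
    qed
  qed
next
  fix x :: l2
  obtain f where *: "f \<in> L2" "x = cls f" by (metis l2_cases)
  show "U 0 x = x" using * T_zero[OF *(1)] by (simp add: U_cls cls_eq_iff T_L2)
  show "U (s + t) x = U s (U t x)" if "s \<ge> 0" "t \<ge> 0" for s t
  proof -
    have "U (s + t) x = cls (T (s + t) f)" "U s (U t x) = cls (T s (T t f))"
      using that * by (simp_all add: U_cls T_L2)
    moreover have "cls (T (s + t) f) = cls (T s (T t f))"
      by (rule cls_eq_iff[THEN iffD2]) (use that * in \<open>auto intro!: T_L2 T_add\<close>)
    ultimately show ?thesis by simp
  qed
  have "\<forall>\<^sub>F t in at_right 0. L2_norm (\<lambda>u. T t f u - f u) = dist (U t x) x"
  proof (rule eventually_at_rightI[of 0 1])
    fix t :: real assume "t \<in> {0<..<1}"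
    then have t: "t \<ge> 0" by simp
    show "L2_norm (\<lambda>u. T t f u - f u) = dist (U t x) x"
      using * T_L2[OF t *(1)] by (simp only: dist_norm U_cls[OF t] cls_diff norm_cls L2_diff)
  qed simp
  with T_lim[OF *(1)] have "((\<lambda>t. dist (U t x) x) \<longlongrightarrow> 0) (at_right 0)"
    by (rule Lim_transform_eventually)
  then show "((\<lambda>t. U t x) \<longlongrightarrow> x) (at_right 0)" by (subst tendsto_dist_iff)
qed

text \<open>The graph of the generator in terms of classes; it coincides with \<open>A_op M\<close> by the lemma
\<open>generator_iff\<close>.\<close>

definition in_graph :: "l2 \<Rightarrow> l2 \<Rightarrow> bool" where
  "in_graph x y \<longleftrightarrow> ((\<lambda>e. (U e x - x) /\<^sub>R e) \<longlongrightarrow> y) (at_right 0)"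

lemma in_graph_orbit: "in_graph x y \<Longrightarrow> s \<ge> 0 \<Longrightarrow> in_graph (U s x) (U s y)"
  unfolding in_graph_def by (rule U.orbit_derivative(2))

lemma in_graph_orbit_integral: "t \<ge> 0 \<Longrightarrow> in_graph (U.orbit_integral t x) (U t x - x)"
  unfolding in_graph_def by (rule U.orbit_integral_generator)

text \<open>What membership in \<open>A_op M\<close> says about classes: \<open>x\<close> has a version \<open>w\<close> that is an antiderivative of
\<open>- y\<close>, and \<open>(x + y, q) = 0\<close> is the boundary condition \<open>(f - f', q) = 0\<close>. The function in the
definition of \<open>A_op\<close> is \<open>q\<close> by the uniqueness of Laplace transforms.\<close>

lemma in_graphD:
  assumes "in_graph x y"
  obtains w where "w \<doteq> rep_l2 x" "\<And>a b. 0 \<le> a \<Longrightarrow> a \<le> b \<Longrightarrow> (rep_l2 y has_integral (w a - w b)) {a..b}"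
    "bil (x + y) (cls q) = 0"
proof -
  have "(rep_l2 x, rep_l2 y) \<in> A_op M"
    using assms by (subst generator_iff) (auto simp: rep_l2_L2 in_graph_def)
  then obtain f' q' where f': "f' \<in> L2" "ac_with_derivative (rep_l2 x) f'" and y: "rep_l2 y = (\<lambda>x. - f' x)"
    and q': "q' \<in> L2" "\<And>z. z\<in>right_half_plane \<Longrightarrow> has_laplace q' z (M z / (1 + z))"
      "L2_bilin (\<lambda>u. rep_l2 x u - f' u) q' = 0"
    unfolding A_op_def by blast
  have "q' \<doteq> q"
    by (rule laplace_unique[of 0 _ "\<lambda>s. M (of_real s) / (1 + of_real s)"]) (auto intro!: q' q_laplace simp: right_half_plane_def)
  then have "cls q' = cls q" using q' q by (simp add: cls_eq_iff)
  moreover have "bil (x + y) (cls q') = 0"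
  proof -
    have "x + y = cls (\<lambda>u. rep_l2 x u - f' u)"
    proof -
      have "x + y = cls (rep_l2 x) + cls (rep_l2 y)" by simp
      also have "\<dots> = cls (\<lambda>u. rep_l2 x u + rep_l2 y u)" by (rule cls_add[OF rep_l2_L2 rep_l2_L2])
      finally show ?thesis by (simp only: y add_uminus_conv_diff)
    qed
    then show ?thesis using q' f' by (simp add: bil_cls L2_diff rep_l2_L2)
  qed
  moreover obtain w where w: "w \<doteq> rep_l2 x" "locally_absolutely_continuous w"
      "AE x in halfline. (w has_vector_derivative f' x) (at x)" using f'(2) unfolding ac_with_derivative_def by blast
  moreover have "(rep_l2 y has_integral (w a - w b)) {a..b}" if "0 \<le> a" "a \<le> b" for a b
    using has_integral_neg[OF locally_absolutely_continuous_FTC[OF w(2,3) that]] unfolding y by simp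
  ultimately show thesis using that by simp
qed

section \<open>The semigroup as a transport\<close>

text \<open>The orbit \<open>v s = U s x\<close> solves \<open>\<partial>\<^sub>s v + \<partial>\<^sub>u v = 0\<close>, so the mass over the moving window \<open>[s, b + s]\<close>
is constant. Its right derivative has two contributions: the time derivative of \<open>v\<close> gives
\<open>v (s) - v (b + s)\<close> by the fundamental theorem of calculus, the motion of the endpoints gives
\<open>v (b + s) - v (s)\<close>.\<close>

lemma transport_ind:
  assumes g: "in_graph x y" and s: "s \<ge> 0" and b: "b \<ge> 0"
  shows "bil (U s x) (cls (ind (b + s)) - cls (ind s)) = bil x (cls (ind b))"
proof -
  define X where "X c = cls (ind c)" for c
  define \<psi> where "\<psi> r = bil (U r x) (X (b + r) - X r)" for r
  have Xc: "((\<lambda>e. X (c + e)) \<longlongrightarrow> X c) (at_right 0)" if c: "c \<ge> 0" for c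
  proof -
    have "((\<lambda>b. X b) \<longlongrightarrow> X c) (at c within {0..})" using continuous_ind c by (auto simp: X_def continuous_on_def)
    then have "((\<lambda>b. X b) \<longlongrightarrow> X c) (at_right c)" by (rule tendsto_within_subset) (use c in auto)
    then show ?thesis unfolding filterlim_at_right_to_0[of _ _ c] by (simp add: add.commute)
  qed
  have cont: "continuous_on {0..s} \<psi>"
  proof -
    have X1: "continuous_on {0..s} (\<lambda>r. X (b + r))"
      unfolding X_def by (rule continuous_on_compose2[OF continuous_ind]) (use b in \<open>auto intro!: continuous_intros\<close>)
    have X2: "continuous_on {0..s} X" unfolding X_def by (rule continuous_on_subset[OF continuous_ind]) auto
    show ?thesis unfolding \<psi>_def
      by (intro bil.continuous_on U.continuous continuous_on_diff X1 X2)
  qed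
  have der: "((\<lambda>e. (\<psi> (r + e) - \<psi> r) /\<^sub>R e) \<longlongrightarrow> 0) (at_right 0)" if r: "r \<ge> 0" for r
  proof -
    obtain w where w: "w \<doteq> rep_l2 (U r x)"
      and wi: "\<And>a b. 0 \<le> a \<Longrightarrow> a \<le> b \<Longrightarrow> (rep_l2 (U r y) has_integral (w a - w b)) {a..b}"
      using in_graphD[OF in_graph_orbit[OF g r]] by metis
    have bilX: "bil z (X c) = L2_bilin (rep_l2 z) (ind c)" for z c
      using bil_cls[OF rep_l2_L2 ind_L2, of z c] by (simp add: X_def)
    have wcont: "continuous_on {0..c} w" for c
    proof (cases "c \<ge> 0")
      case True
      have "continuous_on {0..c} (\<lambda>u. integral {0..u} (rep_l2 (U r y)))"
        using wi[of 0 c] True by (intro indefinite_integral_continuous_1) (auto simp: integrable_on_def)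
      then have "continuous_on {0..c} (\<lambda>u. w 0 - integral {0..u} (rep_l2 (U r y)))" by (intro continuous_intros)
      then show ?thesis by (rule continuous_on_eq) (use wi[THEN integral_unique] in auto)
    qed simp
    define W where "W c = integral {0..c} w" for c
    have bilW: "bil (U r x) (X c) = W c" if "c \<ge> 0" for c
    proof -
      have "(rep_l2 (U r x) has_integral bil (U r x) (X c)) {0..c}"
        unfolding bilX by (rule bilin_ind_has_integral[OF rep_l2_L2])
      moreover have "AE u in lborel. u \<in> {0..c} \<longrightarrow> w u = rep_l2 (U r x) u"
        using w[unfolded AE_halfline_iff] AE_lborel_singleton[of 0] by eventually_elim auto
      ultimately have "(w has_integral bil (U r x) (X c)) {0..c}" by (simp only: has_integral_AE)
      then show ?thesis unfolding W_def by (simp add: integral_unique)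
    qed
    have Wd: "((\<lambda>e. (W (c + e) - W c) /\<^sub>R e) \<longlongrightarrow> w c) (at_right 0)" if c: "c \<ge> 0" for c
    proof -
      have "(W has_vector_derivative w c) (at c within {0..c+1})"
        unfolding W_def by (rule integral_has_vector_derivative[OF wcont]) (use c in auto)
      then have "(W has_vector_derivative w c) (at c within {c..c+1})"
        by (rule has_vector_derivative_within_subset) (use c in auto)
      then show ?thesis by (intro has_vector_derivative_at_rightD) (simp add: at_within_Icc_at_right)
    qed
    have gy: "bil (U r y) (X (b + r) - X r) = w r - w (b + r)"
    proof -
      have *: "bil (U r y) (X c) = w 0 - w c" if "c \<ge> 0" for c
        unfolding bilX using has_integral_unique[OF bilin_ind_has_integral[OF rep_l2_L2] wi[of 0 c]] that by simp
      show ?thesis using *[of r] *[of "b + r"] r b by (simp add: bil.diff_right)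
    qed
    have "((\<lambda>e. bil ((U (r + e) x - U r x) /\<^sub>R e) (X (b + r + e) - X (r + e))
        + ((W (b + r + e) - W (b + r)) /\<^sub>R e - (W (r + e) - W r) /\<^sub>R e)) \<longlongrightarrow>
       bil (U r y) (X (b + r) - X r) + (w (b + r) - w r)) (at_right 0)"
      by (intro tendsto_add tendsto_diff Wd bil.tendsto Xc U.orbit_derivative(1)[OF g[unfolded in_graph_def] r]) (use r b in auto)
    then have "((\<lambda>e. bil ((U (r + e) x - U r x) /\<^sub>R e) (X (b + r + e) - X (r + e))
        + ((W (b + r + e) - W (b + r)) /\<^sub>R e - (W (r + e) - W r) /\<^sub>R e)) \<longlongrightarrow> 0) (at_right 0)"
      by (simp add: gy)
    then show ?thesis
    proof (rule Lim_transform_eventually, intro eventually_at_rightI[of 0 1])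
      fix e :: real assume e: "e \<in> {0<..<1}"
      then have e0: "0 \<le> e" by simp
      have "\<psi> (r + e) - \<psi> r = bil (U (r + e) x - U r x) (X (b + r + e) - X (r + e))
        + ((bil (U r x) (X (b + r + e)) - bil (U r x) (X (b + r))) - (bil (U r x) (X (r + e)) - bil (U r x) (X r)))"
        by (simp add: \<psi>_def bil.diff_left bil.diff_right add.assoc)
      also have "\<dots> = bil (U (r + e) x - U r x) (X (b + r + e) - X (r + e)) + ((W (b + r + e) - W (b + r)) - (W (r + e) - W r))"
        using e0 r b by (simp add: bilW)
      finally show "bil ((U (r + e) x - U r x) /\<^sub>R e) (X (b + r + e) - X (r + e))
        + ((W (b + r + e) - W (b + r)) /\<^sub>R e - (W (r + e) - W r) /\<^sub>R e) = (\<psi> (r + e) - \<psi> r) /\<^sub>R e"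
        by (simp only: bil.scaleR_left scaleR_add_right[symmetric] scaleR_diff_right[symmetric])
    qed simp
  qed
  have "\<psi> s = \<psi> 0" by (rule right_derivative_zero_const[OF s cont]) (use der in auto)
  moreover have "X 0 = 0"
  proof -
    have "ind 0 \<doteq> (\<lambda>_. 0)" unfolding AE_halfline_iff by (auto simp: ind_def)
    then show ?thesis unfolding X_def cls_zero[symmetric] by (subst cls_eq_iff) (auto simp: ind_L2 L2_zero)
  qed
  ultimately show ?thesis by (simp add: \<psi>_def X_def U.zero)
qed

lemma right_shift_ind: 
  assumes "s \<ge> 0" "b \<ge> 0" shows "cls (right_shift s (ind b)) = cls (ind (b + s)) - cls (ind s)"
proof -
  have "AE x in lborel. x \<noteq> s" by (rule AE_lborel_singleton)
  then have "right_shift s (ind b) \<doteq> (\<lambda>x. ind (b + s) x - ind s x)" unfolding AE_halfline_iff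
    by eventually_elim (use assms in \<open>auto simp: right_shift_def ind_def indicator_def\<close>)
  then show ?thesis using assms by (simp add: cls_diff ind_L2 cls_eq_iff right_shift_L2 L2_diff)
qed

text \<open>The indicators determine the shifted orbit almost everywhere.\<close>

lemma transport_graph:
  assumes xy: "in_graph x y" and g: "g \<in> L2" and t: "t \<ge> 0"
  shows "bil (U t x) (cls (right_shift t g)) = bil x (cls g)"
proof -
  define v where "v = rep_l2 (U t x)"
  have v: "v \<in> L2" "U t x = cls v" by (auto simp: v_def rep_l2_L2)
  have x: "rep_l2 x \<in> L2" "x = cls (rep_l2 x)" by (auto simp: rep_l2_L2)
  have "(\<lambda>u. v (u + t)) \<doteq> rep_l2 x"
  proof (rule zero_bilin_ind_imp[OF left_shift_L2[OF v(1) t] x(1)])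
    fix b :: real assume b: "b \<ge> 0"
    have "L2_bilin (\<lambda>u. v (u + t)) (ind b) = bil (U t x) (cls (right_shift t (ind b)))"
      unfolding v(2) using L2_bilin_right_shift[OF v(1) ind_L2 t] by (simp add: bil_cls v right_shift_L2 ind_L2 t)
    also have "\<dots> = bil x (cls (ind b))"
      unfolding right_shift_ind[OF t b] by (rule transport_ind[OF xy t b])
    also have "\<dots> = L2_bilin (rep_l2 x) (ind b)" using bil_cls[OF x(1) ind_L2] by simp
    finally show "L2_bilin (\<lambda>u. v (u + t)) (ind b) = L2_bilin (rep_l2 x) (ind b)" .
  qed
  then have "L2_bilin (\<lambda>u. v (u + t)) g = L2_bilin (rep_l2 x) g"
    by (intro L2_bilin_cong left_shift_L2 v x g t) auto
  then have "L2_bilin v (right_shift t g) = L2_bilin (rep_l2 x) g"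
    unfolding L2_bilin_right_shift[OF v(1) g t] .
  then show ?thesis
    using bil_cls[OF v(1) right_shift_L2[OF g t]] bil_cls[OF x(1) g] unfolding v(2)[symmetric] x(2)[symmetric] by (simp only:)
qed

text \<open>This is the identity \<open>T\<^sub>t\<^sup>* S\<^sub>t = 1\<close> in bilinear form: above \<open>t\<close>, the function \<open>T\<^sub>t f\<close> is the right
shift of \<open>f\<close>. It extends from the domain of the generator by density.\<close>

lemma transport:
  assumes g: "g \<in> L2" and t: "t \<ge> 0"
  shows "bil (U t x) (cls (right_shift t g)) = bil x (cls g)"
proof -
  interpret bounded_linear "U t" using U.bl[OF t] .
  have L1: "((\<lambda>e. bil (U t (U.orbit_integral e x /\<^sub>R e)) (cls (right_shift t g))) \<longlongrightarrow> bil (U t x) (cls (right_shift t g))) (at_right 0)"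
    by (intro bil.tendsto tendsto tendsto_const U.orbit_integral_average)
  have L2: "((\<lambda>e. bil (U.orbit_integral e x /\<^sub>R e) (cls g)) \<longlongrightarrow> bil x (cls g)) (at_right 0)"
    by (intro bil.tendsto tendsto_const U.orbit_integral_average)
  have ev: "\<forall>\<^sub>F e in at_right 0. bil (U.orbit_integral e x /\<^sub>R e) (cls g) = bil (U t (U.orbit_integral e x /\<^sub>R e)) (cls (right_shift t g))"
    by (intro eventually_at_rightI[of 0 1])
       (auto simp: scaleR bil.scaleR_left transport_graph[OF in_graph_orbit_integral g t])
  from Lim_transform_eventually[OF L2 ev] show ?thesis
    by (rule tendsto_unique[OF trivial_limit_at_right_real L1])
qed

text \<open>Write \<open>u = T\<^sub>t x\<close> and let \<open>g\<close> be the integral of the orbit of \<open>x\<close> over \<open>[0, t]\<close>. It lies in the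
domain of the generator, so the boundary condition reads \<open>(g, q) + (u - x, q) = 0\<close>. By the lemma
\<open>transport\<close> the pairing of \<open>u\<close> with \<open>q - S\<^sub>t q\<close> is \<open>(u - x, q)\<close>, and its pairing with
\<open>\<integral>\<^sub>0\<^sup>t S\<^sub>r q dr\<close> is \<open>\<integral>\<^sub>0\<^sup>t (T\<^bsub>t - r\<^esub> x, q) dr = (g, q)\<close>. The two add up to \<open>0\<close>.\<close>

lemma bil_cocycle_zero:
  assumes t: "t \<ge> 0"
  shows "bil (U t x) (cls (\<lambda>u. (q u - right_shift t q u) + (primitive q u - right_shift t (primitive q) u))) = 0"
proof -
  have S: "right_shift r q \<in> L2" if "r \<ge> 0" for r using right_shift_L2[OF q(2) that] .
  have P: "(\<lambda>u. primitive q u - right_shift t (primitive q) u) \<in> L2" by (rule primitive_minus_shift_L2[OF q t])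
  obtain v where v: "v \<in> L2" "U t x = cls v" by (metis l2_cases)
  have eq: "L2_bilin v (right_shift r q) = bil (U (t - r) x) (cls q)" if r: "r \<in> {0..t}" for r
  proof -
    have "L2_bilin v (right_shift r q) = bil (U t x) (cls (right_shift r q))" using v S[of r] r by (simp add: bil_cls)
    also have "U t x = U r (U (t - r) x)" using U.add[of r "t - r" x] r by simp
    also have "bil \<dots> (cls (right_shift r q)) = bil (U (t - r) x) (cls q)" by (rule transport) (use q r in auto)
    finally show ?thesis .
  qed
  have cont0: "continuous_on {0..t} (\<lambda>r. bil (U r x) (cls q))"
    by (intro bil.continuous_on U.continuous continuous_on_const)
  have "continuous_on {0..t} (\<lambda>r. bil (U (t - r) x) (cls q))"
    by (rule continuous_on_compose2[OF cont0]) (auto intro!: continuous_intros)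
  then have cont: "continuous_on {0..t} (\<lambda>r. L2_bilin v (right_shift r q))"
    by (rule continuous_on_eq) (use eq in auto)
  have "bil (U t x) (cls (\<lambda>u. primitive q u - right_shift t (primitive q) u)) = integral {0..t} (\<lambda>r. L2_bilin v (right_shift r q))"
    using bilin_primitive_minus_shift[OF v(1) q t cont] v P by (simp add: bil_cls)
  also have "\<dots> = integral {0..t} (\<lambda>r. bil (U (t - r) x) (cls q))"
    by (rule integral_cong) (use eq in auto)
  also have "\<dots> = integral {0..t} (\<lambda>r. bil (U r x) (cls q))"
  proof -
    have "integral {0..t} (\<lambda>r. bil (U r x) (cls q)) = integral {-t..-0} (\<lambda>r. bil (U (- r) x) (cls q))"
      using integral_reflect[where f="\<lambda>r. bil (U r x) (cls q)" and a=0 and b=t] by (simp only: box_real)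
    also have "\<dots> = integral {-t..0} (\<lambda>r. bil (U (- r) x) (cls q))" by simp
    also have "\<dots> = integral {-t+t..0+t} (\<lambda>r. bil (U (t - r) x) (cls q))"
      using integral_shift_Icc_real[of "-t" 0 "\<lambda>r. bil (U (t - r) x) (cls q)" t] by (simp add: o_def)
    finally show ?thesis by simp
  qed
  also have "\<dots> = bil (U.orbit_integral t x) (cls q)"
    unfolding U.orbit_integral_def using integral_linear[OF U.U_integrable[OF order_refl, where x=x and b=t] bil.bounded_linear_left[of "cls q"]] by (simp add: o_def)
  finally have 1: "bil (U t x) (cls (\<lambda>u. primitive q u - right_shift t (primitive q) u)) = bil (U.orbit_integral t x) (cls q)" .
  have "bil (U.orbit_integral t x + (U t x - x)) (cls q) = 0" using in_graphD[OF in_graph_orbit_integral[OF t, of x]] by metis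
  then have 2: "bil (U.orbit_integral t x) (cls q) = bil x (cls q) - bil (U t x) (cls q)" by (simp add: bil.add_left bil.diff_left algebra_simps eq_neg_iff_add_eq_0)
  have "cls (\<lambda>u. (q u - right_shift t q u) + (primitive q u - right_shift t (primitive q) u))
    = (cls q - cls (right_shift t q)) + cls (\<lambda>u. primitive q u - right_shift t (primitive q) u)"
    using q S[OF t] P by (simp add: cls_diff cls_add L2_diff)
  then show ?thesis using 1 2 transport[OF q(2) t, of x] by (simp add: bil.add_right bil.diff_right)
qed

section \<open>Additive cocycles\<close>

text \<open>On the half-line, the antiderivative of \<open>ind a\<close> that vanishes beyond \<open>a\<close>.\<close>

definition ramp :: "real \<Rightarrow> real \<Rightarrow> complex" where
  "ramp a x = - of_real (max 0 (a - max 0 x))"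

lemma ramp_measurable [measurable]: "ramp a \<in> borel_measurable borel"
  unfolding ramp_def[abs_def] by measurable

lemma ramp_L2: assumes "a \<ge> 0" shows "ramp a \<in> L2"
proof (rule L2_bound)
  show "ramp a \<in> borel_measurable halfline" by (rule borel_imp_halfline_measurable) measurable
  show "integrable halfline (\<lambda>x. a\<^sup>2 * (norm (ind a x))\<^sup>2)"
    using L2D(2)[OF ind_L2[of a]] by simp
  show "AE x in halfline. (norm (ramp a x))\<^sup>2 \<le> a\<^sup>2 * (norm (ind a x))\<^sup>2"
    unfolding AE_halfline_iff using assms by (intro AE_I2) (auto simp: ramp_def ind_def indicator_def intro!: power_mono)
qed

lemma ramp_Lipschitz: "norm (ramp a x - ramp a y) \<le> 1 * \<bar>x - y\<bar>"
proof -
  have "norm (ramp a x - ramp a y) = \<bar>max 0 (a - max 0 y) - max 0 (a - max 0 x)\<bar>"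
    unfolding ramp_def by (simp flip: of_real_diff of_real_minus)
  also have "\<dots> \<le> \<bar>x - y\<bar>" by (auto simp: max_def)
  finally show ?thesis by simp
qed

lemma ramp_derivative:
  assumes x: "x > 0" "x \<noteq> a" and a: "a \<ge> 0" shows "(ramp a has_vector_derivative ind a x) (at x)"
proof (cases "x < a")
  case True
  have "((\<lambda>x. complex_of_real (x - a)) has_vector_derivative of_real 1) (at x)"
    by (intro has_vector_derivative_of_real) (auto intro!: derivative_eq_intros)
  then have "((\<lambda>x. complex_of_real (x - a)) has_vector_derivative ind a x) (at x)"
    using True x by (simp add: ind_def)
  then show ?thesis
  proof (rule has_vector_derivative_transform_within_open[where S="{0<..<a}"])
    show "complex_of_real (u - a) = ramp a u" if "u \<in> {0<..<a}" for u
      using that by (simp add: ramp_def)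
  qed (use True x in auto)
next
  case False
  have "((\<lambda>x. 0::complex) has_vector_derivative ind a x) (at x)" using False x by (simp add: ind_def)
  then show ?thesis
  proof (rule has_vector_derivative_transform_within_open[where S="{a<..}"])
    show "0 = ramp a u" if "u \<in> {a<..}" for u using that a by (simp add: ramp_def)
  qed (use False x in auto)
qed

text \<open>Each ramp satisfies the smoothness conditions of the domain, and two of them can be combined so
that the single boundary condition holds.\<close>

lemma ramp_combination_graph:
  assumes a: "a \<ge> 0" "b \<ge> 0"
    and zero: "\<alpha> * L2_bilin (\<lambda>x. ramp a x - ind a x) q + \<beta> * L2_bilin (\<lambda>x. ramp b x - ind b x) q = 0"
  shows "in_graph (cls (\<lambda>x. \<alpha> * ramp a x + \<beta> * ramp b x)) (cls (\<lambda>x. - (\<alpha> * ind a x + \<beta> * ind b x)))"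
proof -
  let ?f = "\<lambda>x. \<alpha> * ramp a x + \<beta> * ramp b x" and ?f' = "\<lambda>x. \<alpha> * ind a x + \<beta> * ind b x"
  have f: "?f \<in> L2" "?f' \<in> L2" by (intro L2_add L2_cmult ramp_L2 ind_L2 a)+
  have ac: "locally_absolutely_continuous ?f"
    unfolding locally_absolutely_continuous_def
  proof (intro allI impI Lipschitz_imp_absolutely_continuous_on)
    fix x y :: real
    have "norm (?f x - ?f y) = norm (\<alpha> * (ramp a x - ramp a y) + \<beta> * (ramp b x - ramp b y))"
      by (simp add: algebra_simps)
    also have "\<dots> \<le> norm \<alpha> * norm (ramp a x - ramp a y) + norm \<beta> * norm (ramp b x - ramp b y)"
      by (rule order_trans[OF norm_triangle_ineq]) (simp add: norm_mult)
    also have "\<dots> \<le> norm \<alpha> * (1 * \<bar>x - y\<bar>) + norm \<beta> * (1 * \<bar>x - y\<bar>)"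
      by (intro add_mono mult_left_mono ramp_Lipschitz) auto
    finally show "norm (?f x - ?f y) \<le> (norm \<alpha> + norm \<beta>) * \<bar>x - y\<bar>" by (simp add: algebra_simps)
  qed
  have der: "AE x in halfline. (?f has_vector_derivative ?f' x) (at x)"
    unfolding AE_halfline_iff using AE_lborel_singleton[of a] AE_lborel_singleton[of b]
  proof eventually_elim
    case (elim x)
    show ?case
      by (intro impI has_vector_derivative_add has_vector_derivative_mult_right ramp_derivative) (use elim a in auto)
  qed
  have acd: "ac_with_derivative ?f ?f'" unfolding ac_with_derivative_def
    by (intro exI[of _ ?f] conjI ac der) simp
  have bz: "L2_bilin (\<lambda>x. ?f x - ?f' x) q = 0"
  proof -
    have i: "integrable halfline (\<lambda>x. (ramp c x - ind c x) * q x)" if "c \<ge> 0" for c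
      by (intro L2_mult_integrable L2_diff ramp_L2 ind_L2 q that)
    have "L2_bilin (\<lambda>x. ?f x - ?f' x) q
      = (\<integral>x. \<alpha> * ((ramp a x - ind a x) * q x) + \<beta> * ((ramp b x - ind b x) * q x) \<partial>halfline)"
      unfolding L2_bilin_def by (rule Bochner_Integration.integral_cong) (auto simp: algebra_simps)
    also have "\<dots> = \<alpha> * L2_bilin (\<lambda>x. ramp a x - ind a x) q + \<beta> * L2_bilin (\<lambda>x. ramp b x - ind b x) q"
      unfolding L2_bilin_def using i[OF a(1)] i[OF a(2)] by simp
    finally show ?thesis using zero by simp
  qed
  have "(?f, \<lambda>x. - ?f' x) \<in> A_op M" unfolding A_op_def mem_Collect_eq
    by (intro exI[of _ ?f] exI[of _ ?f'] conjI bexI[of _ q] ballI q_laplace refl f acd bz q)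
  then show ?thesis unfolding in_graph_def generator_iff[OF f(1) L2_uminus[OF f(2)]] .
qed

text \<open>On ramps the functional \<open>f \<mapsto> (f - f', q)\<close> of the boundary condition is minus integration of
\<open>q + primitive q\<close> over \<open>[0, a]\<close>.\<close>

lemma ramp_bilin:
  assumes a: "a \<ge> 0"
  shows "integrable halfline (\<lambda>x. ind a x * (q x + primitive q x))"
    "L2_bilin (\<lambda>x. ramp a x - ind a x) q = - (\<integral>x. ind a x * (q x + primitive q x) \<partial>halfline)"
proof -
  have [measurable]: "q \<in> borel_measurable borel" using q by (auto intro: supp_borelD)
  have rq: "integrable halfline (\<lambda>x. ramp a x * q x)" by (intro L2_mult_integrable ramp_L2 q a)
  have iq: "integrable halfline (\<lambda>x. ind a x * q x)" by (intro L2_mult_integrable ind_L2 q)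
  have K: "has_bochner_integral lborel (\<lambda>x. indicator {y..} x * indicat_real {0..a} x) (max 0 (a - y))" if "y > 0" for y
  proof -
    have "(\<lambda>x. indicator {y..} x * indicat_real {0..a} x) = indicat_real {y..a}"
      using that by (auto simp: indicator_def fun_eq_iff)
    then show ?thesis by (cases "y \<le> a") (auto simp: has_bochner_integral_iff max_def)
  qed
  have rq0: "q x * of_real (max 0 (a - x)) = - (ramp a x * q x)" for x
    using supp_borelD(2)[OF q(1), of x] by (cases "x \<le> 0") (auto simp: ramp_def)
  have l: "integrable halfline (\<lambda>x. ramp a x * q x) \<longleftrightarrow> integrable lborel (\<lambda>x. ramp a x * q x)"
    "(\<integral>x. ramp a x * q x \<partial>halfline) = (\<integral>x. ramp a x * q x \<partial>lborel)"
    by (rule halfline_integral_lborel; use supp_borelD(2)[OF q(1)] in simp)+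
  have int: "integrable lborel (\<lambda>y. q y * of_real (max 0 (a - y)))"
    unfolding rq0 using rq l by simp
  have P: "integrable halfline (\<lambda>x. primitive q x * of_real (indicat_real {0..a} x))"
    "(\<integral>x. primitive q x * of_real (indicat_real {0..a} x) \<partial>halfline) = - (\<integral>x. ramp a x * q x \<partial>halfline)"
    using primitive_Fubini[OF q(1) _ _ K int] l(2) unfolding rq0 by auto
  have ind: "primitive q x * of_real (indicat_real {0..a} x) = ind a x * primitive q x" for x
    by (simp add: ind_def indicator_def)
  show "integrable halfline (\<lambda>x. ind a x * (q x + primitive q x))"
    using P(1) iq unfolding ind by (simp add: distrib_left)
  have "L2_bilin (\<lambda>x. ramp a x - ind a x) q = (\<integral>x. ramp a x * q x \<partial>halfline) - (\<integral>x. ind a x * q x \<partial>halfline)"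
    unfolding L2_bilin_def using rq iq by (simp add: left_diff_distrib)
  also have "\<dots> = - (\<integral>x. ind a x * (q x + primitive q x) \<partial>halfline)"
    using P iq unfolding ind by (simp add: distrib_left)
  finally show "L2_bilin (\<lambda>x. ramp a x - ind a x) q = - (\<integral>x. ind a x * (q x + primitive q x) \<partial>halfline)" .
qed

text \<open>Take \<open>F\<close> in the domain of the generator with \<open>F = 0\<close> beyond \<open>N\<close>. Comparing the two expansions of
\<open>d\<^bsub>s + e\<^esub>\<close> gives \<open>d\<^sub>s - S\<^sub>e d\<^sub>s = d\<^sub>e - S\<^sub>s d\<^sub>e\<close>. Both terms on the right are orthogonal to \<open>T\<^sub>e F\<close>:
the first because \<open>T\<^sub>e\<^sup>* d\<^sub>e = 0\<close>, the second because its pairing is that of \<open>F\<close> with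
\<open>S\<^bsub>s - e\<^esub> d\<^sub>e\<close>, whose support starts beyond \<open>N\<close>. On the left \<open>(T\<^sub>e F, S\<^sub>e d\<^sub>s) = (F, d\<^sub>s)\<close>, so
\<open>(T\<^sub>e F - F, d\<^sub>s) = 0\<close>; it remains to divide by \<open>e\<close> and let \<open>e\<close> tend to \<open>0\<close>.\<close>

lemma cocycle_orthogonal_graph:
  assumes d: "real_additive_cocycle right_shift T d"
    and f: "f \<in> L2" "in_graph (cls f) y" and vanish: "AE x in halfline. N < x \<longrightarrow> f x = 0"
    and s: "s \<ge> N + 1" "N \<ge> 0"
  shows "bil y (cls (d s)) = 0"
proof -
  have dL: "d t \<in> L2_real" "d t \<in> L2" if "t > 0" for t
    using d that by (auto simp: real_additive_cocycle_def L2_real_def)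
  have orth: "bil (U e x) (cls (d e)) = 0" if e: "e > 0" for e x
  proof -
    obtain h where h: "h \<in> L2" "x = cls h" by (metis l2_cases)
    have "L2_inner (T e h) (d e) = L2_inner h (\<lambda>_. 0)"
      using d e h unfolding real_additive_cocycle_def G0_def L2_adjoint_def by blast
    then show ?thesis using h e dL[OF e] L2_inner_real[OF T_L2[OF less_imp_le[OF e] h(1)] dL(1)[OF e]]
      by (simp add: U_cls bil_cls T_L2) (simp add: L2_inner_def)
  qed
  have s0: "s > 0" using s by linarith
  have key: "bil (U e (cls f) - cls f) (cls (d s)) = 0" if e: "0 < e" "e < 1" for e
  proof -
    have se: "s - e \<ge> 0" "s - e \<ge> N" using s e by auto
    have c1: "d (s + e) \<doteq> (\<lambda>x. d s x + right_shift s (d e) x)" "d (e + s) \<doteq> (\<lambda>x. d e x + right_shift e (d s) x)"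
      using d e s0 by (auto simp: real_additive_cocycle_def)
    have R: "right_shift s (d e) \<in> L2" "right_shift e (d s) \<in> L2" "right_shift (s - e) (d e) \<in> L2"
      using dL e s0 se by (auto intro!: right_shift_L2)
    have "(\<lambda>x. d s x + right_shift s (d e) x) \<doteq> (\<lambda>x. d e x + right_shift e (d s) x)"
      using c1 by eventually_elim (simp add: add.commute)
    then have "cls (d s) + cls (right_shift s (d e)) = cls (d e) + cls (right_shift e (d s))"
      using dL R e s0 by (simp add: cls_add cls_eq_iff L2_add)
    then have "cls (d s) = cls (d e) + cls (right_shift e (d s)) - cls (right_shift s (d e))"
      by (simp add: eq_diff_eq)
    then have "bil (U e (cls f)) (cls (d s)) = bil (U e (cls f)) (cls (d e)) + bil (U e (cls f)) (cls (right_shift e (d s)))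
      - bil (U e (cls f)) (cls (right_shift s (d e)))" by (simp only: bil.add_right bil.diff_right)
    also have "bil (U e (cls f)) (cls (d e)) = 0" by (rule orth[OF e(1)])
    also have "bil (U e (cls f)) (cls (right_shift e (d s))) = bil (cls f) (cls (d s))"
      by (rule transport) (use dL s0 e in auto)
    also have "bil (U e (cls f)) (cls (right_shift s (d e))) = 0"
    proof -
      have "right_shift s (d e) = right_shift e (right_shift (s - e) (d e))"
        using right_shift_right_shift[of e "s - e" "d e"] e se by simp
      then have "bil (U e (cls f)) (cls (right_shift s (d e))) = bil (cls f) (cls (right_shift (s - e) (d e)))"
        using transport[OF R(3), of e "cls f"] e by simp
      also have "\<dots> = L2_bilin f (right_shift (s - e) (d e))" by (rule bil_cls[OF f(1) R(3)])
      also have "\<dots> = 0" unfolding L2_bilin_def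
      proof (rule integral_eq_zero_AE)
        have "AE x in halfline. x \<noteq> N" unfolding AE_halfline_iff using AE_lborel_singleton[of N] by eventually_elim simp
        with vanish show "AE x in halfline. f x * right_shift (s - e) (d e) x = 0"
          by eventually_elim (use se in \<open>auto simp: right_shift_def\<close>)
      qed
      finally show ?thesis .
    qed
    finally show ?thesis by (simp add: bil.diff_left)
  qed
  have "((\<lambda>e. bil ((U e (cls f) - cls f) /\<^sub>R e) (cls (d s))) \<longlongrightarrow> bil y (cls (d s))) (at_right 0)"
    using f(2) unfolding in_graph_def by (intro bil.tendsto tendsto_const)
  moreover have "((\<lambda>e. bil ((U e (cls f) - cls f) /\<^sub>R e) (cls (d s))) \<longlongrightarrow> 0) (at_right 0)"
    by (rule tendsto_eventually, rule eventually_at_rightI[of 0 1]) (auto simp: bil.scaleR_left key)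
  ultimately show ?thesis by (rule tendsto_unique[OF trivial_limit_at_right_real])
qed


lemma right_shift_real:
  assumes "AE x in halfline. f x \<in> \<real>" "t \<ge> 0" shows "AE x in halfline. right_shift t f x \<in> \<real>"
proof -
  have "f \<doteq> (\<lambda>x. of_real (Re (f x)))" using assms(1) by eventually_elim (simp add: complex_is_Real_iff complex_eq_iff)
  from right_shift_cong[OF this assms(2)] show ?thesis
    by eventually_elim (auto simp: right_shift_def)
qed

text \<open>The cocycle identity holds pointwise by telescoping, and the annihilation by \<open>T\<^sub>t\<^sup>*\<close> is the lemma
\<open>bil_cocycle_zero\<close>.\<close>

lemma real_additive_cocycle_difference:
  assumes c: "c \<in> borel_measurable halfline" "c \<doteq> (\<lambda>x. q x + primitive q x)" "AE x in halfline. c x \<in> \<real>"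
  shows "real_additive_cocycle right_shift T (\<lambda>t x. c x - right_shift t c x)"
proof -
  define ct where "ct t x = c x - right_shift t c x" for t x
  define p where "p t x = (q x - right_shift t q x) + (primitive q x - right_shift t (primitive q) x)" for t x
  have pL: "p t \<in> L2" if "t > 0" for t
    unfolding p_def[abs_def] using q that
    by (intro L2_add L2_diff right_shift_L2 primitive_minus_shift_L2) auto
  have cp: "ct t \<doteq> p t" if "t > 0" for t
  proof -
    have "right_shift t c \<doteq> right_shift t (\<lambda>x. q x + primitive q x)" using c(2) that by (intro right_shift_cong) auto
    with c(2) show ?thesis by eventually_elim (simp add: ct_def p_def right_shift_def)
  qed
  have cm: "ct t \<in> borel_measurable halfline" if "t > 0" for t
    unfolding ct_def[abs_def] using c(1) that by (intro borel_measurable_diff right_shift_measurable) auto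
  have cL: "ct t \<in> L2" if "t > 0" for t
    by (rule L2_bound[OF cm[OF that] L2D(2)[OF pL[OF that]]]) (use cp[OF that] in eventually_elim, simp)
  have cR: "ct t \<in> L2_real" if "t > 0" for t
  proof -
    have "AE x in halfline. right_shift t c x \<in> \<real>" using c(3) that by (intro right_shift_real) auto
    with c(3) have "AE x in halfline. ct t x \<in> \<real>" by eventually_elim (simp add: ct_def)
    then show ?thesis using cL[OF that] by (simp add: L2_real_def)
  qed
  have orth: "L2_inner (T t h) (ct t) = 0" if t: "t > 0" and h: "h \<in> L2" for t h
  proof -
    have Th: "T t h \<in> L2" using T_L2 t h by simp
    have "L2_inner (T t h) (ct t) = L2_bilin (T t h) (ct t)" by (rule L2_inner_real[OF Th cR[OF t]])
    also have "\<dots> = L2_bilin (T t h) (p t)" by (rule L2_bilin_cong[OF Th Th _ cL[OF t] pL[OF t] cp[OF t]]) simp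
    also have "\<dots> = bil (U t (cls h)) (cls (p t))" using t h Th pL[OF t] by (simp add: U_cls bil_cls)
    also have "\<dots> = 0" unfolding p_def[abs_def] by (rule bil_cocycle_zero) (use t in simp)
    finally show ?thesis .
  qed
  have cocycle: "ct (s + t) x = ct s x + right_shift s (ct t) x" if "s > 0" "t > 0" for s t x
    using that by (auto simp: ct_def right_shift_def diff_diff_eq)
  show ?thesis unfolding real_additive_cocycle_def ct_def[symmetric]
  proof (intro conjI allI impI ballI)
    show "ct t \<in> L2_real" if "t > 0" for t by (rule cR[OF that])
    show "(\<lambda>t. L2_inner (ct t) g) \<in> borel_measurable halfline" if "g \<in> L2_real" for g
      unfolding ct_def[abs_def] using that L2D(1) by (intro measurable_shift_pairing c(1)) (auto simp: L2_real_def)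
    show "ct t \<in> G0 T t" if "t > 0" for t
      using cR[OF that] cL[OF that] orth[OF that] L2_zero
      by (simp add: G0_def L2_adjoint_def) (simp add: L2_inner_def)
    show "ct (s + t) \<doteq> (\<lambda>x. ct s x + right_shift s (ct t) x)" if "s > 0" "t > 0" for s t
      using cocycle[OF that] by simp
  qed
qed

text \<open>Up to \<open>N + 1\<close> a cocycle is the difference \<open>\<kappa> - S\<^sub>t \<kappa>\<close> of the single function \<open>\<kappa> = d\<^bsub>N + 1\<^esub>\<close>. Testing
the lemma \<open>cocycle_orthogonal_graph\<close> with combinations of two ramps shows that whenever
\<open>\<alpha> \<integral>\<^sub>0\<^sup>a c + \<beta> \<integral>\<^sub>0\<^sup>b c = 0\<close> also \<open>\<alpha> \<integral>\<^sub>0\<^sup>a \<kappa> + \<beta> \<integral>\<^sub>0\<^sup>b \<kappa> = 0\<close>. Hence the primitive of \<open>\<kappa>\<close> is a multiple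
of that of \<open>c\<close>, the factor is a quotient of real numbers, and it does not depend on \<open>N\<close>.\<close>

lemma real_additive_cocycle_unique:
  assumes c: "c \<in> borel_measurable halfline" "c \<doteq> (\<lambda>x. q x + primitive q x)" "AE x in halfline. c x \<in> \<real>"
    and d: "real_additive_cocycle right_shift T d"
  shows "\<exists>k::real. \<forall>t>0. d t \<doteq> (\<lambda>x. of_real k * (c x - right_shift t c x))"
proof -
  have dL: "d t \<in> L2_real" "d t \<in> L2" if "t > 0" for t
    using d that by (auto simp: real_additive_cocycle_def L2_real_def)
  have d_add: "d (s + t) \<doteq> (\<lambda>x. d s x + right_shift s (d t) x)" if "s > 0" "t > 0" for s t
    using d that by (simp add: real_additive_cocycle_def)
  define \<kappa> where "\<kappa> N = d (real N + 1)" for N :: nat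
  have \<kappa>: "\<kappa> N \<in> L2" for N unfolding \<kappa>_def by (intro dL) simp
  define C where "C a = (\<integral>x. ind a x * c x \<partial>halfline)" for a
  define K where "K N a = L2_bilin (\<kappa> N) (ind a)" for N a
  have indm: "ind a \<in> borel_measurable halfline" for a using L2D(1)[OF ind_L2] .
  have qp: "(\<lambda>x. q x + primitive q x) \<in> borel_measurable halfline"
    using borel_imp_halfline_measurable supp_borelD(1)[OF q(1)] supp_borelD(1)[OF primitive_supp_borel(2)[OF q(1)]]
    by (intro borel_measurable_add) auto
  have indc_AE: "AE x in halfline. ind a x * c x = ind a x * (q x + primitive q x)" for a
    using c(2) by eventually_elim simp
  have C_int: "integrable halfline (\<lambda>x. ind a x * c x)" if "a \<ge> 0" for a
    using ramp_bilin(1)[OF that] integrable_cong_AE[OF borel_measurable_times[OF indm c(1)] borel_measurable_times[OF indm qp] indc_AE]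
    by simp
  have C_ramp: "L2_bilin (\<lambda>x. ramp a x - ind a x) q = - C a" if "a \<ge> 0" for a
    unfolding C_def ramp_bilin(2)[OF that]
    by (simp only: integral_cong_AE[OF borel_measurable_times[OF indm c(1)] borel_measurable_times[OF indm qp] indc_AE])
  have C_real: "C a \<in> \<real>" if "a \<ge> 0" for a unfolding C_def
    by (rule AE_real_integral[OF C_int[OF that]]) (use c(3) in eventually_elim, auto simp: ind_def indicator_def)
  have K_real: "K N a \<in> \<real>" for N a unfolding K_def L2_bilin_def
  proof (rule AE_real_integral[OF L2_mult_integrable[OF \<kappa> ind_L2]])
    have "AE x in halfline. \<kappa> N x \<in> \<real>" using dL(1)[of "real N + 1"] by (simp add: \<kappa>_def L2_real_def)
    then show "AE x in halfline. \<kappa> N x * ind a x \<in> \<real>" by eventually_elim (auto simp: ind_def indicator_def)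
  qed
  have CK: "\<alpha> * K N a + \<beta> * K N b = 0"
    if ab: "0 \<le> a" "a \<le> real N" "0 \<le> b" "b \<le> real N" and z: "\<alpha> * C a + \<beta> * C b = 0" for \<alpha> \<beta> N a b
  proof -
    have g: "in_graph (cls (\<lambda>x. \<alpha> * ramp a x + \<beta> * ramp b x)) (cls (\<lambda>x. - (\<alpha> * ind a x + \<beta> * ind b x)))"
    proof (rule ramp_combination_graph)
      have "\<alpha> * (- C a) + \<beta> * (- C b) = - (\<alpha> * C a + \<beta> * C b)" by simp
      then show "\<alpha> * L2_bilin (\<lambda>x. ramp a x - ind a x) q + \<beta> * L2_bilin (\<lambda>x. ramp b x - ind b x) q = 0"
        unfolding C_ramp[OF ab(1)] C_ramp[OF ab(3)] z by simp
    qed (use ab in auto)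
    have "bil (cls (\<lambda>x. - (\<alpha> * ind a x + \<beta> * ind b x))) (cls (d (real N + 1))) = 0"
    proof (rule cocycle_orthogonal_graph[OF d _ g])
      show "(\<lambda>x. \<alpha> * ramp a x + \<beta> * ramp b x) \<in> L2" by (intro L2_add L2_cmult ramp_L2 ab)
      show "AE x in halfline. real N < x \<longrightarrow> \<alpha> * ramp a x + \<beta> * ramp b x = 0"
        using ab by (intro AE_I2) (auto simp: ramp_def)
    qed auto
    moreover have "(\<lambda>x. - (\<alpha> * ind a x + \<beta> * ind b x)) \<in> L2"
      by (intro L2_uminus L2_add L2_cmult ind_L2)
    ultimately have "L2_bilin (\<lambda>x. - (\<alpha> * ind a x + \<beta> * ind b x)) (\<kappa> N) = 0"
      using bil_cls[OF _ \<kappa>[of N]] unfolding \<kappa>_def by (simp only:)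
    moreover have "L2_bilin (\<lambda>x. - (\<alpha> * ind a x + \<beta> * ind b x)) (\<kappa> N)
      = (\<integral>x. - (\<alpha> * (\<kappa> N x * ind a x) + \<beta> * (\<kappa> N x * ind b x)) \<partial>halfline)"
      unfolding L2_bilin_def by (rule Bochner_Integration.integral_cong) (auto simp: algebra_simps)
    moreover have "\<dots> = - (\<alpha> * K N a + \<beta> * K N b)"
      unfolding K_def L2_bilin_def using L2_mult_integrable[OF \<kappa> ind_L2] by simp
    ultimately have "- (\<alpha> * K N a + \<beta> * K N b) = 0" by (simp only:)
    then show ?thesis by (simp only: neg_equal_0_iff_equal)
  qed
  obtain k :: real and N0 :: nat where kN: "\<And>N a. N \<ge> N0 \<Longrightarrow> 0 \<le> a \<Longrightarrow> a \<le> real N \<Longrightarrow> K N a = of_real k * C a"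
  proof (cases "\<exists>a\<ge>0. C a \<noteq> 0")
    case False
    show thesis
    proof (rule that[of 0 0])
      fix N :: nat and a :: real assume a: "0 \<le> a" "a \<le> real N"
      then have "1 * K N a + 0 * K N a = 0" using False by (intro CK) auto
      then show "K N a = of_real 0 * C a" by simp
    qed
  next
    case True
    then obtain a0 where a0: "a0 \<ge> 0" "C a0 \<noteq> 0" by blast
    obtain N0 :: nat where N0: "a0 \<le> real N0" using real_arch_simple by blast
    \<comment> \<open>The functions \<open>\<kappa> N\<close> extend each other, so the factor found for \<open>N0\<close> is the same for all larger \<open>N\<close>.\<close>
    have Kc: "K N a0 = K N0 a0" if "N \<ge> N0" for N
    proof (cases "N = N0")
      case False
      then have pos: "real N - real N0 > 0" using that by simp
      have "d ((real N0 + 1) + (real N - real N0)) \<doteq> (\<lambda>x. d (real N0 + 1) x + right_shift (real N0 + 1) (d (real N - real N0)) x)"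
        by (rule d_add) (use pos in auto)
      then have "AE x in halfline. \<kappa> N x * ind a0 x = \<kappa> N0 x * ind a0 x"
        by eventually_elim (use N0 in \<open>auto simp: \<kappa>_def right_shift_def ind_def indicator_def add.commute\<close>)
      then show ?thesis unfolding K_def L2_bilin_def
        by (intro integral_cong_AE borel_measurable_integrable L2_mult_integrable \<kappa> ind_L2)
    qed simp
    define k where "k = Re (K N0 a0 / C a0)"
    have k: "of_real k = K N0 a0 / C a0"
      unfolding k_def using K_real[of N0 a0] C_real[OF a0(1)] by (auto elim!: Reals_cases simp flip: of_real_divide)
    show thesis
    proof (rule that[of N0 k])
      fix N :: nat and a :: real assume N: "N \<ge> N0" and a: "0 \<le> a" "a \<le> real N"
      have "C a0 * K N a + (- C a) * K N a0 = 0"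
        using a a0 N0 N by (intro CK) (auto simp: mult.commute)
      moreover have "K N a0 = of_real k * C a0" using a0(2) Kc[OF N] k by simp
      ultimately have "C a0 * K N a = C a0 * (of_real k * C a)" by (simp add: algebra_simps)
      then show "K N a = of_real k * C a" using a0(2) by simp
    qed
  qed
  have \<kappa>c: "AE x in halfline. x < real N \<longrightarrow> \<kappa> N x - of_real k * c x = 0" if N: "N \<ge> N0" for N
  proof (rule zero_integrals_imp_AE_zero)
    fix a assume a: "0 \<le> a" "a \<le> real N"
    have "(\<kappa> N has_integral K N a) {0..a}" unfolding K_def by (rule bilin_ind_has_integral[OF \<kappa>])
    moreover have "(c has_integral C a) {0..a}"
      using halfline_indicator_has_integral[of 0 a c] C_int[OF a(1)] by (simp add: C_def ind_def)
    ultimately have "((\<lambda>x. \<kappa> N x - of_real k * c x) has_integral (K N a - of_real k * C a)) {0..a}"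
      by (intro has_integral_diff has_integral_mult_right)
    then show "((\<lambda>x. \<kappa> N x - of_real k * c x) has_integral 0) {0..a}" by (simp add: kN[OF N a])
  qed simp
  show ?thesis
  proof (intro exI[of _ k] allI impI)
    fix t :: real assume t: "t > 0"
    have *: "AE x in halfline. x < real N \<longrightarrow> d t x = of_real k * (c x - right_shift t c x)" if N: "N \<ge> N0" for N
    proof -
      have 1: "d ((real N + 1) + t) \<doteq> (\<lambda>x. d (real N + 1) x + right_shift (real N + 1) (d t) x)"
        "d (t + (real N + 1)) \<doteq> (\<lambda>x. d t x + right_shift t (d (real N + 1)) x)"
        by (rule d_add; use t in simp)+
      \<comment> \<open>Truncation makes the equality hold on the whole half-line, as shifting it requires.\<close>
      have "(\<lambda>x. if x < real N then \<kappa> N x else 0) \<doteq> (\<lambda>x. if x < real N then of_real k * c x else 0)"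
        using \<kappa>c[OF N] by eventually_elim simp
      then have 2: "right_shift t (\<lambda>x. if x < real N then \<kappa> N x else 0) \<doteq> right_shift t (\<lambda>x. if x < real N then of_real k * c x else 0)"
        by (rule right_shift_cong) (use t in simp)
      show ?thesis using 1 2 \<kappa>c[OF N]
      proof eventually_elim
        case (elim x)
        show ?case
        proof
          assume x: "x < real N"
          have "d t x = \<kappa> N x - right_shift t (\<kappa> N) x"
            using elim(1,2) x by (simp add: add.commute \<kappa>_def right_shift_def split: if_splits)
          also have "right_shift t (\<kappa> N) x = of_real k * right_shift t c x"
            using elim(3) x t by (auto simp: right_shift_def split: if_splits)
          also have "\<kappa> N x = of_real k * c x" using elim(4) x by simp
          finally show "d t x = of_real k * (c x - right_shift t c x)" by (simp add: right_diff_distrib)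
        qed
      qed
    qed
    have "AE x in halfline. x < real (N + N0) \<longrightarrow> d t x = of_real k * (c x - right_shift t c x)" for N
      by (rule *) simp
    then have "AE x in halfline. \<forall>N. x < real (N + N0) \<longrightarrow> d t x = of_real k * (c x - right_shift t c x)"
      by (simp only: AE_all_countable) blast
    then show "d t \<doteq> (\<lambda>x. of_real k * (c x - right_shift t c x))"
    proof eventually_elim
      case (elim x)
      obtain N :: nat where "x < real N" using reals_Archimedean2 by blast
      then have "x < real (N + N0)" by simp
      then show ?case using elim by blast
    qed
  qed
qed

end

text \<open>The pair \<open>(0, 0)\<close> belongs to every generator, and its membership in \<open>A_op M\<close> already asserts that
\<open>M z / (1 + z)\<close> is the Laplace transform of some \<open>q\<close> in \<open>L\<^sup>2\<close>.\<close>

lemma A_op_symbol_exists: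
  assumes "generates (A_op M) T"
  obtains q where "A_op_semigroup M T q"
proof -
  have gen: "generator T = A_op M" and bd: "\<And>t. t \<ge> 0 \<Longrightarrow> L2_bounded_op (T t)"
    using assms by (auto simp: generates_def C0_semigroup_def)
  have zero: "L2_norm (\<lambda>x. (T t (\<lambda>_. 0) x - 0) / of_real t - 0) = 0" if t: "t > 0" for t
  proof -
    have "\<forall>f\<in>L2. T t f \<in> L2" and lin: "\<forall>f\<in>L2. \<forall>g\<in>L2. \<forall>a b. T t (\<lambda>x. a * f x + b * g x) \<doteq> (\<lambda>x. a * T t f x + b * T t g x)"
      using bd[of t] t unfolding L2_bounded_op_def by auto
    then have TL: "(\<lambda>x. T t (\<lambda>_. 0) x / of_real t) \<in> L2" using L2_zero L2_divide by blast
    have "T t (\<lambda>_. 0) \<doteq> (\<lambda>_. 0)" using lin[rule_format, OF L2_zero L2_zero, of 0 0] by simp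
    then have "(\<lambda>x. T t (\<lambda>_. 0) x / of_real t) \<doteq> (\<lambda>_. 0)" by eventually_elim simp
    then have "cls (\<lambda>x. T t (\<lambda>_. 0) x / of_real t) = 0"
      unfolding cls_zero[symmetric] using TL L2_zero by (simp add: cls_eq_iff)
    then show ?thesis using norm_cls[OF TL] by simp
  qed
  have "((\<lambda>t. L2_norm (\<lambda>x. (T t (\<lambda>_. 0) x - 0) / of_real t - 0)) \<longlongrightarrow> 0) (at_right 0)"
    by (rule tendsto_eventually, rule eventually_at_rightI[of 0 1]) (use zero in auto)
  then have "((\<lambda>_. 0), (\<lambda>_. 0)) \<in> generator T" unfolding generator_def using L2_zero by simp
  then obtain q0 where q0: "q0 \<in> L2" "\<And>z. z \<in> right_half_plane \<Longrightarrow> has_laplace q0 z (M z / (1 + z))"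
    unfolding gen A_op_def by blast
  obtain q where q: "q \<in> supp_borel" "q \<in> L2" "q0 \<doteq> q" using L2_supp_borel[OF q0(1)] .
  have "A_op_semigroup M T q"
    by unfold_locales (use assms q q0(2) has_laplace_cong_AE[OF q(3) L2D(1)[OF q(2)]] in auto)
  then show thesis by (rule that)
qed

theorem lemma5p4:
  fixes M :: "complex \<Rightarrow> complex"
    and T :: "real \<Rightarrow> (real \<Rightarrow> complex) \<Rightarrow> (real \<Rightarrow> complex)"
    and c :: "real \<Rightarrow> complex"
  assumes "M \<in> HD2_real"
    and "generates (A_op M) T"
    and "c \<in> L2_loc"
    and "\<exists>\<sigma>>0. \<forall>z. Re z > \<sigma> \<longrightarrow> has_laplace c z (M z / z)"
  shows "real_additive_cocycle right_shift T (\<lambda>t x. c x - right_shift t c x) \<and>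
    (\<forall>d. real_additive_cocycle right_shift T d \<longrightarrow>
      (\<exists>k::real. \<forall>t>0. d t \<doteq> (\<lambda>x. of_real k * (c x - right_shift t c x))))"
proof -
  obtain q where "A_op_semigroup M T q" using A_op_symbol_exists[OF assms(2)] .
  then interpret A_op_semigroup M T q .
  obtain \<sigma> where \<sigma>: "\<sigma> > 0" "\<And>z. Re z > \<sigma> \<Longrightarrow> has_laplace c z (M z / z)" using assms(4) by blast
  have cs: "has_laplace c (of_real s) (M (of_real s) / of_real s)" if "s > \<sigma>" for s
    using \<sigma> that by simp
  have cm: "c \<in> borel_measurable halfline" using has_laplace_measurable[OF cs[of "\<sigma> + 1"]] by simp
  have lq: "has_laplace (\<lambda>x. q x + primitive q x) (of_real s) (M (of_real s) / of_real s)" if s: "s > \<sigma>" for s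
  proof -
    have s0: "s > 0" using s \<sigma>(1) by simp
    have ql: "has_laplace q (of_real s) (M (of_real s) / (1 + of_real s))"
      using s0 by (intro q_laplace) (simp add: right_half_plane_def)
    have nz: "(1 + complex_of_real s) \<noteq> 0" "complex_of_real s \<noteq> 0"
      using s0 by (auto simp: complex_eq_iff)
    \<comment> \<open>This is \<open>1 / (1 + s) + 1 / ((1 + s) s) = 1 / s\<close>: the primitive contributes the second term.\<close>
    have "M (of_real s) / (1 + of_real s) + M (of_real s) / (1 + of_real s) / of_real s = M (of_real s) / complex_of_real s"
      using nz by (simp add: divide_simps) (simp add: algebra_simps)
    then show ?thesis using has_laplace_add[OF ql has_laplace_primitive[OF q(1) s0 ql]] by simp
  qed
  have cq: "c \<doteq> (\<lambda>x. q x + primitive q x)"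
    by (rule laplace_unique[where \<sigma>=\<sigma> and F="\<lambda>s. M (of_real s) / of_real s"]) (erule cs, erule lq)
  have lcnj: "has_laplace (\<lambda>x. cnj (c x)) (of_real s) (M (of_real s) / of_real s)" if s: "s > \<sigma>" for s
  proof -
    have "cnj (M (of_real s)) = M (cnj (of_real s))"
      using assms(1) s \<sigma>(1) by (simp add: HD2_real_def right_half_plane_def)
    then show ?thesis using has_laplace_cnj[OF cs[OF s]] by simp
  qed
  have "(\<lambda>x. cnj (c x)) \<doteq> c"
    by (rule laplace_unique[where \<sigma>=\<sigma> and F="\<lambda>s. M (of_real s) / of_real s"]) (erule lcnj, erule cs)
  then have cr: "AE x in halfline. c x \<in> \<real>" by eventually_elim (simp add: Reals_cnj_iff)
  show ?thesis
    using real_additive_cocycle_difference[OF cm cq cr] real_additive_cocycle_unique[OF cm cq cr] by blast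
qed

end
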